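(* Let $K$ be either a number field, with $C=\mathrm{Spec}(\mathcal{O}_K)$, or the function field $k(C)$ of a complete nonsingular curve $C$ over an algebraically closed field $k$. Let $p$ be a closed point of $C$. Let $n,d\ge 1$ and let $\varphi:\mathbb{P}^n\to\mathbb{P}^n$ be a morphism defined over $K$, given by $n+1$ homogeneous polynomials of degree $d$ without common zero in $\mathbb{P}^n(\overline K)$. Let $[\mathbf{a}_0,\dots,\mathbf{a}_n]$ be a presentation of $\varphi$ with respect to a choice of homogeneous coordinates $[X_0,\dots,X_n]$ on $\mathbb{P}^n$ over $K$. If the presentation $[\mathbf{a}_0,\dots,\mathbf{a}_n]$ is semi-stable at $p$, then the presentation $[\mathbf{a}_0,\dots,\mathbf{a}_n]$ is minimal at $p$.
   Context: Presentations. Put $N=(n+1)\binom{n+d}{d}-1$. With respect to homogeneous coordinates $[X_0,\dots,X_n]$ on $\mathbb{P}^n$ over $K$, $\varphi$ is written $[F_0,\dots,F_n]$ with $F_i\in K[X_0,\dots,X_n]$ homogeneous of degree $d$. Let $\mathbf{a}_i$ be the tuple of the $\binom{n+d}{d}$ coefficients of $F_i$. The point $[\mathbf{a}_0,\dots,\mathbf{a}_n]\in\mathbb{P}^N(K)$ is the presentation of $\varphi$ with respect to $[X_0,\dots,X_n]$; it is determined by the choice of coordinates, while the tuple $(\mathbf{a}_0,\dots,\mathbf{a}_n)$ is determined only up to a common nonzero scalar. Resultant. $\rho=\rho(\mathbf{a}_0,\dots,\mathbf{a}_n)$ is the (Macaulay) resultant of $n+1$ forms of degree $d$ in $n+1$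 variables, a polynomial with integer coefficients, homogeneous of total degree $(n+1)d^n$ in the coefficients, equal to $1$ on $(X_0^d,\dots,X_n^d)$; over any field it is nonzero exactly when the forms have no common zero in $\mathbb{P}^n$ over the algebraic closure. Action. A change of coordinates by an invertible $(n+1)\times(n+1)$ matrix $\Gamma$ sends the coefficients of $F=(F_0,\dots,F_n)$ to the coefficients $(\mathbf{a}_0^\Gamma,\dots,\mathbf{a}_n^\Gamma)$ of $\mathrm{adj}(\Gamma)\cdot F(\Gamma X)$, where $\mathrm{adj}(\Gamma)$ is the adjugate matrix. This induces an action of $\mathrm{PGL}_{n+1}$ on $\mathbb{P}^N$, and the presentations of $\varphi$ are exactly the points in the $\mathrm{PGL}_{n+1}(K)$-orbit of one of them. Normalization and reduction. Let $\mathcal{O}_p$ be the local ring of $C$ at $p$, $\kappa(p)$ its residue field, and $\mathrm{ord}_p$ the normalized discrete valuation. The tuple $(\mathbf{a}_0,\dots,\mathbf{a}_n)$ is normalized at $p$ if all its entries lie in $\mathcal{O}_p$ and not all of them vanish modulo $p$. A presentation always has representatives normalized at $p$, and its reduction $[\mathbf{a}_0(p),\dots,\mathbf{a}_n(p)]\in\mathbb{P}^N(\kappa(p))$ is obtained by reducing a normalized representative modulo $p$. Semi-stability. $(\mathbb{P}^N)^{ss}\subset\mathbb{P}^N$ is the open subscheme (over $\mathbb{Z}$) of GIT semi-stable points for the conjugation action of $\mathrm{SL}_{n+1}$, in which $\Gamma\in\mathrm{SL}_{n+1}$ sends the coefficients of $F=(F_0,\dots,F_n)$ to the coefficients of $\mathrm{adj}(\Gamma)\cdot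 F(\Gamma X)$. Concretely, let $A_d=\mathbb{Z}[\mathbf{a}_0,\dots,\mathbf{a}_n]$ be the polynomial ring in the $N+1$ coefficient variables, and $A_d^{\mathrm{SL}_{n+1}}$ the subring of polynomials invariant under the group scheme $\mathrm{SL}_{n+1}$; a point of $\mathbb{P}^N$ with values in a field is semi-stable if and only if some homogeneous $f\in A_d^{\mathrm{SL}_{n+1}}$ of positive degree does not vanish at it. The presentation $[\mathbf{a}_0,\dots,\mathbf{a}_n]$ is semi-stable at $p$ if its reduction $[\mathbf{a}_0(p),\dots,\mathbf{a}_n(p)]$ lies in $(\mathbb{P}^N)^{ss}(\kappa(p))$. Minimality. For a choice of coordinates $[X_0,\dots,X_n]$ with corresponding presentation represented by a tuple $(\mathbf{a}_0,\dots,\mathbf{a}_n)$ normalized at $p$, set $(R_{\varphi,[X_0,\dots,X_n]})_p=\mathrm{ord}_p(\rho(\mathbf{a}_0,\dots,\mathbf{a}_n))$. The presentation is minimal at $p$ if $(R_{\varphi,[X_0,\dots,X_n]})_p$ is minimal among all choices of homogeneous coordinates on $\mathbb{P}^n$ over $K$. *)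

theory Defs
  imports
    "HOL-Library.Poly_Mapping"
    "HOL-Library.Extended"
    "HOL-Algebra.QuotRing"
    "HOL-Algebra.Subrings"
    "HOL-Algebra.Algebraic_Closure_Type"
    "Jordan_Normal_Form.Determinant"
begin

section \<open>Polynomials in several variables\<close>

type_synonym ('v, 'a) mpol = "('v \<Rightarrow>\<^sub>0 nat) \<Rightarrow>\<^sub>0 'a"

abbreviation mconst :: "'a::zero \<Rightarrow> ('v, 'a) mpol"
  where "mconst c \<equiv> Poly_Mapping.single 0 c"

abbreviation mvar :: "'v \<Rightarrow> ('v, 'a::{zero,one}) mpol"
  where "mvar v \<equiv> Poly_Mapping.single (Poly_Mapping.single v 1) 1"

definition mp_eval :: "('c::zero \<Rightarrow> 'b::comm_ring_1) \<Rightarrow> ('v \<Rightarrow> 'b) \<Rightarrow> ('v, 'c) mpol \<Rightarrow> 'b"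
  where "mp_eval h x P =
    (\<Sum>\<mu>\<in>Poly_Mapping.keys P. h (Poly_Mapping.lookup P \<mu>) *
       (\<Prod>v\<in>Poly_Mapping.keys \<mu>. x v ^ Poly_Mapping.lookup \<mu> v))"

definition mon_degree :: "('v \<Rightarrow>\<^sub>0 nat) \<Rightarrow> nat"
  where "mon_degree \<mu> = (\<Sum>v\<in>Poly_Mapping.keys \<mu>. Poly_Mapping.lookup \<mu> v)"

text \<open>Exponents of the monomials of degree \<open>d\<close> in \<open>X\<^sub>0, \<dots>, X\<^sub>n\<close>.\<close>

definition monoms :: "nat \<Rightarrow> nat \<Rightarrow> (nat \<Rightarrow>\<^sub>0 nat) set"
  where "monoms n d = {\<alpha>. Poly_Mapping.keys \<alpha> \<subseteq> {..n} \<and> mon_degree \<alpha> = d}"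

definition forms :: "'a::zero set \<Rightarrow> nat \<Rightarrow> nat \<Rightarrow> (nat, 'a) mpol set"
  where "forms k n d = {G. \<forall>\<alpha>\<in>Poly_Mapping.keys G. \<alpha> \<in> monoms n d \<and> Poly_Mapping.lookup G \<alpha> \<in> k}"


section \<open>Tuples of forms, their coefficients, and the action\<close>

text \<open>
  A tuple \<open>F = (F\<^sub>0, \<dots>, F\<^sub>n)\<close> is a function on \<open>nat\<close> of which only the values at
  \<open>i \<le> n\<close> matter. The coefficient variable \<open>(i, \<alpha>)\<close> stands for the coefficient of \<open>X\<^sup>\<alpha>\<close> in
  \<open>F\<^sub>i\<close>; the entries of the tuple \<open>(\<a>\<^sub>0, \<dots>, \<a>\<^sub>n)\<close> are the values of \<open>coeffs_of F\<close> on
  \<open>coeff_vars n d\<close>.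
\<close>

type_synonym cvar = "nat \<times> (nat \<Rightarrow>\<^sub>0 nat)"

definition coeff_vars :: "nat \<Rightarrow> nat \<Rightarrow> cvar set"
  where "coeff_vars n d = {..n} \<times> monoms n d"

definition coeffs_of :: "(nat \<Rightarrow> (nat, 'a::zero) mpol) \<Rightarrow> cvar \<Rightarrow> 'a"
  where "coeffs_of F = (\<lambda>(i, \<alpha>). Poly_Mapping.lookup (F i) \<alpha>)"

definition forms_with_coeffs ::
    "nat \<Rightarrow> nat \<Rightarrow> (cvar \<Rightarrow> 'a::comm_ring_1) \<Rightarrow> nat \<Rightarrow> (nat, 'a) mpol"
  where "forms_with_coeffs n d a i = (\<Sum>\<alpha>\<in>monoms n d. Poly_Mapping.single \<alpha> (a (i, \<alpha>)))"

definition scale_forms ::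
    "'a::comm_ring_1 \<Rightarrow> (nat \<Rightarrow> (nat, 'a) mpol) \<Rightarrow> nat \<Rightarrow> (nat, 'a) mpol"
  where "scale_forms c F i = mconst c * F i"

text \<open>The tuple \<open>adj(\<Gamma>) \<cdot> F(\<Gamma>X)\<close>, over an arbitrary commutative ring.\<close>

definition conj_forms ::
    "nat \<Rightarrow> 'a::comm_ring_1 mat \<Rightarrow> (nat \<Rightarrow> (nat, 'a) mpol) \<Rightarrow> nat \<Rightarrow> (nat, 'a) mpol"
  where "conj_forms n \<Gamma> F i =
    (\<Sum>j\<le>n. mconst (adj_mat \<Gamma> $$ (i, j)) *
       mp_eval mconst (\<lambda>l. \<Sum>s\<le>n. mconst (\<Gamma> $$ (l, s)) * mvar s) (F j))"

definition proj_morphism :: "nat \<Rightarrow> nat \<Rightarrow> (nat \<Rightarrow> (nat, 'a::field) mpol) \<Rightarrow> bool"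
  where "proj_morphism n d \<Phi> \<longleftrightarrow>
    (\<forall>i\<le>n. \<Phi> i \<in> forms UNIV n d) \<and>
    \<not> (\<exists>z :: nat \<Rightarrow> 'a alg_closure. (\<exists>i\<le>n. z i \<noteq> 0) \<and> (\<forall>i\<le>n. mp_eval to_ac z (\<Phi> i) = 0))"

text \<open>
  \<open>F\<close> represents the presentation of the morphism \<open>\<Phi>\<close> with respect to some choice of
  homogeneous coordinates.
\<close>

definition presentation ::
    "nat \<Rightarrow> (nat \<Rightarrow> (nat, 'a::field) mpol) \<Rightarrow> (nat \<Rightarrow> (nat, 'a) mpol) \<Rightarrow> bool"
  where "presentation n \<Phi> F \<longleftrightarrow>
    (\<exists>\<Gamma> c. \<Gamma> \<in> carrier_mat (n + 1) (n + 1) \<and> invertible_mat \<Gamma> \<and> c \<noteq> 0 \<and>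
       (\<forall>i\<le>n. F i = scale_forms c (conj_forms n \<Gamma> \<Phi>) i))"


section \<open>The Macaulay resultant\<close>

text \<open>
  Macaulay's definition: with \<open>t = (n+1)(d-1)+1\<close>, take the matrix of the map
  \<open>(G\<^sub>0, \<dots>, G\<^sub>n) \<mapsto> \<Sum>\<^sub>i G\<^sub>i F\<^sub>i\<close> from tuples of forms of degree \<open>t - d\<close> to forms of degree \<open>t\<close>,
  where the \<open>F\<^sub>i\<close> are the generic forms of degree \<open>d\<close>. The resultant is the greatest common
  divisor, in the ring of integer polynomials in the coefficients of the \<open>F\<^sub>i\<close>, of the maximal
  minors of this matrix; its sign is fixed by the value \<open>1\<close> at \<open>(X\<^sub>0\<^sup>d, \<dots>, X\<^sub>n\<^sup>d)\<close>.
\<close>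

definition macaulay_degree :: "nat \<Rightarrow> nat \<Rightarrow> nat"
  where "macaulay_degree n d = (n + 1) * (d - 1) + 1"

definition macaulay_entry ::
    "nat \<Rightarrow> nat \<Rightarrow> (nat \<Rightarrow>\<^sub>0 nat) \<Rightarrow> nat \<times> (nat \<Rightarrow>\<^sub>0 nat) \<Rightarrow> (cvar, int) mpol"
  where "macaulay_entry n d \<gamma> = (\<lambda>(i, \<beta>).
    Poly_Mapping.lookup (Poly_Mapping.single \<beta> 1 * forms_with_coeffs n d mvar i) \<gamma>)"

text \<open>
  Rows are enumerated by \<open>e\<close> and columns are selected by \<open>c\<close>; different enumerations only change
  signs, and a non-injective \<open>c\<close> only contributes \<open>0\<close>.
\<close>

definition macaulay_minors :: "nat \<Rightarrow> nat \<Rightarrow> (cvar, int) mpol set"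
  where "macaulay_minors n d =
    (let t = macaulay_degree n d; r = card (monoms n t) in
      {det (mat r r (\<lambda>(u, v). macaulay_entry n d (e u) (c v))) | e c.
         bij_betw e {..<r} (monoms n t) \<and> c ` {..<r} \<subseteq> {..n} \<times> monoms n (t - d)})"

definition resultant_poly :: "nat \<Rightarrow> nat \<Rightarrow> (cvar, int) mpol"
  where "resultant_poly n d = (THE \<rho>.
    (\<forall>\<Delta>\<in>macaulay_minors n d. \<rho> dvd \<Delta>) \<and>
    (\<forall>g. (\<forall>\<Delta>\<in>macaulay_minors n d. g dvd \<Delta>) \<longrightarrow> g dvd \<rho>) \<and>
    mp_eval of_int (\<lambda>(i, \<alpha>). if \<alpha> = Poly_Mapping.single i d then 1 else 0) \<rho> = (1::int))"

definition resultant_of :: "nat \<Rightarrow> nat \<Rightarrow> (nat \<Rightarrow> (nat, 'a::comm_ring_1) mpol) \<Rightarrow> 'a"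
  where "resultant_of n d F = mp_eval of_int (coeffs_of F) (resultant_poly n d)"


section \<open>Invariants and semi-stability\<close>

text \<open>
  Let \<open>A = \<int>[\<a>\<^sub>0, \<dots>, \<a>\<^sub>n]\<close>. Invariance under the group scheme \<open>SL\<^bsub>n+1\<^esub>\<close> means that the
  coaction \<open>A \<rightarrow> A \<otimes> O(SL\<^bsub>n+1\<^esub>)\<close> sends \<open>f\<close> to \<open>f \<otimes> 1\<close>, where \<open>A \<otimes> O(SL\<^bsub>n+1\<^esub>)\<close> is the
  quotient of \<open>A[\<Gamma>\<^sub>0\<^sub>0, \<dots>, \<Gamma>\<^sub>n\<^sub>n]\<close> by the ideal generated by \<open>det \<Gamma> - 1\<close>. The variables \<open>Inl v\<close>
  are those of \<open>A\<close> and \<open>Inr (i, j)\<close> is the matrix entry \<open>\<Gamma>\<^sub>i\<^sub>j\<close>.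
\<close>

type_synonym cgvar = "cvar + nat \<times> nat"

definition generic_mat :: "nat \<Rightarrow> (cgvar, int) mpol mat"
  where "generic_mat n = mat (n + 1) (n + 1) (\<lambda>(i, j). mvar (Inr (i, j)))"

definition coaction :: "nat \<Rightarrow> nat \<Rightarrow> (cvar, int) mpol \<Rightarrow> (cgvar, int) mpol"
  where "coaction n d f =
    mp_eval of_int
      (coeffs_of (conj_forms n (generic_mat n) (forms_with_coeffs n d (\<lambda>v. mvar (Inl v))))) f"

definition SL_invariants :: "nat \<Rightarrow> nat \<Rightarrow> (cvar, int) mpol set"
  where "SL_invariants n d =
    {f. (\<forall>\<mu>\<in>Poly_Mapping.keys f. Poly_Mapping.keys \<mu> \<subseteq> coeff_vars n d) \<and>
        (det (generic_mat n) - 1) dvd (coaction n d f - mp_eval of_int (\<lambda>v. mvar (Inl v)) f)}"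

definition int_eval :: "('r, 's) ring_scheme \<Rightarrow> ('v \<Rightarrow> 'r) \<Rightarrow> ('v, int) mpol \<Rightarrow> 'r"
  where "int_eval R b f =
    (\<Oplus>\<^bsub>R\<^esub>\<mu>\<in>Poly_Mapping.keys f. [Poly_Mapping.lookup f \<mu>] \<cdot>\<^bsub>R\<^esub>
       (\<Otimes>\<^bsub>R\<^esub>v\<in>Poly_Mapping.keys \<mu>. b v [^]\<^bsub>R\<^esub> Poly_Mapping.lookup \<mu> v))"

definition semistable_point :: "('r, 's) ring_scheme \<Rightarrow> nat \<Rightarrow> nat \<Rightarrow> (cvar \<Rightarrow> 'r) \<Rightarrow> bool"
  where "semistable_point \<kappa> n d b \<longleftrightarrow>
    (\<exists>f\<in>SL_invariants n d. \<exists>D>0. (\<forall>\<mu>\<in>Poly_Mapping.keys f. mon_degree \<mu> = D) \<and>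
       int_eval \<kappa> b f \<noteq> \<zero>\<^bsub>\<kappa>\<^esub>)"


section \<open>Discrete valuation rings in a field\<close>

text \<open>
  A local ring with fraction field \<open>'a\<close> is given by its set \<open>\<O>\<close> of elements; its maximal ideal
  consists of the non-units (recall \<^term>\<open>inverse 0 = 0\<close>).
\<close>

definition subring_of :: "'a::field set \<Rightarrow> 'a ring"
  where "subring_of S = ring_of_type_algebra\<lparr>carrier := S\<rparr>"

definition max_ideal :: "'a::field set \<Rightarrow> 'a set"
  where "max_ideal \<O> = {x \<in> \<O>. x = 0 \<or> inverse x \<notin> \<O>}"

definition residue_field :: "'a::field set \<Rightarrow> 'a set ring"
  where "residue_field \<O> = subring_of \<O> Quot max_ideal \<O>"

definition reduce :: "'a::field set \<Rightarrow> 'a \<Rightarrow> 'a set"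
  where "reduce \<O> x = max_ideal \<O> +>\<^bsub>subring_of \<O>\<^esub> x"

definition uniformizer :: "'a::field set \<Rightarrow> 'a \<Rightarrow> bool"
  where "uniformizer \<O> \<pi> \<longleftrightarrow> max_ideal \<O> = {\<pi> * y | y. y \<in> \<O>}"

definition ord_at :: "'a::field set \<Rightarrow> 'a \<Rightarrow> int extended"
  where "ord_at \<O> x = (if x = 0 then Pinf else
    Fin (THE e. \<exists>\<pi> u. uniformizer \<O> \<pi> \<and> u \<in> \<O> \<and> inverse u \<in> \<O> \<and> x = u * \<pi> powi e))"


section \<open>Normalization, reduction and minimality\<close>

definition normalized :: "'a::field set \<Rightarrow> nat \<Rightarrow> nat \<Rightarrow> (nat \<Rightarrow> (nat, 'a) mpol) \<Rightarrow> bool"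
  where "normalized \<O> n d F \<longleftrightarrow>
    (\<forall>v\<in>coeff_vars n d. coeffs_of F v \<in> \<O>) \<and>
    (\<exists>v\<in>coeff_vars n d. coeffs_of F v \<notin> max_ideal \<O>)"

definition semistable_at :: "'a::field set \<Rightarrow> nat \<Rightarrow> nat \<Rightarrow> (nat \<Rightarrow> (nat, 'a) mpol) \<Rightarrow> bool"
  where "semistable_at \<O> n d F \<longleftrightarrow>
    (\<exists>c. c \<noteq> 0 \<and> normalized \<O> n d (scale_forms c F) \<and>
       semistable_point (residue_field \<O>) n d (\<lambda>v. reduce \<O> (coeffs_of (scale_forms c F) v)))"

text \<open>
  The exponent \<open>(R\<^bsub>\<phi>,[X\<^sub>0,\<dots>,X\<^sub>n]\<^esub>)\<^sub>p\<close>, computed from any representative normalized at \<open>p\<close> of the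
  point of projective space given by \<open>F\<close>; two such representatives differ by a unit.
\<close>

definition resultant_exponent ::
    "'a::field set \<Rightarrow> nat \<Rightarrow> nat \<Rightarrow> (nat \<Rightarrow> (nat, 'a) mpol) \<Rightarrow> int extended"
  where "resultant_exponent \<O> n d F =
    (THE r. \<exists>c. c \<noteq> 0 \<and> normalized \<O> n d (scale_forms c F) \<and>
       r = ord_at \<O> (resultant_of n d (scale_forms c F)))"

definition minimal_at ::
    "'a::field set \<Rightarrow> nat \<Rightarrow> nat \<Rightarrow> (nat \<Rightarrow> (nat, 'a) mpol) \<Rightarrow> (nat \<Rightarrow> (nat, 'a) mpol) \<Rightarrow> bool"
  where "minimal_at \<O> n d \<Phi> F \<longleftrightarrow>
    (\<forall>F'. presentation n \<Phi> F' \<longrightarrow> resultant_exponent \<O> n d F \<le> resultant_exponent \<O> n d F')"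


section \<open>Closed points of the spectrum of the ring of integers of a number field\<close>

definition number_field :: "'a::field itself \<Rightarrow> bool"
  where "number_field _ \<longleftrightarrow> CHAR('a) = 0 \<and>
    (\<exists>B::'a set. finite B \<and>
      (\<forall>x. \<exists>q. (\<forall>b\<in>B. \<exists>r s. q b = of_int r / of_int s) \<and> x = (\<Sum>b\<in>B. q b * b)))"

definition ring_of_integers :: "'a::field set"
  where "ring_of_integers = {x. algebraic_int x}"

definition localization_at :: "'a::field set \<Rightarrow> 'a set \<Rightarrow> 'a set"
  where "localization_at A P = {x / s | x s. x \<in> A \<and> s \<in> A - P}"


section \<open>Closed points of curves over an algebraically closed field\<close>

text \<open>
  A complete nonsingular curve is projective. An integral closed subscheme \<open>C\<close> of projective
  \<open>m\<close>-space over a subfield \<open>k\<close> of \<open>'a\<close>, together with an identification of its function field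
  with \<open>'a\<close>, is given by the homogeneous coordinates \<open>x\<^sub>0, \<dots>, x\<^sub>m\<close> in \<open>'a\<close> of its generic point:
  the homogeneous ideal of \<open>C\<close> is generated by the forms over \<open>k\<close> which vanish at \<open>x\<close>, and the
  function field consists of the quotients of values at \<open>x\<close> of forms of equal degree.
\<close>

definition alg_closed_subfield :: "'a::field set \<Rightarrow> bool"
  where "alg_closed_subfield k \<longleftrightarrow> subfield k ring_of_type_algebra \<and>
    (\<forall>f. (\<forall>i. poly.coeff f i \<in> k) \<and> Polynomial.degree f > 0 \<longrightarrow> (\<exists>z\<in>k. poly f z = 0))"

definition algebraic_over :: "'a::field set \<Rightarrow> 'a \<Rightarrow> bool"
  where "algebraic_over S y \<longleftrightarrow> (\<exists>f. f \<noteq> 0 \<and> (\<forall>i. poly.coeff f i \<in> S) \<and> poly f y = 0)"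

definition trdeg_one :: "'a::field set \<Rightarrow> bool"
  where "trdeg_one k \<longleftrightarrow>
    (\<exists>t. \<not> algebraic_over k t \<and>
         (\<forall>y. algebraic_over {poly f t | f. \<forall>i. poly.coeff f i \<in> k} y))"

definition generic_point :: "'a::field set \<Rightarrow> nat \<Rightarrow> (nat \<Rightarrow> 'a) \<Rightarrow> bool"
  where "generic_point k m x \<longleftrightarrow> (\<exists>i\<le>m. x i \<noteq> 0) \<and>
    (\<forall>y. \<exists>e. \<exists>G\<in>forms k m e. \<exists>H\<in>forms k m e.
       mp_eval id x H \<noteq> 0 \<and> y = mp_eval id x G / mp_eval id x H)"

text \<open>
  Homogeneous coordinates of the closed points; these are \<open>k\<close>-rational as \<open>k\<close> is algebraically
  closed.
\<close>

definition curve_points :: "'a::field set \<Rightarrow> nat \<Rightarrow> (nat \<Rightarrow> 'a) \<Rightarrow> (nat \<Rightarrow> 'a) set"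
  where "curve_points k m x = {P. (\<forall>i\<le>m. P i \<in> k) \<and> (\<exists>i\<le>m. P i \<noteq> 0) \<and>
    (\<forall>e. \<forall>G\<in>forms k m e. mp_eval id x G = 0 \<longrightarrow> mp_eval id P G = 0)}"

definition curve_local_ring :: "'a::field set \<Rightarrow> nat \<Rightarrow> (nat \<Rightarrow> 'a) \<Rightarrow> (nat \<Rightarrow> 'a) \<Rightarrow> 'a set"
  where "curve_local_ring k m x P =
    {mp_eval id x G / mp_eval id x H | G H.
       \<exists>e. G \<in> forms k m e \<and> H \<in> forms k m e \<and> mp_eval id P H \<noteq> 0}"

text \<open>
  Nonsingular means that the local rings at the closed points are regular; they have dimension
  one, so this says that their maximal ideals are principal.
\<close>

definition nonsingular_curve :: "'a::field set \<Rightarrow> nat \<Rightarrow> (nat \<Rightarrow> 'a) \<Rightarrow> bool"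
  where "nonsingular_curve k m x \<longleftrightarrow>
    alg_closed_subfield k \<and> generic_point k m x \<and> trdeg_one k \<and>
    (\<forall>P\<in>curve_points k m x. \<exists>\<pi>. uniformizer (curve_local_ring k m x P) \<pi>)"

end

theory Submission
  imports
    Defs
    "HOL-Library.Product_Lexorder"
    "HOL-Computational_Algebra.Polynomial"
    "Jordan_Normal_Form.Char_Poly"
    "Jordan_Normal_Form.Column_Operations"
begin

text \<open>
  Let \<open>f\<close> be a homogeneous invariant of degree \<open>D\<close> whose value at the normalized tuple \<open>G\<close> is a
  unit at \<open>p\<close>, and let \<open>G'\<close> be a normalized tuple for other coordinates. Both tuples arise from
  \<open>\<Phi>\<close> by a matrix \<open>\<Gamma>\<close> and a scalar \<open>c\<close>. With \<open>W = c\<^bsup>n+1\<^esup> (det \<Gamma>)\<^bsup>n+d\<^esup>\<close>, homogeneity and the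
  transformation under \<open>\<Gamma>\<close> give \<open>f(G)\<^bsup>n+1\<^esup> = W\<^sup>D f(\<Phi>)\<^bsup>n+1\<^esup>\<close> and
  \<open>\<rho>(G)\<^bsup>n+1\<^esup> = W\<^sup>E \<rho>(\<Phi>)\<^bsup>n+1\<^esup>\<close>, where \<open>E\<close> is the degree of the resultant \<open>\<rho>\<close>; likewise for \<open>G'\<close>
  and \<open>W'\<close>. As \<open>f(G)\<close> is a unit and \<open>f(G')\<close> is integral, \<open>ord W \<le> ord W'\<close>, and hence
  \<open>ord \<rho>(G) \<le> ord \<rho>(G')\<close>.
\<close>


section \<open>Evaluation of polynomials\<close>

text \<open>The resultant is given only as a gcd of minors over the integers, so its existence,
  homogeneity and weight all have to be extracted from divisibility. Existence rests on gcds in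
  integer polynomial rings. Homogeneity and weight rest on one device: with a parameter adjoined,
  the resultant of the transformed generic forms divides a power of the parameter times a nonzero
  polynomial free of it, and is therefore a monomial in the parameter. The exponent n+d of the
  determinant in W comes from scalar matrices: t times the identity multiplies a tuple by t^n
  through the adjugate and by t^d through the substitution, while its determinant is t^(n+1). As a
  determinant need not have an (n+1)-st root in K, the identities are stated for (n+1)-st powers.
  Since W carries the whole dependence on coordinates and scaling, the invariant f controls the
  resultant. The local rings are given as sets of fractions, so their valuations have to be
  constructed: for curves from transcendence degree one, for number fields from finite rank over the
  rationals.\<close>

definition mon_eval :: "('v \<Rightarrow> 'b::comm_ring_1) \<Rightarrow> ('v \<Rightarrow>\<^sub>0 nat) \<Rightarrow> 'b"
  where "mon_eval x \<mu> = (\<Prod>v\<in>Poly_Mapping.keys \<mu>. x v ^ Poly_Mapping.lookup \<mu> v)"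

lemma mon_eval_superset:
  assumes "finite V" "Poly_Mapping.keys \<mu> \<subseteq> V"
  shows "mon_eval x \<mu> = (\<Prod>v\<in>V. x v ^ Poly_Mapping.lookup \<mu> v)"
  unfolding mon_eval_def
  by (rule prod.mono_neutral_left[OF assms]) (simp add: in_keys_iff)

lemma mon_eval_0 [simp]: "mon_eval x 0 = 1"
  by (simp add: mon_eval_def)

lemma mon_eval_add: "mon_eval x (\<mu> + \<nu>) = mon_eval x \<mu> * mon_eval x \<nu>"
proof -
  let ?V = "Poly_Mapping.keys \<mu> \<union> Poly_Mapping.keys \<nu>"
  have "Poly_Mapping.keys (\<mu> + \<nu>) \<subseteq> ?V"
    by (rule keys_add)
  then show ?thesis
    by (simp add: mon_eval_superset[of ?V] lookup_add power_add prod.distrib)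
qed

lemma mon_eval_single [simp]: "mon_eval x (Poly_Mapping.single v e) = x v ^ e"
  by (cases "e = 0") (auto simp: mon_eval_def)

lemma mon_eval_scale: "mon_eval (\<lambda>v. t * x v) \<mu> = t ^ mon_degree \<mu> * mon_eval x \<mu>"
  by (simp add: mon_eval_def mon_degree_def power_mult_distrib prod.distrib power_sum)

lemma mon_degree_eq_sum:
  assumes "finite V" "Poly_Mapping.keys \<mu> \<subseteq> V"
  shows "mon_degree \<mu> = (\<Sum>v\<in>V. Poly_Mapping.lookup \<mu> v)"
  unfolding mon_degree_def
  by (rule sum.mono_neutral_left[OF assms]) (simp add: in_keys_iff)

lemma mon_degree_0 [simp]: "mon_degree 0 = 0"
  by (simp add: mon_degree_def)

lemma mon_degree_single [simp]: "mon_degree (Poly_Mapping.single v e) = e"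
  by (cases "e = 0") (auto simp: mon_degree_def)

lemma mon_degree_add: "mon_degree (\<mu> + \<nu>) = mon_degree \<mu> + mon_degree \<nu>"
proof -
  let ?V = "Poly_Mapping.keys \<mu> \<union> Poly_Mapping.keys \<nu>"
  have "Poly_Mapping.keys (\<mu> + \<nu>) \<subseteq> ?V"
    by (rule keys_add)
  then show ?thesis
    by (simp add: mon_degree_eq_sum[of ?V] lookup_add sum.distrib)
qed

lemma mpol_sum_monomials:
  "(\<Sum>\<mu>\<in>Poly_Mapping.keys P. Poly_Mapping.single \<mu> (Poly_Mapping.lookup P \<mu>)) = P"
  by (rule poly_mapping_eqI) (auto simp: lookup_sum lookup_single when_def in_keys_iff)

lemma mpol_induct [case_names zero add]:
  assumes "Q 0"
    and "\<And>\<mu> c P. c \<noteq> 0 \<Longrightarrow> Q P \<Longrightarrow> Q (Poly_Mapping.single \<mu> c + P)"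
  shows "Q (P :: ('v, 'c::comm_monoid_add) mpol)"
proof -
  have "\<forall>\<mu>\<in>M. c \<mu> \<noteq> 0 \<Longrightarrow> Q (\<Sum>\<mu>\<in>M. Poly_Mapping.single \<mu> (c \<mu>))"
    if "finite M" for M and c :: "('v \<Rightarrow>\<^sub>0 nat) \<Rightarrow> 'c"
    using that by induction (simp_all add: assms)
  from this[of "Poly_Mapping.keys P" "Poly_Mapping.lookup P"] show ?thesis
    by (simp add: mpol_sum_monomials in_keys_iff)
qed

context comm_ring_hom
begin

lemma mp_eval_superset:
  assumes "finite M" "Poly_Mapping.keys P \<subseteq> M"
  shows "mp_eval hom x P = (\<Sum>\<mu>\<in>M. hom (Poly_Mapping.lookup P \<mu>) * mon_eval x \<mu>)"
  unfolding mp_eval_def mon_eval_def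
  by (rule sum.mono_neutral_left[OF assms]) (simp add: in_keys_iff)

lemma mp_eval_single [simp]: "mp_eval hom x (Poly_Mapping.single \<mu> c) = hom c * mon_eval x \<mu>"
  by (simp add: mp_eval_superset[of "{\<mu>}"])

lemma mp_eval_add: "mp_eval hom x (P + Q) = mp_eval hom x P + mp_eval hom x Q"
proof -
  let ?M = "Poly_Mapping.keys P \<union> Poly_Mapping.keys Q"
  have "Poly_Mapping.keys (P + Q) \<subseteq> ?M"
    by (rule keys_add)
  then show ?thesis
    by (simp add: mp_eval_superset[of ?M] lookup_add hom_add sum.distrib distrib_right)
qed

lemma mp_eval_0 [simp]: "mp_eval hom x 0 = 0"
  by (simp add: mp_eval_def)

lemma mp_eval_1 [simp]: "mp_eval hom x 1 = 1"
  using mp_eval_single[of x 0 1] by simp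

lemma mp_eval_mult: "mp_eval hom x (P * Q) = mp_eval hom x P * mp_eval hom x Q"
proof (induction P rule: mpol_induct)
  case (add \<mu> c P)
  have "mp_eval hom x (Poly_Mapping.single \<mu> c * Q) = hom c * mon_eval x \<mu> * mp_eval hom x Q"
    by (induction Q rule: mpol_induct)
      (simp_all add: distrib_left mp_eval_add mult_single hom_mult mon_eval_add algebra_simps)
  with add show ?case
    by (simp add: distrib_right mp_eval_add)
qed simp

lemma comm_ring_hom_mp_eval: "comm_ring_hom (mp_eval hom x)"
  by unfold_locales (simp_all add: mp_eval_add mp_eval_mult)

end

lemma (in comm_ring_hom) hom_mp_eval:
  assumes "comm_ring_hom g"
  shows "hom (mp_eval g x P) = mp_eval (\<lambda>c. hom (g c)) (\<lambda>v. hom (x v)) P"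
  by (simp add: mp_eval_def hom_sum hom_mult hom_prod hom_power)

lemma mp_eval_cong:
  assumes "\<And>\<mu>. \<mu> \<in> Poly_Mapping.keys P \<Longrightarrow> h (Poly_Mapping.lookup P \<mu>) = h' (Poly_Mapping.lookup P \<mu>)"
    and "\<And>\<mu> v. \<mu> \<in> Poly_Mapping.keys P \<Longrightarrow> v \<in> Poly_Mapping.keys \<mu> \<Longrightarrow> x v = x' v"
  shows "mp_eval h x P = mp_eval h' x' P"
  unfolding mp_eval_def using assms by (intro sum.cong prod.cong refl) auto

lemma comm_ring_hom_of_int: "comm_ring_hom (of_int :: int \<Rightarrow> 'a::comm_ring_1)"
  by unfold_locales simp_all

lemma comm_ring_hom_mconst: "comm_ring_hom (mconst :: 'a::comm_ring_1 \<Rightarrow> ('v, 'a) mpol)"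
  by unfold_locales (simp_all add: single_add mult_single)

lemma comm_ring_hom_compose:
  assumes "comm_ring_hom g" "comm_ring_hom h"
  shows "comm_ring_hom (\<lambda>x. h (g x))"
proof -
  interpret g: comm_ring_hom g by fact
  interpret h: comm_ring_hom h by fact
  show ?thesis
    by unfold_locales (simp_all add: g.hom_add g.hom_mult h.hom_add h.hom_mult)
qed

lemma comm_ring_hom_of_int_unique:
  assumes "comm_ring_hom h"
  shows "h (of_int k) = of_int k"
proof -
  interpret comm_ring_hom h by fact
  show ?thesis by (rule hom_of_int)
qed

lemma hom_mp_eval_of_int:
  assumes "comm_ring_hom h"
  shows "h (mp_eval of_int x P) = mp_eval of_int (\<lambda>v. h (x v)) P"
  using comm_ring_hom.hom_mp_eval[OF assms comm_ring_hom_of_int]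
  by (simp add: comm_ring_hom_of_int_unique[OF assms])

text \<open>Associativity of substitution; it yields the composition rule for linear changes of
  variables.\<close>

lemma mp_eval_hom_compose:
  assumes "comm_ring_hom h"
  shows "mp_eval h x (mp_eval mconst y P) = mp_eval h (\<lambda>v. mp_eval h x (y v)) P"
proof -
  interpret h: comm_ring_hom h by fact
  interpret e: comm_ring_hom "mp_eval h x" by (rule h.comm_ring_hom_mp_eval)
  show ?thesis
    by (simp add: e.hom_mp_eval[OF comm_ring_hom_mconst])
qed

lemma mon_eval_mvar: "mon_eval mvar \<mu> = Poly_Mapping.single \<mu> (1::'a::comm_ring_1)"
proof -
  have "finite V \<Longrightarrow> (\<Prod>v\<in>V. (mvar v :: ('v, 'a) mpol) ^ f v) = Poly_Mapping.single (\<Sum>v\<in>V. Poly_Mapping.single v (f v)) 1"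
    for V and f :: "'v \<Rightarrow> nat"
  proof (induction V rule: finite_induct)
    case (insert v V)
    have "(mvar v :: ('v, 'a) mpol) ^ k = Poly_Mapping.single (Poly_Mapping.single v k) 1" for k
      by (induction k) (simp_all add: mult_single flip: single_add)
    with insert show ?case
      by (simp add: mult_single)
  qed simp
  from this[of "Poly_Mapping.keys \<mu>" "Poly_Mapping.lookup \<mu>"] show ?thesis
    by (simp add: mon_eval_def mpol_sum_monomials del: One_nat_def)
qed

lemma mp_eval_mvar: "mp_eval mconst mvar P = (P :: ('v, 'a::comm_ring_1) mpol)"
proof -
  interpret comm_ring_hom "mconst :: 'a \<Rightarrow> ('v, 'a) mpol" by (rule comm_ring_hom_mconst)
  show ?thesis
    by (simp add: mp_eval_superset[of "Poly_Mapping.keys P"] mon_eval_mvar mult_single mpol_sum_monomials del: One_nat_def)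
qed

section \<open>Greatest common divisors of integer polynomials\<close>

text \<open>No normalization is chosen, so in a domain a gcd is fixed only up to units. Divisibility
  is that of the whole ring, even where \<open>S\<close> lies in a subring.\<close>

definition is_gcd :: "'a::comm_semiring_1 set \<Rightarrow> 'a \<Rightarrow> bool"
  where "is_gcd S g \<longleftrightarrow> (\<forall>s\<in>S. g dvd s) \<and> (\<forall>h. (\<forall>s\<in>S. h dvd s) \<longrightarrow> h dvd g)"

definition primitive_poly :: "'a::comm_semiring_1 poly \<Rightarrow> bool"
  where "primitive_poly p \<longleftrightarrow> (\<forall>c. (\<forall>i. c dvd coeff p i) \<longrightarrow> c dvd 1)"

text \<open>\<open>R\<close> models the polynomials in finitely many of the variables inside the
  ring in all of them, so that one fixed type serves an induction on the variables. By
  \<open>saturated\<close>, factors of a nonzero element of \<open>R\<close> stay in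
  \<open>R\<close>, so divisibility in \<open>R\<close> and in the ambient ring agree.\<close>

locale gcd_subring =
  fixes R :: "'a::idom set"
  assumes zero_mem: "0 \<in> R" and one_mem: "1 \<in> R"
    and add_mem: "a \<in> R \<Longrightarrow> b \<in> R \<Longrightarrow> a + b \<in> R"
    and uminus_mem: "a \<in> R \<Longrightarrow> - a \<in> R"
    and mult_mem: "a \<in> R \<Longrightarrow> b \<in> R \<Longrightarrow> a * b \<in> R"
    and saturated: "a * b \<in> R \<Longrightarrow> a * b \<noteq> 0 \<Longrightarrow> a \<in> R"
    and gcd_ex: "a \<in> R \<Longrightarrow> b \<in> R \<Longrightarrow> \<exists>g\<in>R. is_gcd {a, b} g"
begin

lemma gcd_finite_ex:
  assumes "finite S" "S \<subseteq> R"
  shows "\<exists>g\<in>R. is_gcd S g"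
  using assms
proof (induction S rule: finite_induct)
  case empty
  show ?case using zero_mem by (auto simp: is_gcd_def)
next
  case (insert a S)
  then obtain g where g: "g \<in> R" "is_gcd S g" by auto
  with insert.prems obtain k where k: "k \<in> R" "is_gcd {a, g} k" using gcd_ex by blast
  then have "is_gcd (insert a S) k"
    using g(2) unfolding is_gcd_def by (auto intro: dvd_trans)
  with k show ?case by blast
qed

text \<open>The multiples have some gcd because \<open>R\<close> has gcds. It is divisible by
  \<open>c\<close>, and its quotient by \<open>c\<close> is a common divisor of \<open>S\<close>,
  hence divides \<open>g\<close>.\<close>

lemma is_gcd_mult:
  assumes "finite S" "S \<subseteq> R" "is_gcd S g" "c \<in> R" "c \<noteq> 0"
  shows "is_gcd ((*) c ` S) (c * g)"
proof -
  have "\<exists>k\<in>R. is_gcd ((*) c ` S) k"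
    using assms mult_mem by (intro gcd_finite_ex) auto
  then obtain G where G: "is_gcd ((*) c ` S) G" by blast
  then have "c dvd G" by (auto simp: is_gcd_def)
  then obtain k where k: "G = c * k" by (elim dvdE)
  have "k dvd s" if "s \<in> S" for s
    using G that assms(5) unfolding is_gcd_def k by auto
  then have "k dvd g" using assms(3) by (auto simp: is_gcd_def)
  then have "G dvd c * g" by (simp add: k)
  then show ?thesis
    using G assms(3) unfolding is_gcd_def by (auto intro: dvd_trans)
qed

section \<open>Univariate polynomials over a ring with gcds\<close>

definition R_polys :: "'a poly set"
  where "R_polys = {p. \<forall>i. coeff p i \<in> R}"

lemma R_polysD: "p \<in> R_polys \<Longrightarrow> coeff p i \<in> R"
  by (simp add: R_polys_def)

lemma sum_mem: "(\<And>i. i \<in> I \<Longrightarrow> f i \<in> R) \<Longrightarrow> sum f I \<in> R"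
  by (induction I rule: infinite_finite_induct) (auto intro: zero_mem add_mem)

lemma R_polys_add: "p \<in> R_polys \<Longrightarrow> q \<in> R_polys \<Longrightarrow> p + q \<in> R_polys"
  by (simp add: R_polys_def add_mem)

lemma R_polys_uminus: "p \<in> R_polys \<Longrightarrow> - p \<in> R_polys"
  by (simp add: R_polys_def uminus_mem)

lemma R_polys_diff: "p \<in> R_polys \<Longrightarrow> q \<in> R_polys \<Longrightarrow> p - q \<in> R_polys"
  using R_polys_add[of p "- q"] R_polys_uminus by simp

lemma R_polys_mult: "p \<in> R_polys \<Longrightarrow> q \<in> R_polys \<Longrightarrow> p * q \<in> R_polys"
  by (auto simp: R_polys_def coeff_mult intro!: sum_mem mult_mem)

lemma R_polys_smult: "c \<in> R \<Longrightarrow> p \<in> R_polys \<Longrightarrow> smult c p \<in> R_polys"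
  by (simp add: R_polys_def mult_mem)

lemma R_polys_monom: "c \<in> R \<Longrightarrow> monom c n \<in> R_polys"
  by (simp add: R_polys_def zero_mem)

lemma R_polys_0: "0 \<in> R_polys"
  by (simp add: R_polys_def zero_mem)

lemma is_gcd_primitive:
  assumes "primitive_poly p"
  shows "is_gcd (coeff p ` {..degree p}) 1"
  unfolding is_gcd_def
proof safe
  fix h assume h: "\<forall>s\<in>coeff p ` {..degree p}. h dvd s"
  have "h dvd coeff p i" for i
    using h by (cases "i \<le> degree p") (auto simp: coeff_eq_0)
  then show "h dvd 1" using assms by (auto simp: primitive_poly_def)
qed simp

text \<open>The coefficients of \<open>p\<close> have gcd 1, so their multiples by \<open>a\<close>
  have gcd \<open>a\<close>.\<close>

lemma dvd_mult_primitive: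
  assumes "p \<in> R_polys" "primitive_poly p" "a \<in> R" "\<And>i. d dvd a * coeff p i"
  shows "d dvd a"
proof (cases "a = 0")
  case False
  have "is_gcd ((*) a ` (coeff p ` {..degree p})) (a * 1)"
    using assms False by (intro is_gcd_mult is_gcd_primitive) (auto simp: R_polys_def)
  then show ?thesis using assms(4) by (auto simp: is_gcd_def)
qed simp

lemma primitive_part_ex:
  assumes "p \<in> R_polys" "p \<noteq> 0"
  obtains c q where "c \<in> R" "c \<noteq> 0" "q \<in> R_polys" "primitive_poly q" "p = smult c q"
proof -
  have "\<exists>g\<in>R. is_gcd (coeff p ` {..degree p}) g"
    using assms by (intro gcd_finite_ex) (auto simp: R_polys_def)
  then obtain c where c: "c \<in> R" "is_gcd (coeff p ` {..degree p}) c" by blast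
  have "c dvd coeff p i" for i
    using c by (cases "i \<le> degree p") (auto simp: is_gcd_def coeff_eq_0)
  then have "[:c:] dvd p" by (simp add: const_poly_dvd_iff)
  then obtain q where q: "p = [:c:] * q" by (elim dvdE)
  then have q: "p = smult c q" by simp
  with assms have "c \<noteq> 0" by auto
  \<comment> \<open>Each nonzero coefficient is a factor of a nonzero element of \<open>R\<close>;
    saturation says nothing about zero products, hence the case distinction.\<close>
  have "coeff q i \<in> R" for i
  proof (cases "coeff q i = 0")
    case False
    have "coeff q i * c \<in> R" using R_polysD[OF assms(1), of i] by (simp add: q mult.commute)
    then show ?thesis using saturated False \<open>c \<noteq> 0\<close> by auto
  qed (simp add: zero_mem)
  moreover have "primitive_poly q"
    unfolding primitive_poly_def
  proof safe
    fix e assume "\<forall>i. e dvd coeff q i"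
    then have "\<forall>s\<in>coeff p ` {..degree p}. c * e dvd s" by (auto simp: q)
    then have "c * e dvd c * 1" using c by (simp add: is_gcd_def)
    then show "e dvd 1" using \<open>c \<noteq> 0\<close> by (simp only: dvd_mult_cancel_left) simp
  qed
  ultimately show ?thesis using that c(1) \<open>c \<noteq> 0\<close> q by (auto simp: R_polys_def)
qed

text \<open>As \<open>c\<close> divides both \<open>b * c\<close> and \<open>b * a\<close>, it
  divides their gcd, which is \<open>b\<close> times the unit \<open>g\<close>.\<close>

lemma coprime_dvd_mult:
  assumes "a \<in> R" "b \<in> R" "c \<in> R" "is_gcd {c, a} g" "g dvd 1" "c dvd a * b"
  shows "c dvd b"
proof (cases "b = 0")
  case False
  have "is_gcd ((*) b ` {c, a}) (b * g)"
    using assms False by (intro is_gcd_mult) auto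
  moreover have "\<forall>s\<in>(*) b ` {c, a}. c dvd s" using assms(6) by (auto simp: mult.commute)
  ultimately have "c dvd b * g" by (auto simp: is_gcd_def)
  also have "b * g dvd b * 1" using assms(5) by (rule mult_dvd_mono[OF dvd_refl])
  finally show ?thesis by simp
qed simp

text \<open>
  Gauss's lemma. If \<open>d\<close> divides a common factor \<open>c\<close> of the coefficients of \<open>p q\<close> and the leading
  coefficient of \<open>p\<close>, then it divides the product of \<open>q\<close> with the lower part of \<open>p\<close>, and the
  induction hypothesis shows that it divides \<open>p\<close>. So \<open>c\<close> is coprime to both leading coefficients.
\<close>

lemma primitive_mult_aux:
  assumes "p \<in> R_polys" "q \<in> R_polys" "primitive_poly p" "primitive_poly q" "c \<in> R"
    and "\<And>i. c dvd coeff (p * q) i" "p \<noteq> 0" "q \<noteq> 0"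
    and IH: "\<And>p'. p' \<in> R_polys \<Longrightarrow> primitive_poly p' \<Longrightarrow> p' \<noteq> 0 \<Longrightarrow> degree p' < degree p \<Longrightarrow> primitive_poly (p' * q)"
    and g: "is_gcd {c, lead_coeff p} d" "d \<in> R"
  shows "d dvd 1"
proof -
  define p0 where "p0 = p - monom (lead_coeff p) (degree p)"
  have d: "d dvd c" "d dvd lead_coeff p" using g by (auto simp: is_gcd_def)
  have "d dvd coeff p0 i" for i
  proof (cases "p0 = 0")
    case False
    have p0: "p0 \<in> R_polys"
      using assms(1) unfolding p0_def by (intro R_polys_diff R_polys_monom R_polysD)
    have "degree p0 \<noteq> degree p"
      using False by (metis coeff_diff coeff_monom diff_self leading_coeff_0_iff p0_def)
    moreover have "degree p0 \<le> degree p"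
      unfolding p0_def by (intro degree_diff_le degree_monom_le order_refl)
    ultimately have deg: "degree p0 < degree p" by simp
    obtain e p1 where p1: "e \<in> R" "e \<noteq> 0" "p1 \<in> R_polys" "primitive_poly p1" "p0 = smult e p1"
      by (rule primitive_part_ex[OF p0 False])
    have "primitive_poly (p1 * q)"
      using p1 deg False by (intro IH) auto
    moreover have "d dvd e * coeff (p1 * q) i" for i
    proof -
      have "e * coeff (p1 * q) i = coeff (p * q) i - coeff (monom (lead_coeff p) (degree p) * q) i"
        unfolding coeff_diff[symmetric] left_diff_distrib[symmetric] p0_def[symmetric]
        by (simp add: p1(5))
      moreover have "d dvd coeff (monom (lead_coeff p) (degree p) * q) i"
        using d by (simp add: coeff_monom_mult)
      ultimately show ?thesis using dvd_trans[OF d(1) assms(6)] by (metis dvd_diff)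
    qed
    ultimately have "d dvd e"
      using dvd_mult_primitive[OF R_polys_mult[OF p1(3) assms(2)] _ p1(1)] by blast
    then show ?thesis by (simp add: p1(5))
  qed simp
  moreover have "d dvd coeff (monom (lead_coeff p) (degree p)) i" for i
    using d(2) by (auto simp: coeff_monom)
  ultimately have "d dvd coeff (p0 + monom (lead_coeff p) (degree p)) i" for i
    unfolding coeff_add by (rule dvd_add)
  then have "\<forall>i. d dvd coeff p i" by (simp add: p0_def)
  then show ?thesis using assms(3) by (auto simp: primitive_poly_def)
qed

lemma primitive_mult:
  assumes "p \<in> R_polys" "q \<in> R_polys" "primitive_poly p" "primitive_poly q" "p \<noteq> 0" "q \<noteq> 0"
  shows "primitive_poly (p * q)"
  using assms
proof (induction "degree p + degree q" arbitrary: p q rule: less_induct)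
  case less
  have pq: "p * q \<in> R_polys" using less.prems by (intro R_polys_mult)
  show ?case
    unfolding primitive_poly_def
  proof safe
    fix c0 assume c0: "\<forall>i. c0 dvd coeff (p * q) i"
    \<comment> \<open>The common divisor \<open>c0\<close> is replaced by the content
      \<open>c\<close>, which is divisible by \<open>c0\<close> and known to lie in
      \<open>R\<close>.\<close>
    have "\<exists>g\<in>R. is_gcd (coeff (p * q) ` {..degree (p * q)}) g"
      using pq by (intro gcd_finite_ex) (auto simp: R_polys_def)
    then obtain c where c: "c \<in> R" "is_gcd (coeff (p * q) ` {..degree (p * q)}) c" by blast
    have cd: "c dvd coeff (p * q) i" for i
      using c by (cases "i \<le> degree (p * q)") (auto simp: is_gcd_def coeff_eq_0)
    obtain d1 where d1: "d1 \<in> R" "is_gcd {c, lead_coeff p} d1"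
      using gcd_ex[OF c(1) R_polysD[OF less.prems(1)]] by blast
    obtain d2 where d2: "d2 \<in> R" "is_gcd {c, lead_coeff q} d2"
      using gcd_ex[OF c(1) R_polysD[OF less.prems(2)]] by blast
    have cd': "c dvd coeff (q * p) i" for i
      using cd by (simp add: mult.commute)
    \<comment> \<open>The auxiliary lemma treats the leading coefficient of the first factor only.
      It is applied a second time with \<open>p\<close> and \<open>q\<close> exchanged, which is why
      the induction runs on the sum of the degrees.\<close>
    have IH1: "primitive_poly (p' * q)"
      if "p' \<in> R_polys" "primitive_poly p'" "p' \<noteq> 0" "degree p' < degree p" for p'
      by (rule less.hyps) (fact less.prems that | simp add: that)+
    have IH2: "primitive_poly (q' * p)"
      if "q' \<in> R_polys" "primitive_poly q'" "q' \<noteq> 0" "degree q' < degree q" for q'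
      by (rule less.hyps) (fact less.prems that | simp add: that add.commute)+
    have "d1 dvd 1"
      by (rule primitive_mult_aux[OF less.prems(1-4) c(1) cd less.prems(5,6) IH1 d1(2,1)])
    have "d2 dvd 1"
      by (rule primitive_mult_aux[OF less.prems(2,1,4,3) c(1) cd' less.prems(6,5) IH2 d2(2,1)])
    have "c dvd lead_coeff p * lead_coeff q"
      using cd[of "degree p + degree q"] by (simp add: coeff_mult_degree_sum)
    then have "c dvd lead_coeff q"
      by (rule coprime_dvd_mult[OF R_polysD[OF less.prems(1)] R_polysD[OF less.prems(2)] c(1) d1(2) \<open>d1 dvd 1\<close>])
    then have "c dvd d2" using d2 by (simp add: is_gcd_def)
    moreover have "c0 dvd c" using c0 c by (auto simp: is_gcd_def)
    ultimately show "c0 dvd 1" using \<open>d2 dvd 1\<close> by (blast intro: dvd_trans)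
  qed
qed

text \<open>The leading coefficient of \<open>s\<close> is a factor of that of \<open>g * s\<close>,
  so saturation puts it into \<open>R\<close>; subtracting the leading monomial lowers the
  degree.\<close>

lemma quotient_mem:
  assumes "g \<in> R_polys" "g * s \<in> R_polys" "g \<noteq> 0"
  shows "s \<in> R_polys"
  using assms(2)
proof (induction "degree s" arbitrary: s rule: less_induct)
  case less
  show ?case
  proof (cases "s = 0")
    case False
    have "lead_coeff s * lead_coeff g \<in> R"
      using R_polysD[OF less.prems, of "degree g + degree s"]
      by (simp add: coeff_mult_degree_sum mult.commute)
    then have ls: "lead_coeff s \<in> R" using saturated False assms(3) by simp
    define m where "m = monom (lead_coeff s) (degree s)"
    have m: "m \<in> R_polys" unfolding m_def by (intro R_polys_monom ls)
    have "s - m \<in> R_polys"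
    proof (cases "s - m = 0")
      case nz: False
      have "degree (s - m) \<noteq> degree s"
        using nz by (metis coeff_diff coeff_monom diff_self leading_coeff_0_iff m_def)
      moreover have "degree (s - m) \<le> degree s"
        unfolding m_def by (intro degree_diff_le degree_monom_le order_refl)
      moreover have "g * (s - m) \<in> R_polys"
        unfolding right_diff_distrib by (intro R_polys_diff R_polys_mult less.prems assms(1) m)
      ultimately show ?thesis using less.hyps[of "s - m"] by simp
    qed (simp add: R_polys_0)
    from R_polys_add[OF this m] show ?thesis by simp
  qed (simp add: R_polys_0)
qed

text \<open>With the quotient written as a content \<open>f\<close> times a primitive
  \<open>s1\<close>, Gauss's lemma makes \<open>h * s1\<close> primitive. Comparing the two sides of
  \<open>smult a p = smult (e * f) (h * s1)\<close>, the contents \<open>a\<close> and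
  \<open>e * f\<close> divide each other and cancel up to a unit.\<close>

lemma smult_primitive_dvd:
  assumes "h \<in> R_polys" "p \<in> R_polys" "primitive_poly h" "primitive_poly p"
    and "e \<in> R" "a \<in> R" "e \<noteq> 0" "a \<noteq> 0" "h \<noteq> 0" "p \<noteq> 0" "smult e h dvd smult a p"
  shows "e dvd a" "h dvd p"
proof -
  obtain s where s: "smult a p = smult e h * s" using assms(11) by (elim dvdE)
  then have "s \<noteq> 0" using assms by auto
  have "smult e h * s \<in> R_polys"
    unfolding s[symmetric] by (intro R_polys_smult assms)
  then have "s \<in> R_polys"
    using quotient_mem[OF R_polys_smult[OF assms(5,1)]] assms by simp
  then obtain f s1 where s1: "f \<in> R" "f \<noteq> 0" "s1 \<in> R_polys" "primitive_poly s1" "s = smult f s1"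
    by (rule primitive_part_ex[OF _ \<open>s \<noteq> 0\<close>])
  then have s1nz: "s1 \<noteq> 0" using \<open>s \<noteq> 0\<close> by auto
  have prim: "primitive_poly (h * s1)" using s1 s1nz assms by (intro primitive_mult)
  have eq: "smult a p = smult (e * f) (h * s1)" using s s1(5) by (simp add: mult.commute)
  have "a * coeff p i = e * f * coeff (h * s1) i" for i
    using arg_cong[OF eq, of "\<lambda>p. coeff p i"] by simp
  note co = this
  have "e * f dvd a"
    by (rule dvd_mult_primitive[of p]) (use assms co in auto)
  then show "e dvd a" by (rule dvd_mult_left)
  have "a dvd e * f"
    by (rule dvd_mult_primitive[of "h * s1"])
      (use assms s1 prim co in \<open>auto intro!: R_polys_mult mult_mem simp flip: co\<close>)
  then obtain u where "e * f = a * u" by (elim dvdE)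
  then have "smult a p = smult a (smult u (h * s1))" using eq by simp
  then have "p = smult u (h * s1)" using assms(8) by (metis smult_cancel)
  then show "h dvd p" by (metis dvd_smult dvd_triv_left)
qed

text \<open>Each reduction step multiplies by the leading coefficient of \<open>q\<close> in place
  of dividing by it, which keeps all polynomials over \<open>R\<close>.\<close>

lemma pseudo_division:
  assumes "p \<in> R_polys" "q \<in> R_polys" "q \<noteq> 0"
  shows "\<exists>m s r. s \<in> R_polys \<and> r \<in> R_polys \<and> smult (lead_coeff q ^ m) p = q * s + r
    \<and> (r = 0 \<or> degree r < degree q)"
  using assms(1)
proof (induction "degree p" arbitrary: p rule: less_induct)
  case less
  show ?case
  proof (cases "p = 0 \<or> degree p < degree q")
    case True
    then show ?thesis
      using less.prems R_polys_0 by (intro exI[of _ 0] exI[of _ "0::'a poly"] exI[of _ p]) auto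
  next
    case False
    define t where "t = monom (lead_coeff p) (degree p - degree q)"
    define p' where "p' = smult (lead_coeff q) p - q * t"
    have t: "t \<in> R_polys" unfolding t_def by (intro R_polys_monom R_polysD less.prems)
    have p': "p' \<in> R_polys" unfolding p'_def
      by (intro R_polys_diff R_polys_smult R_polys_mult R_polysD less.prems assms(2) t)
    show ?thesis
    proof (cases "p' = 0")
      case True
      then show ?thesis
        using t R_polys_0 by (intro exI[of _ 1] exI[of _ t] exI[of _ "0::'a poly"]) (auto simp: p'_def)
    next
      case nz: False
      have "degree (q * t) = degree p"
        using False assms(3) by (simp add: degree_mult_eq t_def degree_monom_eq monom_eq_0_iff)
      then have "degree p' \<le> degree p"
        unfolding p'_def by (intro degree_diff_le) auto
      moreover have "coeff (q * t) (degree p) = lead_coeff q * lead_coeff p"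
        using False by (simp add: t_def mult.commute[of q] coeff_monom_mult)
      then have "coeff p' (degree p) = 0"
        by (simp add: p'_def)
      then have "degree p' \<noteq> degree p" using nz by (metis leading_coeff_0_iff)
      ultimately have "degree p' < degree p" by simp
      from less.hyps[OF this p'] obtain m s r where
        *: "s \<in> R_polys" "r \<in> R_polys" "smult (lead_coeff q ^ m) p' = q * s + r" "r = 0 \<or> degree r < degree q"
        by blast
      have "smult (lead_coeff q ^ Suc m) p = q * (s + smult (lead_coeff q ^ m) t) + r"
        using *(3) by (simp add: p'_def smult_diff_right algebra_simps)
      moreover have "lead_coeff q ^ m \<in> R"
        by (induction m) (auto intro: one_mem mult_mem R_polysD assms(2))
      then have "s + smult (lead_coeff q ^ m) t \<in> R_polys"
        using * t by (intro R_polys_add R_polys_smult)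
      ultimately show ?thesis using * by blast
    qed
  qed
qed

text \<open>Euclid's algorithm in which each remainder is replaced by its primitive part. By
  \<open>smult_primitive_dvd\<close>, neither the multiplier of the pseudo-division nor the content
  of the remainder affects the primitive common divisors.\<close>

lemma primitive_gcd_ex:
  assumes "p \<in> R_polys" "q \<in> R_polys" "primitive_poly p" "primitive_poly q" "p \<noteq> 0" "q \<noteq> 0"
  shows "\<exists>g\<in>R_polys. g \<noteq> 0 \<and> primitive_poly g \<and> g dvd p \<and> g dvd q \<and>
    (\<forall>h\<in>R_polys. h \<noteq> 0 \<longrightarrow> primitive_poly h \<longrightarrow> h dvd p \<longrightarrow> h dvd q \<longrightarrow> h dvd g)"
  using assms
proof (induction "degree q" arbitrary: p q rule: less_induct)
  case less
  obtain m s r where r: "s \<in> R_polys" "r \<in> R_polys" "smult (lead_coeff q ^ m) p = q * s + r"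
    "r = 0 \<or> degree r < degree q"
    using pseudo_division[OF less.prems(1,2,6)] by blast
  have lq: "lead_coeff q ^ m \<in> R"
    by (induction m) (auto intro: one_mem mult_mem R_polysD less.prems(2))
  have lq0: "lead_coeff q ^ m \<noteq> 0" using less.prems by simp
  have to_p: "h dvd p" if "h \<in> R_polys" "h \<noteq> 0" "primitive_poly h" "h dvd smult (lead_coeff q ^ m) p" for h
    using smult_primitive_dvd(2)[OF that(1) less.prems(1) that(3) less.prems(3) one_mem lq one_neq_zero
        lq0 that(2) less.prems(5)] that(4) by simp
  show ?case
  proof (cases "r = 0")
    case True
    then have "q dvd p" using to_p[OF less.prems(2,6,4)] r(3) by simp
    then show ?thesis using less.prems(2,4,6) by (intro bexI[of _ q]) simp_all
  next
    case False
    obtain e r1 where r1: "e \<in> R" "e \<noteq> 0" "r1 \<in> R_polys" "primitive_poly r1" "r = smult e r1"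
      by (rule primitive_part_ex[OF r(2) False])
    have "r1 \<noteq> 0" "degree r1 < degree q" using False r(4) r1(2,5) by simp_all
    note IH = less.hyps[OF this(2) less.prems(2) r1(3) less.prems(4) r1(4) less.prems(6) this(1)]
    obtain g where
      g: "g \<in> R_polys" "g \<noteq> 0" "primitive_poly g" "g dvd q" "g dvd r1"
      "\<And>h. h \<in> R_polys \<Longrightarrow> h \<noteq> 0 \<Longrightarrow> primitive_poly h \<Longrightarrow> h dvd q \<Longrightarrow> h dvd r1 \<Longrightarrow> h dvd g"
      using IH by blast
    have "g dvd smult (lead_coeff q ^ m) p"
      unfolding r(3) r1(5) by (intro dvd_add dvd_smult g(5) dvd_mult2 g(4))
    then have "g dvd p" using to_p g by blast
    moreover have "h dvd g" if "h \<in> R_polys" "h \<noteq> 0" "primitive_poly h" "h dvd p" "h dvd q" for h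
    proof -
      have "h dvd smult (lead_coeff q ^ m) p - q * s"
        using that by (intro dvd_diff dvd_smult dvd_mult2)
      then have "smult 1 h dvd smult e r1" using r(3) r1(5) by simp
      then have "h dvd r1"
        using smult_primitive_dvd(2)[of h r1 1 e] that(1-3) r1(1-4) \<open>r1 \<noteq> 0\<close> one_mem by simp
      then show ?thesis by (rule g(6)[OF that(1-3,5)])
    qed
    ultimately show ?thesis using g by blast
  qed
qed

text \<open>The gcd is the gcd of the contents times the gcd of the primitive parts.\<close>

lemma poly_gcd_ex:
  assumes "p \<in> R_polys" "q \<in> R_polys"
  shows "\<exists>g\<in>R_polys. g dvd p \<and> g dvd q \<and> (\<forall>h\<in>R_polys. h dvd p \<longrightarrow> h dvd q \<longrightarrow> h dvd g)"
proof (cases "p = 0 \<or> q = 0")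
  case True
  then have "is_gcd {p, q} (if p = 0 then q else p)"
    by (auto simp: is_gcd_def)
  then show ?thesis
    using assms unfolding is_gcd_def by (intro bexI[of _ "if p = 0 then q else p"]) simp_all
next
  case False
  then have pq: "p \<noteq> 0" "q \<noteq> 0" by auto
  obtain a p1 where p1: "a \<in> R" "a \<noteq> 0" "p1 \<in> R_polys" "primitive_poly p1" "p = smult a p1"
    by (rule primitive_part_ex[OF assms(1) pq(1)])
  obtain b q1 where q1: "b \<in> R" "b \<noteq> 0" "q1 \<in> R_polys" "primitive_poly q1" "q = smult b q1"
    by (rule primitive_part_ex[OF assms(2) pq(2)])
  have nz: "p1 \<noteq> 0" "q1 \<noteq> 0" using pq p1(5) q1(5) by auto
  obtain g where g: "g \<in> R_polys" "g \<noteq> 0" "primitive_poly g" "g dvd p1" "g dvd q1"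
      "\<And>h. h \<in> R_polys \<Longrightarrow> h \<noteq> 0 \<Longrightarrow> primitive_poly h \<Longrightarrow> h dvd p1 \<Longrightarrow> h dvd q1 \<Longrightarrow> h dvd g"
    using primitive_gcd_ex[OF p1(3) q1(3) p1(4) q1(4) nz] by blast
  obtain c where c: "c \<in> R" "is_gcd {a, b} c" using gcd_ex[OF p1(1) q1(1)] by blast
  have sm: "smult x y dvd smult x' y'" if xy: "x dvd x'" "y dvd y'" for x x' :: 'a and y y'
  proof -
    obtain k where "x' = x * k" using xy(1) by (elim dvdE)
    moreover obtain l where "y' = y * l" using xy(2) by (elim dvdE)
    ultimately have "smult x' y' = smult x y * smult k l" by (simp add: mult.commute)
    then show ?thesis by (rule dvdI)
  qed
  have cab: "c dvd a" "c dvd b" "\<And>h. h dvd a \<Longrightarrow> h dvd b \<Longrightarrow> h dvd c"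
    using c(2) by (auto simp: is_gcd_def)
  have "smult c g dvd p" "smult c g dvd q"
    unfolding p1(5) q1(5) by (rule sm[OF cab(1) g(4)], rule sm[OF cab(2) g(5)])
  moreover have "h dvd smult c g" if h: "h \<in> R_polys" "h dvd p" "h dvd q" for h
  proof -
    have "h \<noteq> 0" using h pq by auto
    obtain e h1 where h1: "e \<in> R" "e \<noteq> 0" "h1 \<in> R_polys" "primitive_poly h1" "h = smult e h1"
      by (rule primitive_part_ex[OF h(1) \<open>h \<noteq> 0\<close>])
    have "h1 \<noteq> 0" using \<open>h \<noteq> 0\<close> h1(5) by auto
    have "e dvd a" "h1 dvd p1"
      using smult_primitive_dvd[of h1 p1 e a] h1(1-4) p1(1-4) h(2) nz \<open>h1 \<noteq> 0\<close>
      unfolding h1(5) p1(5) by blast+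
    moreover have "e dvd b" "h1 dvd q1"
      using smult_primitive_dvd[of h1 q1 e b] h1(1-4) q1(1-4) h(3) nz \<open>h1 \<noteq> 0\<close>
      unfolding h1(5) q1(5) by blast+
    ultimately show ?thesis
      unfolding h1(5) using sm[OF cab(3) g(6)] h1 \<open>h1 \<noteq> 0\<close> by blast
  qed
  ultimately show ?thesis using R_polys_smult[OF c(1) g(1)] by blast
qed

end

section \<open>Polynomials in a given set of variables, and induction on the variables\<close>

definition mpols_in :: "'v set \<Rightarrow> ('v, 'a::zero) mpol set"
  where "mpols_in V = {P. \<forall>\<mu>\<in>Poly_Mapping.keys P. Poly_Mapping.keys \<mu> \<subseteq> V}"

lemma mpols_in_0 [simp]: "0 \<in> mpols_in V"
  and mpols_in_mconst [simp]: "mconst c \<in> mpols_in V"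
  by (auto simp: mpols_in_def)

lemma mpols_in_1 [simp]: "(1 :: ('v, 'a::comm_ring_1) mpol) \<in> mpols_in V"
  by (auto simp: mpols_in_def)

lemma mpols_in_mvar: "v \<in> V \<Longrightarrow> (mvar v :: ('v, 'a::comm_ring_1) mpol) \<in> mpols_in V"
  by (auto simp: mpols_in_def)

lemma mpols_in_UNIV [simp]: "P \<in> mpols_in UNIV"
  by (simp add: mpols_in_def)

lemma mpols_in_add: "P \<in> mpols_in V \<Longrightarrow> Q \<in> mpols_in V \<Longrightarrow> P + Q \<in> mpols_in V"
  using keys_add[of P Q] unfolding mpols_in_def by blast

lemma mpols_in_uminus: "P \<in> mpols_in V \<Longrightarrow> - P \<in> mpols_in V"
  for P :: "('v, 'a::comm_ring_1) mpol"
  by (auto simp: mpols_in_def in_keys_iff)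

lemma mpols_in_mult: "P \<in> mpols_in V \<Longrightarrow> Q \<in> mpols_in V \<Longrightarrow> P * Q \<in> mpols_in V"
  for P :: "('v, 'a::comm_ring_1) mpol"
proof -
  assume "P \<in> mpols_in V" "Q \<in> mpols_in V"
  then have "Poly_Mapping.keys (\<mu> + \<nu>) \<subseteq> V"
    if "\<mu> \<in> Poly_Mapping.keys P" "\<nu> \<in> Poly_Mapping.keys Q" for \<mu> \<nu>
    using keys_add[of \<mu> \<nu>] that unfolding mpols_in_def by blast
  with keys_mult[of P Q] show ?thesis
    unfolding mpols_in_def by blast
qed

lemma mpols_in_ex_finite: "finite S \<Longrightarrow> \<exists>V. finite V \<and> S \<subseteq> mpols_in V"
proof (intro exI conjI)
  show "S \<subseteq> mpols_in (\<Union>P\<in>S. \<Union>\<mu>\<in>Poly_Mapping.keys P. Poly_Mapping.keys \<mu>)"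
    by (auto simp: mpols_in_def)
qed simp

lemma mpols_in_empty: "P \<in> mpols_in {} \<longleftrightarrow> (\<exists>c. P = mconst c)"
proof
  assume P: "P \<in> mpols_in {}"
  have "P = mconst (Poly_Mapping.lookup P 0)"
  proof (rule poly_mapping_eqI)
    fix \<mu>
    show "Poly_Mapping.lookup P \<mu> = Poly_Mapping.lookup (mconst (Poly_Mapping.lookup P 0)) \<mu>"
    proof (cases "\<mu> = 0")
      case False
      then have "Poly_Mapping.keys \<mu> \<noteq> {}"
        by simp
      then have "\<mu> \<notin> Poly_Mapping.keys P" using P by (auto simp: mpols_in_def)
      with False show ?thesis by (simp add: in_keys_iff lookup_single when_def)
    qed simp
  qed
  then show "\<exists>c. P = mconst c" by blast
qed auto

text \<open>The isomorphism of \<open>A[x]\<close>, with \<open>x\<close> among the variables, with the univariate polynomials over \<open>A\<close>.\<close>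

definition as_poly_in :: "'v \<Rightarrow> ('v, 'a::comm_ring_1) mpol \<Rightarrow> ('v, 'a) mpol poly"
  where "as_poly_in x = mp_eval (\<lambda>c. [:mconst c:]) (\<lambda>v. if v = x then [:0, 1:] else [:mvar v:])"

lemma comm_ring_hom_pCons: "comm_ring_hom (\<lambda>c::'a::comm_ring_1. [:c:])"
  by unfold_locales (simp_all add: one_pCons)

lemma comm_ring_hom_const_mconst:
  "comm_ring_hom (\<lambda>c::'a::comm_ring_1. [:mconst c :: ('v, 'a) mpol:])"
  by (rule comm_ring_hom_compose[OF comm_ring_hom_mconst comm_ring_hom_pCons])

lemma comm_ring_hom_as_poly_in: "comm_ring_hom (as_poly_in x)"
  unfolding as_poly_in_def
  by (rule comm_ring_hom.comm_ring_hom_mp_eval[OF comm_ring_hom_const_mconst])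

lemma comm_ring_hom_poly: "comm_ring_hom (\<lambda>p. poly p (a::'a::comm_ring_1))"
  by unfold_locales simp_all

lemma poly_as_poly_in: "poly (as_poly_in x P) (mvar x) = P"
proof -
  have "poly (as_poly_in x P) (mvar x)
      = mp_eval (\<lambda>c. poly [:mconst c:] (mvar x))
          (\<lambda>v. poly (if v = x then [:0, 1:] else [:mvar v:]) (mvar x)) P"
    unfolding as_poly_in_def
    by (rule comm_ring_hom.hom_mp_eval[OF comm_ring_hom_poly comm_ring_hom_const_mconst])
  also have "\<dots> = mp_eval mconst mvar P"
    by (rule mp_eval_cong) simp_all
  finally show ?thesis by (simp only: mp_eval_mvar)
qed

lemma as_poly_in_const:
  assumes "P \<in> mpols_in V" "x \<notin> V"
  shows "as_poly_in x P = [:P:]"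
proof -
  have "as_poly_in x P = mp_eval (\<lambda>c. [:mconst c:]) (\<lambda>v. [:mvar v:]) P"
    unfolding as_poly_in_def
    by (rule mp_eval_cong) (use assms in \<open>auto simp: mpols_in_def\<close>)
  also have "\<dots> = [:mp_eval mconst mvar P:]"
    by (rule comm_ring_hom.hom_mp_eval[OF comm_ring_hom_pCons comm_ring_hom_mconst, symmetric])
  finally show ?thesis by (simp only: mp_eval_mvar)
qed

text \<open>The univariate polynomials with coefficients in \<open>mpols_in V\<close> form a ring
  that contains the images of the constants, of \<open>x\<close> and of the variables in
  \<open>V\<close>.\<close>

lemma coeff_as_poly_in:
  assumes "P \<in> mpols_in (insert x V)"
  shows "coeff (as_poly_in x P) i \<in> mpols_in V"
proof -
  define S :: "('a, 'b) mpol poly set" where "S = {p. \<forall>i. coeff p i \<in> mpols_in V}"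
  have sum: "(\<And>i. i \<in> I \<Longrightarrow> f i \<in> mpols_in V) \<Longrightarrow> sum f I \<in> mpols_in V"
    for f :: "nat \<Rightarrow> ('a, 'b) mpol" and I
    by (induction I rule: infinite_finite_induct) (auto intro: mpols_in_add)
  have sum': "(\<And>i. i \<in> I \<Longrightarrow> f i \<in> S) \<Longrightarrow> sum f I \<in> S" for f and I :: "('a \<Rightarrow>\<^sub>0 nat) set"
    unfolding S_def by (induction I rule: infinite_finite_induct) (auto intro: mpols_in_add)
  have mult: "p * q \<in> S" if "p \<in> S" "q \<in> S" for p q
    using that unfolding S_def by (auto simp: coeff_mult intro!: sum mpols_in_mult)
  have one: "1 \<in> S" and const: "[:c:] \<in> S" if "c \<in> mpols_in V" for c
    using that by (auto simp: S_def coeff_pCons split: nat.splits)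
  have one: "1 \<in> S" using const[OF mpols_in_1] by (simp add: one_pCons)
  have X: "[:0, 1:] \<in> S" by (auto simp: S_def coeff_pCons split: nat.splits)
  have pow: "p ^ k \<in> S" if "p \<in> S" for p k
    using that by (induction k) (auto intro: mult one)
  have prod: "(\<And>v. v \<in> W \<Longrightarrow> f v \<in> S) \<Longrightarrow> prod f W \<in> S" for f and W :: "'a set"
    by (induction W rule: infinite_finite_induct) (auto intro: mult one)
  have "as_poly_in x P \<in> S"
    unfolding as_poly_in_def mp_eval_def
  proof (intro sum' mult prod pow const mpols_in_mconst)
    fix \<mu> v assume "\<mu> \<in> Poly_Mapping.keys P" "v \<in> Poly_Mapping.keys \<mu>"
    then have "v \<in> insert x V" using assms by (auto simp: mpols_in_def)
    then show "(if v = x then [:0, 1:] else [:mvar v:]) \<in> S"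
      using X by (auto intro!: const mpols_in_mvar simp del: One_nat_def)
  qed
  then show ?thesis by (simp add: S_def)
qed

text \<open>Seen as a polynomial in a variable \<open>x\<close> outside \<open>V\<close>, the
  product is a nonzero constant; degrees in \<open>x\<close> add in a domain, so \<open>x\<close>
  cannot occur in \<open>P\<close>. The linear order on the variables serves the domain property of
  the polynomial ring.\<close>

lemma mpols_in_factor:
  fixes P Q :: "('v::linorder, 'a::idom) mpol"
  assumes "P * Q \<in> mpols_in V" "P * Q \<noteq> 0"
  shows "P \<in> mpols_in V"
proof (rule ccontr)
  assume "P \<notin> mpols_in V"
  then obtain \<mu> x where x: "\<mu> \<in> Poly_Mapping.keys P" "x \<in> Poly_Mapping.keys \<mu>" "x \<notin> V"
    by (auto simp: mpols_in_def)
  interpret comm_ring_hom "as_poly_in x :: ('v, 'a) mpol \<Rightarrow> _"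
    by (rule comm_ring_hom_as_poly_in)
  have eq: "as_poly_in x P * as_poly_in x Q = [:P * Q:]"
    using as_poly_in_const[OF assms(1) x(3)] by (simp add: hom_mult)
  then have "degree (as_poly_in x P * as_poly_in x Q) = 0" by simp
  moreover have "as_poly_in x P \<noteq> 0" "as_poly_in x Q \<noteq> 0"
    using eq assms(2) by auto
  ultimately have "degree (as_poly_in x P) = 0"
    by (simp add: degree_mult_eq)
  then have c: "as_poly_in x P = [:coeff (as_poly_in x P) 0:]"
    by (rule degree_0_id[symmetric])
  have "poly (as_poly_in x P) (mvar x) = coeff (as_poly_in x P) 0"
    by (subst c) simp
  then have "P = coeff (as_poly_in x P) 0"
    by (simp only: poly_as_poly_in)
  moreover have "P \<in> mpols_in (insert x (UNIV - {x}))"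
    by (simp add: insert_absorb)
  ultimately have "P \<in> mpols_in (UNIV - {x})"
    using coeff_as_poly_in by metis
  then show False using x by (auto simp: mpols_in_def)
qed

lemma mpols_in_dvd:
  fixes P Q :: "('v::linorder, 'a::idom) mpol"
  assumes "P dvd Q" "Q \<in> mpols_in V" "Q \<noteq> 0"
  shows "P \<in> mpols_in V"
proof -
  obtain K where "Q = P * K" using assms(1) by (elim dvdE)
  then show ?thesis using assms mpols_in_factor[of P K V] by simp
qed

text \<open>Without variables the ring is that of the integers. Adding \<open>x\<close> passes from
  a ring to the polynomials over it, where \<open>poly_gcd_ex\<close> applies;
  \<open>as_poly_in x\<close> and evaluation at \<open>x\<close> carry divisibility there and
  back.\<close>

lemma gcd_subring_mpols_in:
  assumes "finite V"
  shows "gcd_subring (mpols_in V :: ('v::linorder, int) mpol set)"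
  using assms
proof (induction V rule: finite_induct)
  case empty
  show ?case
  proof
    fix P Q :: "('v, int) mpol" assume "P \<in> mpols_in {}" "Q \<in> mpols_in {}"
    then obtain a b where ab: "P = mconst a" "Q = mconst b" by (auto simp: mpols_in_empty)
    \<comment> \<open>Setting all variables to 0 reads the integer off a constant polynomial and
      transports divisibility to the integers.\<close>
    interpret e: comm_ring_hom "mp_eval id (\<lambda>_. 0) :: ('v, int) mpol \<Rightarrow> int"
      by (rule comm_ring_hom.comm_ring_hom_mp_eval) (unfold_locales, simp_all)
    interpret i: comm_ring_hom "id :: int \<Rightarrow> int" by (unfold_locales, simp_all)
    interpret m: comm_ring_hom "mconst :: int \<Rightarrow> ('v, int) mpol" by (rule comm_ring_hom_mconst)
    have "is_gcd {P, Q} (mconst (gcd a b))"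
    proof (cases "P = 0 \<and> Q = 0")
      case True
      then have "a = 0" "b = 0" using ab by (metis lookup_single_eq lookup_zero)+
      with True show ?thesis by (simp add: is_gcd_def)
    next
      case False
      have "h dvd mconst (gcd a b)" if h: "h dvd P" "h dvd Q" for h
      proof -
        have "h \<in> mpols_in {}"
          using False h mpols_in_dvd[of h P "{}"] mpols_in_dvd[of h Q "{}"] by (auto simp: ab)
        then obtain c where c: "h = mconst c" by (auto simp: mpols_in_empty)
        have "c dvd a" "c dvd b"
          using e.hom_dvd[OF h(1)] e.hom_dvd[OF h(2)] by (simp_all add: ab c i.mp_eval_single)
        then show ?thesis unfolding c by (intro m.hom_dvd) simp
      qed
      then show ?thesis by (auto simp: is_gcd_def ab intro: m.hom_dvd)
    qed
    then show "\<exists>g\<in>mpols_in {}. is_gcd {P, Q} g" using mpols_in_mconst by blast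
  qed (auto intro: mpols_in_add mpols_in_uminus mpols_in_mult mpols_in_factor)
next
  case (insert x V)
  interpret R: gcd_subring "mpols_in V :: ('v, int) mpol set" by (rule insert.IH)
  interpret h: comm_ring_hom "as_poly_in x :: ('v, int) mpol \<Rightarrow> _"
    by (rule comm_ring_hom_as_poly_in)
  have p_dvd: "poly A (mvar x) dvd poly B (mvar x)" if "A dvd B" for A B :: "('v, int) mpol poly"
    using that by (elim dvdE) simp
  have R: "as_poly_in x P \<in> R.R_polys" if "P \<in> mpols_in (insert x V)" for P
    using coeff_as_poly_in[OF that] by (simp add: R.R_polys_def)
  show ?case
  proof
    fix P Q :: "('v, int) mpol"
    assume PQ: "P \<in> mpols_in (insert x V)" "Q \<in> mpols_in (insert x V)"
    show "\<exists>g\<in>mpols_in (insert x V). is_gcd {P, Q} g"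
    proof (cases "P = 0 \<and> Q = 0")
      case True
      then show ?thesis by (auto simp: is_gcd_def)
    next
      case False
      obtain G where G: "G \<in> R.R_polys" "G dvd as_poly_in x P" "G dvd as_poly_in x Q"
        "\<And>H. H \<in> R.R_polys \<Longrightarrow> H dvd as_poly_in x P \<Longrightarrow> H dvd as_poly_in x Q \<Longrightarrow> H dvd G"
        using R.poly_gcd_ex[OF R[OF PQ(1)] R[OF PQ(2)]] by blast
      \<comment> \<open>\<open>G\<close> is known to be a multiple only of those common divisors
        whose coefficients lie in \<open>mpols_in V\<close>. Since \<open>P\<close> and
        \<open>Q\<close> are not both 0, every common divisor qualifies.\<close>
      have mem: "H \<in> mpols_in (insert x V)" if "H dvd P" "H dvd Q" for H
        using False that mpols_in_dvd[of H P] mpols_in_dvd[of H Q] PQ by blast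
      have "poly G (mvar x) dvd P" "poly G (mvar x) dvd Q"
        using p_dvd[OF G(2)] p_dvd[OF G(3)] by (simp_all only: poly_as_poly_in)
      moreover have "H dvd poly G (mvar x)" if "H dvd P" "H dvd Q" for H
      proof -
        have "as_poly_in x H dvd G"
          using that by (intro G(4) R mem h.hom_dvd)
        from p_dvd[OF this] show ?thesis by (simp only: poly_as_poly_in)
      qed
      ultimately show ?thesis
        using mem by (intro bexI[of _ "poly G (mvar x)"]) (auto simp: is_gcd_def)
    qed
  qed (auto intro: mpols_in_add mpols_in_uminus mpols_in_mult mpols_in_factor)
qed

lemma mpol_gcd_ex:
  fixes S :: "('v::linorder, int) mpol set"
  assumes "finite S"
  shows "\<exists>g. is_gcd S g"
proof -
  obtain V where "finite V" "S \<subseteq> mpols_in V" using mpols_in_ex_finite[OF assms] by blast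
  then show ?thesis
    using gcd_subring.gcd_finite_ex[OF gcd_subring_mpols_in assms] by blast
qed

text \<open>A divisor of 1 involves no variables and is thus an integer dividing 1.\<close>

lemma mpol_dvd_one:
  fixes P :: "('v::linorder, int) mpol"
  assumes "P dvd 1"
  shows "P = 1 \<or> P = - 1"
proof -
  interpret e: comm_ring_hom "mp_eval id (\<lambda>_. 0) :: ('v, int) mpol \<Rightarrow> int"
    by (rule comm_ring_hom.comm_ring_hom_mp_eval) (unfold_locales, simp_all)
  interpret i: comm_ring_hom "id :: int \<Rightarrow> int" by (unfold_locales, simp_all)
  have "P \<in> mpols_in {}" using mpols_in_dvd[OF assms, of "{}"] by simp
  then obtain c where c: "P = mconst c" by (auto simp: mpols_in_empty)
  have "c dvd 1" using e.hom_dvd[OF assms] by (simp add: c i.mp_eval_single)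
  then have "c = 1 \<or> c = -1" by auto
  then show ?thesis
    unfolding c by (elim disjE) (simp_all only: single_uminus single_one simp_thms)
qed


section \<open>The resultant polynomial\<close>

lemma lookup_single_mult:
  "Poly_Mapping.lookup (Poly_Mapping.single \<beta> c * P) \<gamma>
    = (\<Sum>\<alpha>\<in>Poly_Mapping.keys P. (c * Poly_Mapping.lookup P \<alpha>) when \<beta> + \<alpha> = \<gamma>)"
  for P :: "('v, 'a::comm_ring_1) mpol"
proof -
  have "Poly_Mapping.single \<beta> c * P
      = (\<Sum>\<alpha>\<in>Poly_Mapping.keys P. Poly_Mapping.single \<beta> c * Poly_Mapping.single \<alpha> (Poly_Mapping.lookup P \<alpha>))"
    by (subst (1) mpol_sum_monomials[symmetric]) (rule sum_distrib_left)
  then show ?thesis by (simp add: mult_single lookup_sum lookup_single)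
qed

lemma monoms_bound: "\<alpha> \<in> monoms n d \<Longrightarrow> Poly_Mapping.lookup \<alpha> i \<le> d"
proof (cases "i \<in> Poly_Mapping.keys \<alpha>")
  case True
  assume "\<alpha> \<in> monoms n d"
  then show ?thesis
    using member_le_sum[OF True, of "Poly_Mapping.lookup \<alpha>"] by (simp add: monoms_def mon_degree_def)
qed (simp add: in_keys_iff)

lemma finite_monoms [simp]: "finite (monoms n d)"
proof (rule finite_subset)
  let ?f = "\<lambda>f. \<Sum>i\<le>n. Poly_Mapping.single i (f i)"
  show "monoms n d \<subseteq> ?f ` PiE {..n} (\<lambda>_. {..d})"
  proof
    fix \<alpha> assume \<alpha>: "\<alpha> \<in> monoms n d"
    have "\<alpha> = ?f (restrict (Poly_Mapping.lookup \<alpha>) {..n})"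
    proof (rule poly_mapping_eqI)
      fix i
      have "i \<notin> {..n} \<Longrightarrow> Poly_Mapping.lookup \<alpha> i = 0"
        using \<alpha> by (auto simp: monoms_def in_keys_iff)
      then show "Poly_Mapping.lookup \<alpha> i = Poly_Mapping.lookup (?f (restrict (Poly_Mapping.lookup \<alpha>) {..n})) i"
        by (auto simp: lookup_sum lookup_single when_def)
    qed
    moreover have "restrict (Poly_Mapping.lookup \<alpha>) {..n} \<in> PiE {..n} (\<lambda>_. {..d})"
      using monoms_bound[OF \<alpha>] by auto
    ultimately show "\<alpha> \<in> ?f ` PiE {..n} (\<lambda>_. {..d})" by blast
  qed
qed (simp add: finite_PiE)

lemma finite_coeff_vars [simp]: "finite (coeff_vars n d)"
  by (simp add: coeff_vars_def)

lemma monoms_add: "\<alpha> \<in> monoms n d \<Longrightarrow> \<beta> \<in> monoms n e \<Longrightarrow> \<alpha> + \<beta> \<in> monoms n (d + e)"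
  using keys_add[of \<alpha> \<beta>] by (auto simp: monoms_def mon_degree_add)

lemma forms_keys: "P \<in> forms k n d \<Longrightarrow> Poly_Mapping.keys P \<subseteq> monoms n d"
  by (auto simp: forms_def)

lemma lookup_forms_with_coeffs:
  "Poly_Mapping.lookup (forms_with_coeffs n d a i) \<alpha> = (a (i, \<alpha>) when \<alpha> \<in> monoms n d)"
  by (simp add: forms_with_coeffs_def lookup_sum lookup_single when_def)

lemma forms_with_coeffs_in_forms [simp]: "forms_with_coeffs n d a i \<in> forms UNIV n d"
  by (auto simp: forms_def in_keys_iff lookup_forms_with_coeffs)

lemma forms_with_coeffs_coeffs_of:
  "F i \<in> forms UNIV n d \<Longrightarrow> forms_with_coeffs n d (coeffs_of F) i = F i"
  using forms_keys[of "F i" UNIV n d]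
  by (intro poly_mapping_eqI) (auto simp: lookup_forms_with_coeffs coeffs_of_def when_def in_keys_iff)

lemma mon_eq_sum_lookup: "mon_degree \<alpha> = (\<Sum>i\<le>n. Poly_Mapping.lookup \<alpha> i)"
  if "Poly_Mapping.keys \<alpha> \<subseteq> {..n :: nat}"
  using that by (intro mon_degree_eq_sum) simp_all

text \<open>Column \<open>(i, \<beta>)\<close> holds the coefficients of the monomial with exponent
  \<open>\<beta>\<close> times \<open>F i\<close>. Here the forms are arbitrary and over any ring,
  so that the matrix can be specialized and transformed.\<close>

definition macaulay_coeff ::
    "(nat \<Rightarrow> (nat, 'a::comm_ring_1) mpol) \<Rightarrow> (nat \<Rightarrow>\<^sub>0 nat) \<Rightarrow> nat \<times> (nat \<Rightarrow>\<^sub>0 nat) \<Rightarrow> 'a"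
  where "macaulay_coeff F \<gamma> = (\<lambda>(i, \<beta>). Poly_Mapping.lookup (Poly_Mapping.single \<beta> 1 * F i) \<gamma>)"

definition macaulay_cols :: "nat \<Rightarrow> nat \<Rightarrow> (nat \<times> (nat \<Rightarrow>\<^sub>0 nat)) set"
  where "macaulay_cols n d = {..n} \<times> monoms n (macaulay_degree n d - d)"

definition minor_selections ::
    "nat \<Rightarrow> nat \<Rightarrow> ((nat \<Rightarrow> nat \<Rightarrow>\<^sub>0 nat) \<times> (nat \<Rightarrow> nat \<times> (nat \<Rightarrow>\<^sub>0 nat))) set"
  where "minor_selections n d = {(e, c).
    bij_betw e {..<card (monoms n (macaulay_degree n d))} (monoms n (macaulay_degree n d)) \<and>
    c ` {..<card (monoms n (macaulay_degree n d))} \<subseteq> macaulay_cols n d}"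

definition macaulay_minor ::
    "nat \<Rightarrow> nat \<Rightarrow> (nat \<Rightarrow> (nat, 'a::comm_ring_1) mpol) \<Rightarrow> (nat \<Rightarrow> nat \<Rightarrow>\<^sub>0 nat) \<Rightarrow>
      (nat \<Rightarrow> nat \<times> (nat \<Rightarrow>\<^sub>0 nat)) \<Rightarrow> 'a"
  where "macaulay_minor n d F e c =
    (let r = card (monoms n (macaulay_degree n d)) in
      det (mat r r (\<lambda>(u, v). macaulay_coeff F (e u) (c v))))"

lemma macaulay_minors_eq:
  "macaulay_minors n d =
    (\<lambda>(e, c). macaulay_minor n d (forms_with_coeffs n d mvar) e c) ` minor_selections n d"
  by (auto simp: macaulay_minors_def minor_selections_def macaulay_minor_def macaulay_cols_def
      macaulay_entry_def macaulay_coeff_def Let_def image_iff)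

lemma single_mult_forms_with_coeffs:
  "Poly_Mapping.single \<beta> 1 * forms_with_coeffs n d b i
    = (\<Sum>\<alpha>\<in>monoms n d. Poly_Mapping.single (\<beta> + \<alpha>) (b (i, \<alpha>)))"
  by (simp add: forms_with_coeffs_def sum_distrib_left mult_single)

lemma hom_macaulay_coeff:
  assumes "comm_ring_hom h"
  shows "h (macaulay_coeff (forms_with_coeffs n d a) \<gamma> k)
    = macaulay_coeff (forms_with_coeffs n d (\<lambda>v. h (a v))) \<gamma> k"
proof -
  interpret comm_ring_hom h by fact
  show ?thesis
    by (cases k) (simp add: macaulay_coeff_def single_mult_forms_with_coeffs lookup_sum lookup_single when_def hom_sum if_distrib cong: if_cong)
qed

lemma hom_macaulay_minor:
  assumes "comm_ring_hom h"
  shows "h (macaulay_minor n d (forms_with_coeffs n d a) e c)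
    = macaulay_minor n d (forms_with_coeffs n d (\<lambda>v. h (a v))) e c"
proof -
  interpret comm_ring_hom h by fact
  have "map_mat h (mat r r (\<lambda>(u, v). macaulay_coeff (forms_with_coeffs n d a) (e u) (c v)))
      = mat r r (\<lambda>(u, v). macaulay_coeff (forms_with_coeffs n d (\<lambda>v. h (a v))) (e u) (c v))" for r
    by (rule eq_matI) (simp_all add: hom_macaulay_coeff[OF assms])
  then show ?thesis
    by (simp add: macaulay_minor_def Let_def flip: hom_det)
qed

lemma macaulay_minor_cong:
  assumes "\<And>i. i \<le> n \<Longrightarrow> F i = G i" "(e, c) \<in> minor_selections n d"
  shows "macaulay_minor n d F e c = macaulay_minor n d G e c"
  unfolding macaulay_minor_def Let_def
  by (intro arg_cong[of _ _ det] cong_mat)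
    (use assms in \<open>auto simp: minor_selections_def macaulay_cols_def macaulay_coeff_def split: prod.splits\<close>)

text \<open>This carries divisibility of the generic minors by the resultant over to the minors of a
  given tuple in any commutative ring.\<close>

lemma mp_eval_macaulay_minor:
  assumes "\<And>i. i \<le> n \<Longrightarrow> F i \<in> forms UNIV n d" "(e, c) \<in> minor_selections n d"
  shows "mp_eval of_int (coeffs_of F) (macaulay_minor n d (forms_with_coeffs n d mvar) e c)
    = macaulay_minor n d F e c"
proof -
  have "mp_eval of_int (coeffs_of F) (macaulay_minor n d (forms_with_coeffs n d mvar) e c)
      = macaulay_minor n d (forms_with_coeffs n d (\<lambda>v. mp_eval of_int (coeffs_of F) (mvar v))) e c"
    by (intro hom_macaulay_minor comm_ring_hom.comm_ring_hom_mp_eval comm_ring_hom_of_int)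
  also have "\<dots> = macaulay_minor n d F e c"
    using assms(1)
    by (intro macaulay_minor_cong assms(2))
      (simp add: comm_ring_hom.mp_eval_single[OF comm_ring_hom_of_int] forms_with_coeffs_coeffs_of)
  finally show ?thesis .
qed

text \<open>Selections are functions on all of \<open>nat\<close>, so there are infinitely many of
  them. Cutting them down to the first \<open>r\<close> arguments leaves finitely many without
  changing the minors.\<close>

lemma macaulay_minor_restrict:
  fixes n d defines "r \<equiv> card (monoms n (macaulay_degree n d))"
  shows "macaulay_minor n d F (restrict e {..<r}) (restrict c {..<r}) = macaulay_minor n d F e c"
  unfolding macaulay_minor_def Let_def r_def
  by (intro arg_cong[of _ _ det] cong_mat) auto

lemma finite_macaulay_minors: "finite (macaulay_minors n d)"
proof -
  define M where "M = monoms n (macaulay_degree n d)"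
  define r where "r = card M"
  have "macaulay_minors n d \<subseteq>
      (\<lambda>(e, c). macaulay_minor n d (forms_with_coeffs n d mvar) e c) `
        (PiE {..<r} (\<lambda>_. M) \<times> PiE {..<r} (\<lambda>_. macaulay_cols n d))"
  proof
    fix \<Delta> assume "\<Delta> \<in> macaulay_minors n d"
    then obtain e c where ec: "(e, c) \<in> minor_selections n d"
      "\<Delta> = macaulay_minor n d (forms_with_coeffs n d mvar) e c"
      by (auto simp: macaulay_minors_eq)
    have "\<Delta> = macaulay_minor n d (forms_with_coeffs n d mvar) (restrict e {..<r}) (restrict c {..<r})"
      unfolding r_def M_def macaulay_minor_restrict ec(2) ..
    moreover have "restrict e {..<r} \<in> PiE {..<r} (\<lambda>_. M)" "restrict c {..<r} \<in> PiE {..<r} (\<lambda>_. macaulay_cols n d)"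
      using ec(1) by (auto simp: minor_selections_def M_def r_def bij_betw_def)
    ultimately show "\<Delta> \<in> (\<lambda>(e, c). macaulay_minor n d (forms_with_coeffs n d mvar) e c) `
        (PiE {..<r} (\<lambda>_. M) \<times> PiE {..<r} (\<lambda>_. macaulay_cols n d))"
      by (intro image_eqI[of _ _ "(restrict e {..<r}, restrict c {..<r})"]) auto
  qed
  then show ?thesis
    by (rule finite_subset) (simp add: M_def macaulay_cols_def finite_PiE)
qed

definition power_forms :: "nat \<Rightarrow> nat \<Rightarrow> (nat, 'a::comm_ring_1) mpol"
  where "power_forms d i = Poly_Mapping.single (Poly_Mapping.single i d) 1"

lemma power_forms_in_forms: "i \<le> n \<Longrightarrow> power_forms d i \<in> forms UNIV n d"
  by (auto simp: power_forms_def forms_def monoms_def split: if_splits)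

lemma coeffs_of_power_forms:
  "coeffs_of (power_forms d) = (\<lambda>(i, \<alpha>). if \<alpha> = Poly_Mapping.single i d then 1 else 0)"
  by (auto simp: fun_eq_iff coeffs_of_def power_forms_def lookup_single when_def)

text \<open>
  By the pigeonhole principle every monomial of degree \<open>(n+1)(d-1)+1\<close> is divisible by some \<open>X\<^sub>i\<^sup>d\<close>,
  so at \<open>(X\<^sub>0\<^sup>d, \<dots>, X\<^sub>n\<^sup>d)\<close> the Macaulay matrix contains the identity matrix.
\<close>

lemma ex_unit_minor:
  assumes "d \<ge> 1"
  obtains e c where "(e, c) \<in> minor_selections n d"
    "macaulay_minor n d (power_forms d :: nat \<Rightarrow> (nat, 'a::comm_ring_1) mpol) e c = 1"
proof -
  define M where "M = monoms n (macaulay_degree n d)"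
  obtain e where e: "bij_betw e {..<card M} M"
    using ex_bij_betw_nat_finite[of M] by (auto simp: M_def atLeast0LessThan)
  have "\<exists>i\<le>n. d \<le> Poly_Mapping.lookup \<gamma> i" if "\<gamma> \<in> M" for \<gamma>
  proof (rule ccontr)
    assume "\<not> (\<exists>i\<le>n. d \<le> Poly_Mapping.lookup \<gamma> i)"
    then have "(\<Sum>i\<le>n. Poly_Mapping.lookup \<gamma> i) \<le> (\<Sum>i\<le>n. d - 1)"
      by (intro sum_mono) force
    also have "(\<Sum>i\<le>n. Poly_Mapping.lookup \<gamma> i) = mon_degree \<gamma>"
      using that by (intro mon_eq_sum_lookup[symmetric]) (simp add: M_def monoms_def)
    finally show False using that by (simp add: M_def monoms_def macaulay_degree_def)
  qed
  then obtain i where i: "i \<gamma> \<le> n" "d \<le> Poly_Mapping.lookup \<gamma> (i \<gamma>)" if "\<gamma> \<in> M" for \<gamma>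
    by metis
  define q where "q \<gamma> = \<gamma> - Poly_Mapping.single (i \<gamma>) d" for \<gamma>
  have split: "\<gamma> = q \<gamma> + Poly_Mapping.single (i \<gamma>) d" if "\<gamma> \<in> M" for \<gamma>
    by (rule poly_mapping_eqI)
      (use i(2)[OF that] in \<open>auto simp: q_def lookup_add lookup_minus lookup_single when_def\<close>)
  have q: "q \<gamma> \<in> monoms n (macaulay_degree n d - d)" if "\<gamma> \<in> M" for \<gamma>
  proof -
    have "mon_degree \<gamma> = mon_degree (q \<gamma>) + d"
      by (subst split[OF that]) (simp add: mon_degree_add)
    moreover have "Poly_Mapping.keys (q \<gamma>) \<subseteq> Poly_Mapping.keys \<gamma>"
      by (auto simp: q_def in_keys_iff lookup_minus)
    ultimately show ?thesis using that by (auto simp: M_def monoms_def)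
  qed
  \<comment> \<open>Column \<open>v\<close> then stands for the monomial \<open>e v\<close> itself,
    which puts the single entry 1 on the diagonal.\<close>
  define c where "c v = (i (e v), q (e v))" for v
  have eM: "e u \<in> M" if "u < card M" for u
    using e that by (auto simp: bij_betw_def)
  have "(e, c) \<in> minor_selections n d"
    using e i q eM by (auto simp: minor_selections_def macaulay_cols_def c_def M_def)
  moreover have "mat (card M) (card M) (\<lambda>(u, v). macaulay_coeff (power_forms d :: nat \<Rightarrow> (nat, 'a) mpol) (e u) (c v))
      = 1\<^sub>m (card M)"
  proof (rule eq_matI)
    fix u v assume "u < dim_row (1\<^sub>m (card M) :: 'a mat)" "v < dim_col (1\<^sub>m (card M) :: 'a mat)"
    then have uv: "u < card M" "v < card M" by auto
    have "macaulay_coeff (power_forms d :: nat \<Rightarrow> (nat, 'a) mpol) (e u) (c v) = (1 when e v = e u)"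
      using split[OF eM[OF uv(2)]]
      by (simp add: macaulay_coeff_def c_def power_forms_def mult_single lookup_single)
    also have "e v = e u \<longleftrightarrow> v = u"
      using e uv by (auto simp: bij_betw_def inj_on_def)
    finally show "mat (card M) (card M) (\<lambda>(u, v). macaulay_coeff (power_forms d :: nat \<Rightarrow> (nat, 'a) mpol) (e u) (c v)) $$ (u, v)
        = 1\<^sub>m (card M) $$ (u, v)"
      using uv by (auto simp: when_def)
  qed auto
  then have "macaulay_minor n d (power_forms d :: nat \<Rightarrow> (nat, 'a) mpol) e c = 1"
    by (simp add: macaulay_minor_def M_def Let_def)
  ultimately show ?thesis using that by blast
qed

text \<open>The definite description denotes: some minor has the value 1 at the pure powers, so the
  value of any gcd there divides 1, and a choice of sign makes it 1. Two gcds differ by a unit, that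
  is by a sign, and the value at the pure powers excludes -1.\<close>

lemma resultant_poly_spec:
  assumes "d \<ge> 1"
  shows "\<And>\<Delta>. \<Delta> \<in> macaulay_minors n d \<Longrightarrow> resultant_poly n d dvd \<Delta>"
    and "mp_eval of_int (coeffs_of (power_forms d)) (resultant_poly n d) = (1::int)"
proof -
  define ev :: "(cvar, int) mpol \<Rightarrow> int" where "ev = mp_eval of_int (coeffs_of (power_forms d))"
  interpret ev: comm_ring_hom ev
    unfolding ev_def by (intro comm_ring_hom.comm_ring_hom_mp_eval comm_ring_hom_of_int)
  define P where "P \<rho> \<longleftrightarrow> is_gcd (macaulay_minors n d) \<rho> \<and> ev \<rho> = 1" for \<rho>
  obtain \<rho> where \<rho>: "is_gcd (macaulay_minors n d) \<rho>"
    using mpol_gcd_ex[OF finite_macaulay_minors] by blast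
  obtain e c where ec: "(e, c) \<in> minor_selections n d"
    "macaulay_minor n d (power_forms d :: nat \<Rightarrow> (nat, int) mpol) e c = 1"
    using ex_unit_minor[OF assms] by blast
  define \<Delta> where "\<Delta> = macaulay_minor n d (forms_with_coeffs n d mvar :: nat \<Rightarrow> (nat, (cvar, int) mpol) mpol) e c"
  have \<Delta>: "\<Delta> \<in> macaulay_minors n d"
    unfolding macaulay_minors_eq \<Delta>_def by (rule image_eqI[OF _ ec(1)]) simp
  have "ev \<Delta> = 1"
    unfolding ev_def \<Delta>_def using ec
    by (subst mp_eval_macaulay_minor) (auto intro: power_forms_in_forms)
  then have "ev \<rho> dvd 1"
    using ev.hom_dvd[of \<rho> \<Delta>] \<rho> \<Delta> by (simp add: is_gcd_def)
  then have "ev \<rho> = 1 \<or> ev \<rho> = - 1" by auto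
  then have "P \<rho> \<or> P (- \<rho>)"
    using \<rho> by (auto simp: P_def is_gcd_def ev.hom_uminus)
  moreover have "\<rho>1 = \<rho>2" if "P \<rho>1" "P \<rho>2" for \<rho>1 \<rho>2
  proof -
    have "\<rho>1 dvd \<rho>2" "\<rho>2 dvd \<rho>1" using that by (auto simp: P_def is_gcd_def)
    then obtain u w where u: "\<rho>2 = \<rho>1 * u" and w: "\<rho>1 = \<rho>2 * w" by (elim dvdE)
    have "\<rho>1 \<noteq> 0" using that by (auto simp: P_def)
    moreover have "\<rho>1 * (u * w) = \<rho>1 * 1" using u w by (metis mult.assoc mult_1_right)
    ultimately have "u * w = 1" using mult_cancel_left by blast
    then have "u = 1 \<or> u = - 1" by (intro mpol_dvd_one) (metis dvd_triv_left)
    moreover have "ev u = 1" using that u by (simp add: P_def ev.hom_mult)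
    ultimately have "u = 1" by (auto simp: ev.hom_uminus)
    then show ?thesis using u by simp
  qed
  ultimately have "\<exists>!\<rho>. P \<rho>" by metis
  then have "P (THE \<rho>. P \<rho>)" by (rule theI')
  moreover have "resultant_poly n d = (THE \<rho>. P \<rho>)"
    unfolding resultant_poly_def P_def is_gcd_def ev_def coeffs_of_power_forms conj_assoc ..
  ultimately have "P (resultant_poly n d)" by simp
  then show "\<And>\<Delta>. \<Delta> \<in> macaulay_minors n d \<Longrightarrow> resultant_poly n d dvd \<Delta>"
    and "mp_eval of_int (coeffs_of (power_forms d)) (resultant_poly n d) = (1::int)"
    by (auto simp: P_def is_gcd_def ev_def)
qed

lemma mpols_in_sum: "(\<And>i. i \<in> I \<Longrightarrow> f i \<in> mpols_in V) \<Longrightarrow> sum f I \<in> mpols_in V"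
  by (induction I rule: infinite_finite_induct) (auto intro: mpols_in_add)

lemma mpols_in_prod:
  "(\<And>i. i \<in> I \<Longrightarrow> f i \<in> mpols_in V) \<Longrightarrow> prod f I \<in> mpols_in V" for f :: "'i \<Rightarrow> ('v, 'a::comm_ring_1) mpol"
  by (induction I rule: infinite_finite_induct) (auto intro: mpols_in_mult)

lemma macaulay_minor_mpols_in:
  assumes "(e, c) \<in> minor_selections n d"
  shows "macaulay_minor n d (forms_with_coeffs n d mvar) e c \<in> (mpols_in (coeff_vars n d) :: (cvar, int) mpol set)"
proof -
  have entry: "macaulay_coeff (forms_with_coeffs n d mvar) \<gamma> (i, \<beta>) \<in> (mpols_in (coeff_vars n d) :: (cvar, int) mpol set)"
    if "i \<le> n" for \<gamma> i \<beta>
    unfolding macaulay_coeff_def prod.case lookup_single_mult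
    by (intro mpols_in_sum)
      (use that in \<open>auto simp: when_def lookup_forms_with_coeffs coeff_vars_def simp del: One_nat_def intro!: mpols_in_mvar\<close>)
  have sgn: "(of_int (sign p) :: (cvar, int) mpol) \<in> mpols_in (coeff_vars n d)" for p
    by (simp add: sign_def mpols_in_uminus)
  show ?thesis
    unfolding macaulay_minor_def Let_def
  proof (subst det_def', rule mat_carrier, intro mpols_in_sum mpols_in_mult mpols_in_prod sgn)
    let ?r = "card (monoms n (macaulay_degree n d))"
    fix p i assume p: "p \<in> {p. p permutes {0..<?r}}" and i: "i \<in> {0..<?r}"
    then have "p i < ?r" using permutes_in_image[of p "{0..<?r}" i] by simp
    then have "c (p i) \<in> macaulay_cols n d"
      using assms unfolding minor_selections_def by blast
    then obtain j \<beta> where j: "c (p i) = (j, \<beta>)" "j \<le> n"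
      unfolding macaulay_cols_def by blast
    show "mat ?r ?r (\<lambda>(u, v). macaulay_coeff (forms_with_coeffs n d mvar) (e u) (c v)) $$ (i, p i)
        \<in> (mpols_in (coeff_vars n d) :: (cvar, int) mpol set)"
      using i \<open>p i < ?r\<close> by (simp add: j(1) del: One_nat_def) (rule entry[OF j(2)])
  qed
qed

lemma ex_nonzero_minor:
  assumes "d \<ge> 1"
  obtains e c where "(e, c) \<in> minor_selections n d"
    "macaulay_minor n d (forms_with_coeffs n d mvar) e c \<noteq> (0 :: (cvar, int) mpol)"
proof -
  obtain e c where ec: "(e, c) \<in> minor_selections n d"
    "macaulay_minor n d (power_forms d :: nat \<Rightarrow> (nat, int) mpol) e c = 1"
    using ex_unit_minor[OF assms] by blast
  have "mp_eval of_int (coeffs_of (power_forms d :: nat \<Rightarrow> (nat, int) mpol))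
      (macaulay_minor n d (forms_with_coeffs n d mvar) e c) = 1"
    using ec by (subst mp_eval_macaulay_minor) (auto intro: power_forms_in_forms)
  then have "macaulay_minor n d (forms_with_coeffs n d mvar) e c \<noteq> (0 :: (cvar, int) mpol)"
    using comm_ring_hom.mp_eval_0[OF comm_ring_hom_of_int, of "coeffs_of (power_forms d)"] zero_neq_one by metis
  with ec that show ?thesis by blast
qed

text \<open>A divisor of a nonzero minor contains only variables of that minor. Hence
  \<open>resultant_of\<close> depends only on the coefficients named by
  \<open>coeff_vars\<close>.\<close>

lemma resultant_poly_mpols_in:
  assumes "d \<ge> 1"
  shows "resultant_poly n d \<in> mpols_in (coeff_vars n d)"
proof -
  obtain e c where ec: "(e, c) \<in> minor_selections n d"
    "macaulay_minor n d (forms_with_coeffs n d mvar) e c \<noteq> (0 :: (cvar, int) mpol)"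
    using ex_nonzero_minor[OF assms] by blast
  have "resultant_poly n d dvd macaulay_minor n d (forms_with_coeffs n d mvar) e c"
    using ec(1) by (intro resultant_poly_spec assms) (auto simp: macaulay_minors_eq)
  then show ?thesis
    using ec by (rule_tac mpols_in_dvd[OF _ macaulay_minor_mpols_in])
qed


section \<open>Conjugation of tuples of forms\<close>

lemma keys_mconst_mult: "Poly_Mapping.keys (mconst c * P) \<subseteq> Poly_Mapping.keys P"
  for P :: "('v, 'a::comm_ring_1) mpol"
  using keys_mult[of "mconst c" P] by (auto split: if_splits)

lemma lookup_mconst_mult [simp]: "Poly_Mapping.lookup (mconst c * P) \<alpha> = c * Poly_Mapping.lookup P \<alpha>"
  for P :: "('v, 'a::comm_ring_1) mpol"
  unfolding lookup_single_mult by (simp add: when_def in_keys_iff)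

lemma forms_0 [simp]: "0 \<in> forms UNIV n d"
  by (simp add: forms_def)

lemma forms_add: "P \<in> forms UNIV n d \<Longrightarrow> Q \<in> forms UNIV n d \<Longrightarrow> P + Q \<in> forms UNIV n d"
  using keys_add[of P Q] unfolding forms_def by blast

lemma forms_sum: "(\<And>i. i \<in> I \<Longrightarrow> f i \<in> forms UNIV n d) \<Longrightarrow> sum f I \<in> forms UNIV n d"
  by (induction I rule: infinite_finite_induct) (auto intro: forms_add)

lemma forms_mult: "P \<in> forms UNIV n d \<Longrightarrow> Q \<in> forms UNIV n e \<Longrightarrow> P * Q \<in> forms UNIV n (d + e)"
  for P :: "(nat, 'a::comm_ring_1) mpol"
  using keys_mult[of P Q] monoms_add[of _ n d _ e] unfolding forms_def by blast

lemma forms_mconst_mult: "P \<in> forms UNIV n d \<Longrightarrow> mconst c * P \<in> forms UNIV n d"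
  for P :: "(nat, 'a::comm_ring_1) mpol"
  using keys_mconst_mult[of c P] unfolding forms_def by blast

lemma forms_single: "\<alpha> \<in> monoms n d \<Longrightarrow> Poly_Mapping.single \<alpha> c \<in> forms UNIV n d"
  by (auto simp: forms_def split: if_splits)

lemma forms_1: "(1 :: (nat, 'a::comm_ring_1) mpol) \<in> forms UNIV n 0"
  by (auto simp: forms_def monoms_def)

lemma forms_mvar: "s \<le> n \<Longrightarrow> (mvar s :: (nat, 'a::comm_ring_1) mpol) \<in> forms UNIV n 1"
  by (rule forms_single) (simp add: monoms_def)

lemma forms_power: "P \<in> forms UNIV n d \<Longrightarrow> P ^ k \<in> forms UNIV n (k * d)"
  for P :: "(nat, 'a::comm_ring_1) mpol"
  by (induction k) (auto intro: forms_1 forms_mult)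

lemma forms_prod:
  "finite I \<Longrightarrow> (\<And>i. i \<in> I \<Longrightarrow> f i \<in> forms UNIV n (k i)) \<Longrightarrow> prod f I \<in> forms UNIV n (sum k I)"
  for f :: "'i \<Rightarrow> (nat, 'a::comm_ring_1) mpol"
  by (induction I rule: finite_induct) (auto intro: forms_1 forms_mult)

lemma forms_sum_monoms:
  fixes P :: "(nat, 'a::comm_ring_1) mpol"
  assumes "P \<in> forms UNIV n d"
  shows "P = (\<Sum>\<alpha>\<in>monoms n d. mconst (Poly_Mapping.lookup P \<alpha>) * Poly_Mapping.single \<alpha> 1)"
proof -
  have "(\<Sum>\<alpha>\<in>monoms n d. mconst (Poly_Mapping.lookup P \<alpha>) * Poly_Mapping.single \<alpha> 1)
      = forms_with_coeffs n d (coeffs_of (\<lambda>_. P)) 0"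
    by (simp add: forms_with_coeffs_def coeffs_of_def mult_single)
  then show ?thesis using assms by (simp add: forms_with_coeffs_coeffs_of)
qed

section \<open>Linear substitution and the composition of conjugations\<close>

definition lin_form :: "nat \<Rightarrow> 'a::comm_ring_1 mat \<Rightarrow> nat \<Rightarrow> (nat, 'a) mpol"
  where "lin_form n \<Gamma> l = (\<Sum>s\<le>n. mconst (\<Gamma> $$ (l, s)) * mvar s)"

definition lin_subst :: "nat \<Rightarrow> 'a::comm_ring_1 mat \<Rightarrow> (nat, 'a) mpol \<Rightarrow> (nat, 'a) mpol"
  where "lin_subst n \<Gamma> = mp_eval mconst (lin_form n \<Gamma>)"

lemma conj_forms_eq:
  "conj_forms n \<Gamma> F i = (\<Sum>j\<le>n. mconst (adj_mat \<Gamma> $$ (i, j)) * lin_subst n \<Gamma> (F j))"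
  by (simp add: conj_forms_def lin_subst_def lin_form_def[abs_def])

lemma comm_ring_hom_lin_subst: "comm_ring_hom (lin_subst n \<Gamma>)"
  unfolding lin_subst_def by (rule comm_ring_hom.comm_ring_hom_mp_eval[OF comm_ring_hom_mconst])

lemma lin_subst_mconst [simp]: "lin_subst n \<Gamma> (mconst c) = mconst c"
  by (simp add: lin_subst_def comm_ring_hom.mp_eval_single[OF comm_ring_hom_mconst])

lemma lin_subst_mvar: "lin_subst n \<Gamma> (mvar l) = lin_form n \<Gamma> l"
  by (simp add: lin_subst_def comm_ring_hom.mp_eval_single[OF comm_ring_hom_mconst])

lemma lin_form_in_forms: "lin_form n \<Gamma> l \<in> forms UNIV n 1"
  unfolding lin_form_def by (intro forms_sum forms_mconst_mult forms_mvar) simp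

lemma lin_subst_in_forms:
  assumes "P \<in> forms UNIV n d"
  shows "lin_subst n \<Gamma> P \<in> forms UNIV n d"
proof -
  have "mon_eval (lin_form n \<Gamma>) \<alpha> \<in> forms UNIV n d" if "\<alpha> \<in> monoms n d" for \<alpha>
  proof -
    have "mon_eval (lin_form n \<Gamma>) \<alpha> \<in> forms UNIV n (\<Sum>v\<in>Poly_Mapping.keys \<alpha>. Poly_Mapping.lookup \<alpha> v * 1)"
      unfolding mon_eval_def by (intro forms_prod forms_power lin_form_in_forms) simp
    then show ?thesis using that by (simp add: monoms_def mon_degree_def)
  qed
  then show ?thesis
    using forms_keys[OF assms]
    by (simp add: lin_subst_def comm_ring_hom.mp_eval_superset[OF comm_ring_hom_mconst finite_keys order_refl])
      (blast intro: forms_sum forms_mconst_mult)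
qed

lemma conj_forms_in_forms:
  assumes "\<And>j. j \<le> n \<Longrightarrow> F j \<in> forms UNIV n d"
  shows "conj_forms n \<Gamma> F i \<in> forms UNIV n d"
  unfolding conj_forms_eq using assms by (intro forms_sum forms_mconst_mult lin_subst_in_forms) simp

lemma lin_subst_cong:
  assumes "P \<in> forms UNIV n d" "\<And>l. l \<le> n \<Longrightarrow> lin_form n \<Gamma> l = x l"
  shows "lin_subst n \<Gamma> P = mp_eval mconst x P"
  unfolding lin_subst_def
  by (rule mp_eval_cong) (use assms in \<open>auto simp: forms_def monoms_def\<close>)

text \<open>Replacing \<open>X\<close> by \<open>\<Gamma> X\<close> in \<open>P(\<Delta> X)\<close>
  gives \<open>P(\<Delta> \<Gamma> X)\<close>: the matrix substituted last stands on the
  right.\<close>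

lemma lin_subst_lin_subst:
  assumes "P \<in> forms UNIV n d" "\<Gamma> \<in> carrier_mat (n + 1) (n + 1)" "\<Delta> \<in> carrier_mat (n + 1) (n + 1)"
  shows "lin_subst n \<Gamma> (lin_subst n \<Delta> P) = lin_subst n (\<Delta> * \<Gamma>) P"
proof -
  interpret g: comm_ring_hom "lin_subst n \<Gamma>" by (rule comm_ring_hom_lin_subst)
  interpret m: comm_ring_hom "mconst :: 'a \<Rightarrow> (nat, 'a) mpol" by (rule comm_ring_hom_mconst)
  have lin: "lin_form n (\<Delta> * \<Gamma>) l = lin_subst n \<Gamma> (lin_form n \<Delta> l)" if "l \<le> n" for l
  proof -
    have "(\<Delta> * \<Gamma>) $$ (l, k) = (\<Sum>s\<le>n. \<Delta> $$ (l, s) * \<Gamma> $$ (s, k))" if "k \<le> n" for k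
      using assms(2,3) that \<open>l \<le> n\<close>
      by (auto simp: scalar_prod_def atLeast0LessThan lessThan_Suc_atMost)
    then have "lin_form n (\<Delta> * \<Gamma>) l
        = (\<Sum>k\<le>n. \<Sum>s\<le>n. mconst (\<Delta> $$ (l, s)) * (mconst (\<Gamma> $$ (s, k)) * mvar k))"
      unfolding lin_form_def
      by (intro sum.cong refl) (simp add: m.hom_sum m.hom_mult sum_distrib_right mult.assoc del: One_nat_def)
    also have "\<dots> = (\<Sum>s\<le>n. mconst (\<Delta> $$ (l, s)) * lin_form n \<Gamma> s)"
      by (subst sum.swap) (simp add: lin_form_def sum_distrib_left)
    also have "\<dots> = lin_subst n \<Gamma> (lin_form n \<Delta> l)"
      unfolding lin_form_def[of n \<Delta>] g.hom_sum g.hom_mult lin_subst_mvar lin_subst_mconst ..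
    finally show ?thesis .
  qed
  have "lin_subst n \<Gamma> (lin_subst n \<Delta> P) = mp_eval mconst (\<lambda>l. lin_subst n \<Gamma> (lin_form n \<Delta> l)) P"
    unfolding lin_subst_def by (rule mp_eval_hom_compose[OF comm_ring_hom_mconst])
  also have "\<dots> = lin_subst n (\<Delta> * \<Gamma>) P"
    by (rule lin_subst_cong[OF assms(1), symmetric]) (rule lin)
  finally show ?thesis .
qed

lemma lin_subst_scalar:
  assumes "P \<in> forms UNIV n d"
  shows "lin_subst n (u \<cdot>\<^sub>m 1\<^sub>m (n + 1)) P = mconst (u ^ d) * P"
proof -
  interpret m: comm_ring_hom "mconst :: 'a \<Rightarrow> (nat, 'a) mpol" by (rule comm_ring_hom_mconst)
  have "lin_form n (u \<cdot>\<^sub>m 1\<^sub>m (n + 1)) l = mconst u * mvar l" if "l \<le> n" for l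
  proof -
    have "lin_form n (u \<cdot>\<^sub>m 1\<^sub>m (n + 1)) l = (\<Sum>s\<le>n. if s = l then mconst u * mvar l else 0)"
      unfolding lin_form_def using that by (intro sum.cong refl) auto
    then show ?thesis using that by simp
  qed
  then have "lin_subst n (u \<cdot>\<^sub>m 1\<^sub>m (n + 1)) P = mp_eval mconst (\<lambda>l. mconst u * mvar l) P"
    by (intro lin_subst_cong[OF assms]) simp
  also have "\<dots> = (\<Sum>\<alpha>\<in>Poly_Mapping.keys P.
      mconst (u ^ d) * (mconst (Poly_Mapping.lookup P \<alpha>) * mon_eval mvar \<alpha>))"
    using forms_keys[OF assms]
    by (simp only: m.mp_eval_superset[OF finite_keys order_refl])
      (auto simp: mon_eval_scale monoms_def m.hom_power mult.left_commute intro!: sum.cong simp del: One_nat_def)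
  also have "\<dots> = mconst (u ^ d) * mp_eval mconst mvar P"
    by (simp only: m.mp_eval_superset[OF finite_keys order_refl] sum_distrib_left)
  finally show ?thesis by (simp only: mp_eval_mvar)
qed

text \<open>The product of the two adjugates is left as it is, which makes the formula valid over
  every commutative ring. It becomes the adjugate of \<open>\<Gamma> * \<Gamma>'\<close> for nonzero
  determinants, and a scalar matrix for \<open>\<Gamma>' = adj_mat \<Gamma>\<close>.\<close>

lemma conj_forms_conj_forms:
  assumes "\<And>j. j \<le> n \<Longrightarrow> F j \<in> forms UNIV n d" "i \<le> n"
    and \<Gamma>: "\<Gamma> \<in> carrier_mat (n + 1) (n + 1)" and \<Gamma>': "\<Gamma>' \<in> carrier_mat (n + 1) (n + 1)"
  shows "conj_forms n \<Gamma>' (conj_forms n \<Gamma> F) i =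
    (\<Sum>k\<le>n. mconst ((adj_mat \<Gamma>' * adj_mat \<Gamma>) $$ (i, k)) * lin_subst n (\<Gamma> * \<Gamma>') (F k))"
proof -
  interpret g: comm_ring_hom "lin_subst n \<Gamma>'" by (rule comm_ring_hom_lin_subst)
  interpret m: comm_ring_hom "mconst :: 'a \<Rightarrow> (nat, 'a) mpol" by (rule comm_ring_hom_mconst)
  note adj = adj_mat(1)[OF \<Gamma>] adj_mat(1)[OF \<Gamma>']
  have entry: "(adj_mat \<Gamma>' * adj_mat \<Gamma>) $$ (i, k)
      = (\<Sum>j\<le>n. adj_mat \<Gamma>' $$ (i, j) * adj_mat \<Gamma> $$ (j, k))" if "k \<le> n" for k
    using adj that assms(2) by (auto simp: scalar_prod_def atLeast0LessThan lessThan_Suc_atMost)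
  have "conj_forms n \<Gamma>' (conj_forms n \<Gamma> F) i
      = (\<Sum>j\<le>n. mconst (adj_mat \<Gamma>' $$ (i, j)) *
          (\<Sum>k\<le>n. mconst (adj_mat \<Gamma> $$ (j, k)) * lin_subst n (\<Gamma> * \<Gamma>') (F k)))"
    unfolding conj_forms_eq g.hom_sum g.hom_mult lin_subst_mconst
    using lin_subst_lin_subst[OF assms(1) \<Gamma>' \<Gamma>] by simp
  also have "\<dots> = (\<Sum>k\<le>n. \<Sum>j\<le>n. mconst (adj_mat \<Gamma>' $$ (i, j)) *
      (mconst (adj_mat \<Gamma> $$ (j, k)) * lin_subst n (\<Gamma> * \<Gamma>') (F k)))"
    unfolding sum_distrib_left by (rule sum.swap)
  also have "\<dots> = (\<Sum>k\<le>n. mconst ((adj_mat \<Gamma>' * adj_mat \<Gamma>) $$ (i, k)) * lin_subst n (\<Gamma> * \<Gamma>') (F k))"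
    by (intro sum.cong refl) (simp add: entry m.hom_sum m.hom_mult sum_distrib_right mult.assoc)
  finally show ?thesis .
qed

text \<open>Multiplying \<open>A * B\<close> by \<open>adj_mat B * adj_mat A\<close> gives
  \<open>det (A * B)\<close> times the identity. Multiplication by \<open>adj_mat (A * B)\<close>
  from the left then gives the claim up to the factor \<open>det (A * B)\<close>, which cancels in a
  domain.\<close>

lemma adj_mat_mult:
  fixes A B :: "'a::idom mat"
  assumes A: "A \<in> carrier_mat N N" and B: "B \<in> carrier_mat N N" and "det A \<noteq> 0" "det B \<noteq> 0"
  shows "adj_mat (A * B) = adj_mat B * adj_mat A"
proof -
  note AB = mult_carrier_mat[OF A B]
  note a = adj_mat[OF A] and b = adj_mat[OF B] and ab = adj_mat[OF AB]
  have "A * B * (adj_mat B * adj_mat A) = A * (B * adj_mat B) * adj_mat A"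
    using A B a(1) b(1) by (simp add: assoc_mult_mat[of _ N N _ N _ N])
  also have "\<dots> = det B \<cdot>\<^sub>m (A * adj_mat A)"
    unfolding b(2) mult_smult_distrib[OF A one_carrier_mat] right_mult_one_mat[OF A]
    by (rule mult_smult_assoc_mat[OF A a(1)])
  also have "\<dots> = det (A * B) \<cdot>\<^sub>m 1\<^sub>m N"
    unfolding a(2) det_mult[OF A B] by (rule eq_matI) (auto simp: mult.commute)
  finally have eq: "A * B * (adj_mat B * adj_mat A) = det (A * B) \<cdot>\<^sub>m 1\<^sub>m N" .
  have "det (A * B) \<cdot>\<^sub>m adj_mat (A * B) = adj_mat (A * B) * (A * B * (adj_mat B * adj_mat A))"
    unfolding eq mult_smult_distrib[OF ab(1) one_carrier_mat] right_mult_one_mat[OF ab(1)] ..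
  also have "\<dots> = adj_mat (A * B) * (A * B) * (adj_mat B * adj_mat A)"
    using AB ab(1) a(1) b(1) by (intro assoc_mult_mat[symmetric, of _ N N _ N _ N]) auto
  also have "\<dots> = det (A * B) \<cdot>\<^sub>m (adj_mat B * adj_mat A)"
    unfolding ab(3) mult_smult_assoc_mat[OF one_carrier_mat mult_carrier_mat[OF b(1) a(1)]]
      left_mult_one_mat[OF mult_carrier_mat[OF b(1) a(1)]] ..
  finally have *: "det (A * B) \<cdot>\<^sub>m adj_mat (A * B) = det (A * B) \<cdot>\<^sub>m (adj_mat B * adj_mat A)" .
  have nz: "det (A * B) \<noteq> 0" using assms det_mult[OF A B] by simp
  show ?thesis
  proof (rule eq_matI)
    fix i j assume "i < dim_row (adj_mat B * adj_mat A)" "j < dim_col (adj_mat B * adj_mat A)"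
    then have ij: "i < N" "j < N" using a(1) b(1) by auto
    have "(det (A * B) \<cdot>\<^sub>m adj_mat (A * B)) $$ (i, j) = (det (A * B) \<cdot>\<^sub>m (adj_mat B * adj_mat A)) $$ (i, j)"
      by (simp only: *)
    then show "adj_mat (A * B) $$ (i, j) = (adj_mat B * adj_mat A) $$ (i, j)"
      using nz ij ab(1) a(1) b(1) by (simp add: index_smult_mat del: index_mult_mat(1))
  qed (use ab(1) a(1) b(1) in auto)
qed

lemma conj_forms_mult:
  fixes F :: "nat \<Rightarrow> (nat, 'a::idom) mpol"
  assumes "\<And>j. j \<le> n \<Longrightarrow> F j \<in> forms UNIV n d" "i \<le> n"
    and "\<Gamma> \<in> carrier_mat (n + 1) (n + 1)" "\<Gamma>' \<in> carrier_mat (n + 1) (n + 1)" "det \<Gamma> \<noteq> 0" "det \<Gamma>' \<noteq> 0"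
  shows "conj_forms n \<Gamma>' (conj_forms n \<Gamma> F) i = conj_forms n (\<Gamma> * \<Gamma>') F i"
  by (subst conj_forms_conj_forms[OF assms(1-4)]) (simp_all only: conj_forms_eq adj_mat_mult[OF assms(3-6)])

lemma det_adj_mat:
  fixes \<Gamma> :: "'a::idom mat"
  assumes \<Gamma>: "\<Gamma> \<in> carrier_mat (n + 1) (n + 1)" and "det \<Gamma> \<noteq> 0"
  shows "det (adj_mat \<Gamma>) = det \<Gamma> ^ n"
proof -
  note a = adj_mat[OF \<Gamma>]
  have "det \<Gamma> * det (adj_mat \<Gamma>) = det (\<Gamma> * adj_mat \<Gamma>)"
    by (rule det_mult[OF \<Gamma> a(1), symmetric])
  also have "\<dots> = det \<Gamma> ^ Suc n"
    unfolding a(2) by simp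
  finally have "det \<Gamma> * det (adj_mat \<Gamma>) = det \<Gamma> * det \<Gamma> ^ n"
    unfolding power_Suc .
  then show ?thesis using \<open>det \<Gamma> \<noteq> 0\<close> by (metis mult_cancel_left)
qed

text \<open>Conjugation by the adjugate undoes conjugation by \<open>\<Gamma>\<close> up to a
  scalar. The exponent n comes from \<open>adj_mat (adj_mat \<Gamma>) * adj_mat \<Gamma>\<close>,
  which is \<open>det (adj_mat \<Gamma>)\<close> times the identity; the exponent d comes from
  substituting \<open>\<Gamma> * adj_mat \<Gamma>\<close>, that is the scalar
  \<open>det \<Gamma>\<close>, into forms of degree d.\<close>

lemma conj_forms_adj:
  fixes F :: "nat \<Rightarrow> (nat, 'a::idom) mpol"
  assumes F: "\<And>j. j \<le> n \<Longrightarrow> F j \<in> forms UNIV n d" and "i \<le> n"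
    and \<Gamma>: "\<Gamma> \<in> carrier_mat (n + 1) (n + 1)" and "det \<Gamma> \<noteq> 0"
  shows "conj_forms n (adj_mat \<Gamma>) (conj_forms n \<Gamma> F) i = scale_forms (det \<Gamma> ^ (n + d)) F i"
proof -
  interpret m: comm_ring_hom "mconst :: 'a \<Rightarrow> (nat, 'a) mpol" by (rule comm_ring_hom_mconst)
  note a = adj_mat[OF \<Gamma>]
  note detadj = det_adj_mat[OF \<Gamma> \<open>det \<Gamma> \<noteq> 0\<close>]
  have "conj_forms n (adj_mat \<Gamma>) (conj_forms n \<Gamma> F) i
      = (\<Sum>k\<le>n. if k = i then mconst (det \<Gamma> ^ n) * (mconst (det \<Gamma> ^ d) * F i) else 0)"
  proof (subst conj_forms_conj_forms[OF F \<open>i \<le> n\<close> \<Gamma> a(1)])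
    show "(\<Sum>k\<le>n. mconst ((adj_mat (adj_mat \<Gamma>) * adj_mat \<Gamma>) $$ (i, k)) * lin_subst n (\<Gamma> * adj_mat \<Gamma>) (F k))
        = (\<Sum>k\<le>n. if k = i then mconst (det \<Gamma> ^ n) * (mconst (det \<Gamma> ^ d) * F i) else 0)"
      unfolding adj_mat(3)[OF a(1)] a(2) detadj
      using \<open>i \<le> n\<close> by (intro sum.cong refl) (auto simp: lin_subst_scalar[OF F, simplified])
  qed
  then show ?thesis
    using \<open>i \<le> n\<close> by (simp add: scale_forms_def power_add m.hom_mult mult.assoc)
qed

section \<open>Change of the coefficient ring\<close>

definition mp_map :: "('a \<Rightarrow> 'b::comm_ring_1) \<Rightarrow> ('v, 'a::comm_ring_1) mpol \<Rightarrow> ('v, 'b) mpol"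
  where "mp_map h = mp_eval (\<lambda>c. mconst (h c)) mvar"

context comm_ring_hom
begin

lemma comm_ring_hom_mconst_hom: "comm_ring_hom (\<lambda>c. mconst (hom c))"
  by (rule comm_ring_hom_compose[OF comm_ring_hom_axioms comm_ring_hom_mconst])

lemma comm_ring_hom_mp_map: "comm_ring_hom (mp_map hom)"
  unfolding mp_map_def by (rule comm_ring_hom.comm_ring_hom_mp_eval[OF comm_ring_hom_mconst_hom])

lemma mp_map_single [simp]: "mp_map hom (Poly_Mapping.single \<alpha> c) = Poly_Mapping.single \<alpha> (hom c)"
  unfolding mp_map_def comm_ring_hom.mp_eval_single[OF comm_ring_hom_mconst_hom] mon_eval_mvar
  by (simp add: mult_single)

lemma lookup_mp_map: "Poly_Mapping.lookup (mp_map hom P) \<alpha> = hom (Poly_Mapping.lookup P \<alpha>)"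
proof -
  interpret m: comm_ring_hom "mp_map hom" by (rule comm_ring_hom_mp_map)
  have "Poly_Mapping.lookup (mp_map hom (\<Sum>\<mu>\<in>Poly_Mapping.keys P. Poly_Mapping.single \<mu> (Poly_Mapping.lookup P \<mu>))) \<alpha>
      = hom (Poly_Mapping.lookup (\<Sum>\<mu>\<in>Poly_Mapping.keys P. Poly_Mapping.single \<mu> (Poly_Mapping.lookup P \<mu>)) \<alpha>)"
    by (simp add: m.hom_sum lookup_sum hom_sum lookup_single when_def if_distrib cong: if_cong)
  then show ?thesis by (simp only: mpol_sum_monomials)
qed

lemma mp_map_forms_with_coeffs:
  "mp_map hom (forms_with_coeffs n d a i) = forms_with_coeffs n d (\<lambda>v. hom (a v)) i"
  by (rule poly_mapping_eqI) (simp add: lookup_mp_map lookup_forms_with_coeffs when_def)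

lemma mp_map_lin_subst:
  assumes "P \<in> forms UNIV n d" "\<Gamma> \<in> carrier_mat (n + 1) (n + 1)"
  shows "mp_map hom (lin_subst n \<Gamma> P) = lin_subst n (map_mat hom \<Gamma>) (mp_map hom P)"
proof -
  interpret m: comm_ring_hom "mp_map hom :: (nat, 'a) mpol \<Rightarrow> (nat, 'b) mpol" by (rule comm_ring_hom_mp_map)
  have lin: "mp_map hom (lin_form n \<Gamma> l) = lin_form n (map_mat hom \<Gamma>) l" if "l \<le> n" for l
    unfolding lin_form_def m.hom_sum m.hom_mult mp_map_single hom_one
    using that assms(2) by (intro sum.cong refl) simp
  have "mp_map hom (lin_subst n \<Gamma> P) = mp_eval (\<lambda>c. mconst (hom c)) (\<lambda>l. mp_map hom (lin_form n \<Gamma> l)) P"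
    unfolding lin_subst_def by (simp add: m.hom_mp_eval[OF comm_ring_hom_mconst])
  also have "\<dots> = mp_eval (\<lambda>c. mconst (hom c)) (lin_form n (map_mat hom \<Gamma>)) P"
    by (rule mp_eval_cong) (use assms lin in \<open>auto simp: forms_def monoms_def\<close>)
  also have "\<dots> = lin_subst n (map_mat hom \<Gamma>) (mp_map hom P)"
    unfolding mp_map_def comm_ring_hom.hom_mp_eval[OF comm_ring_hom_lin_subst comm_ring_hom_mconst_hom]
    by (simp only: lin_subst_mconst lin_subst_mvar)
  finally show ?thesis .
qed

lemma map_adj_mat: "\<Gamma> \<in> carrier_mat N N \<Longrightarrow> map_mat hom (adj_mat \<Gamma>) = adj_mat (map_mat hom \<Gamma>)"
proof -
  assume \<Gamma>: "\<Gamma> \<in> carrier_mat N N"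
  have "map_mat hom (mat_delete \<Gamma> j i) = mat_delete (map_mat hom \<Gamma>) j i" for i j
    by (rule eq_matI) (auto simp: mat_delete_def)
  then show ?thesis
    using \<Gamma> by (intro eq_matI) (auto simp: adj_mat_def cofactor_def hom_mult hom_power hom_uminus hom_det[symmetric] simp del: hom_det)
qed

lemma mp_map_conj_forms:
  assumes "\<And>j. j \<le> n \<Longrightarrow> F j \<in> forms UNIV n d" "\<Gamma> \<in> carrier_mat (n + 1) (n + 1)" "i \<le> n"
  shows "mp_map hom (conj_forms n \<Gamma> F i) = conj_forms n (map_mat hom \<Gamma>) (\<lambda>j. mp_map hom (F j)) i"
proof -
  interpret m: comm_ring_hom "mp_map hom :: (nat, 'a) mpol \<Rightarrow> (nat, 'b) mpol" by (rule comm_ring_hom_mp_map)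
  show ?thesis
    unfolding conj_forms_eq m.hom_sum m.hom_mult mp_map_single
    using adj_mat(1)[OF assms(2)] assms
    by (intro sum.cong refl) (simp add: mp_map_lin_subst[OF assms(1,2)] map_adj_mat[OF assms(2), symmetric])
qed

end


section \<open>The resultant of a conjugate tuple\<close>

text \<open>Multilinearity in the columns turns the determinant into a combination of determinants
  whose columns are chosen from those indexed by \<open>\<Omega>\<close>, repetitions
  included.\<close>

lemma det_dvd_columns:
  fixes M :: "nat \<Rightarrow> 'k \<Rightarrow> 'a::comm_ring_1"
  assumes "finite \<Omega>"
    and "\<And>c. c ` {..<r} \<subseteq> \<Omega> \<Longrightarrow> x dvd det (mat r r (\<lambda>(u, v). M u (c v)))"
  shows "x dvd det (mat r r (\<lambda>(u, v). \<Sum>k\<in>\<Omega>. q v k * M u k))"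
proof -
  let ?P = "{p. p permutes {0..<r}}"
  let ?C = "PiE {..<r} (\<lambda>_. \<Omega>)"
  have col: "det (mat r r (\<lambda>(u, v). f u v)) = (\<Sum>p\<in>?P. signof p * (\<Prod>j<r. f (p j) j))"
    for f :: "nat \<Rightarrow> nat \<Rightarrow> 'a"
    by (subst det_col[OF mat_carrier], intro sum.cong refl arg_cong2[of _ _ _ _ "(*)"] prod.cong)
      (auto simp: permutes_in_image)
  have "det (mat r r (\<lambda>(u, v). \<Sum>k\<in>\<Omega>. q v k * M u k))
      = (\<Sum>p\<in>?P. signof p * (\<Sum>c\<in>?C. (\<Prod>j<r. q j (c j)) * (\<Prod>j<r. M (p j) (c j))))"
    unfolding col by (simp add: prod_sum_PiE assms(1) prod.distrib)
  also have "\<dots> = (\<Sum>c\<in>?C. (\<Prod>j<r. q j (c j)) * (\<Sum>p\<in>?P. signof p * (\<Prod>j<r. M (p j) (c j))))"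
    unfolding sum_distrib_left by (subst sum.swap) (simp add: mult.left_commute)
  also have "\<dots> = (\<Sum>c\<in>?C. (\<Prod>j<r. q j (c j)) * det (mat r r (\<lambda>(u, v). M u (c v))))"
    by (simp add: col)
  finally show ?thesis
    using assms(2) by (simp only:) (intro dvd_sum dvd_mult, blast)
qed

lemma macaulay_degree_ge: "d \<ge> 1 \<Longrightarrow> d \<le> macaulay_degree n d"
  by (simp add: macaulay_degree_def)

text \<open>In matrix terms, the Macaulay matrix of the conjugate tuple, times a power of the
  determinant, is \<open>S M Q\<close>: \<open>M\<close> is the matrix of \<open>F\<close>,
  \<open>Q\<close> combines columns, and \<open>S\<close> describes the substitution on the
  monomials of degree t. The factor arises because a monomial of degree t - d has to be written as
  \<open>H(\<Gamma> X)\<close>; substituting \<open>adj_mat \<Gamma>\<close> into it provides such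
  an \<open>H\<close> for its multiple by \<open>det \<Gamma> ^ (t - d)\<close>.\<close>

lemma macaulay_coeff_conj:
  fixes F :: "nat \<Rightarrow> (nat, 'a::comm_ring_1) mpol"
  assumes F: "\<And>j. j \<le> n \<Longrightarrow> F j \<in> forms UNIV n d"
    and \<Gamma>: "\<Gamma> \<in> carrier_mat (n + 1) (n + 1)" and "d \<ge> 1" and i\<beta>: "i\<beta> \<in> macaulay_cols n d"
  shows "\<exists>q. \<forall>\<gamma>. det \<Gamma> ^ (macaulay_degree n d - d) * macaulay_coeff (conj_forms n \<Gamma> F) \<gamma> i\<beta>
    = (\<Sum>k\<in>macaulay_cols n d. q k *
        (\<Sum>\<gamma>'\<in>monoms n (macaulay_degree n d).
          Poly_Mapping.lookup (lin_subst n \<Gamma> (Poly_Mapping.single \<gamma>' 1)) \<gamma> * macaulay_coeff F \<gamma>' k))"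
proof -
  define t where "t = macaulay_degree n d"
  obtain i \<beta> where ib: "i\<beta> = (i, \<beta>)" "i \<le> n" "\<beta> \<in> monoms n (t - d)"
    using i\<beta> by (auto simp: macaulay_cols_def t_def)
  have t: "d + (t - d) = t" using macaulay_degree_ge[OF \<open>d \<ge> 1\<close>, of n] by (simp add: t_def)
  interpret g: comm_ring_hom "lin_subst n \<Gamma>" by (rule comm_ring_hom_lin_subst)
  interpret m: comm_ring_hom "mconst :: 'a \<Rightarrow> (nat, 'a) mpol" by (rule comm_ring_hom_mconst)
  note adj = adj_mat[OF \<Gamma>]
  define mo where "mo \<beta> = (Poly_Mapping.single \<beta> 1 :: (nat, 'a) mpol)" for \<beta>
  have mof: "mo \<beta> \<in> forms UNIV n e" if "\<beta> \<in> monoms n e" for \<beta> e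
    unfolding mo_def by (rule forms_single[OF that])
  define H where "H = lin_subst n (adj_mat \<Gamma>) (mo \<beta>)"
  have H: "H \<in> forms UNIV n (t - d)"
    unfolding H_def by (intro lin_subst_in_forms mof ib)
  have H': "lin_subst n \<Gamma> H = mconst (det \<Gamma> ^ (t - d)) * mo \<beta>"
    unfolding H_def lin_subst_lin_subst[OF mof[OF ib(3)] \<Gamma> adj(1)] adj(3)
    by (rule lin_subst_scalar[OF mof[OF ib(3)]])
  have Hsum: "H = (\<Sum>\<beta>'\<in>monoms n (t - d). mconst (Poly_Mapping.lookup H \<beta>') * mo \<beta>')"
    unfolding mo_def by (rule forms_sum_monoms[OF H])
  have expand: "lin_subst n \<Gamma> P = (\<Sum>\<gamma>'\<in>monoms n t. mconst (Poly_Mapping.lookup P \<gamma>') * lin_subst n \<Gamma> (mo \<gamma>'))"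
    if "P \<in> forms UNIV n t" for P
    by (subst forms_sum_monoms[OF that]) (simp add: g.hom_sum g.hom_mult mo_def)
  define q where "q k = adj_mat \<Gamma> $$ (i, fst k) * Poly_Mapping.lookup H (snd k)" for k
  have "det \<Gamma> ^ (t - d) * macaulay_coeff (conj_forms n \<Gamma> F) \<gamma> i\<beta>
      = (\<Sum>k\<in>macaulay_cols n d. q k *
        (\<Sum>\<gamma>'\<in>monoms n t. Poly_Mapping.lookup (lin_subst n \<Gamma> (mo \<gamma>')) \<gamma> * macaulay_coeff F \<gamma>' k))" for \<gamma>
  proof -
    have moF: "mo \<beta>' * F j \<in> forms UNIV n t" if "\<beta>' \<in> monoms n (t - d)" "j \<le> n" for \<beta>' j
      using forms_mult[OF F[OF that(2)] mof[OF that(1)]] by (simp add: t mult.commute)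
    have "mconst (det \<Gamma> ^ (t - d)) * (mo \<beta> * conj_forms n \<Gamma> F i)
        = lin_subst n \<Gamma> H * conj_forms n \<Gamma> F i"
      by (simp add: H' mult.assoc)
    also have "\<dots> = (\<Sum>j\<le>n. mconst (adj_mat \<Gamma> $$ (i, j)) * lin_subst n \<Gamma> (H * F j))"
      by (simp add: conj_forms_eq sum_distrib_left g.hom_mult mult.left_commute)
    also have "\<dots> = (\<Sum>j\<le>n. \<Sum>\<beta>'\<in>monoms n (t - d). mconst (q (j, \<beta>')) * lin_subst n \<Gamma> (mo \<beta>' * F j))"
      by (subst Hsum)
        (simp add: sum_distrib_left sum_distrib_right g.hom_sum g.hom_mult m.hom_mult q_def mult.assoc)
    also have "\<dots> = (\<Sum>k\<in>macaulay_cols n d. mconst (q k) * lin_subst n \<Gamma> (mo (snd k) * F (fst k)))"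
      unfolding macaulay_cols_def t_def[symmetric] by (simp add: sum.cartesian_product case_prod_unfold)
    also have "\<dots> = (\<Sum>k\<in>macaulay_cols n d. mconst (q k) *
        (\<Sum>\<gamma>'\<in>monoms n t. mconst (Poly_Mapping.lookup (mo (snd k) * F (fst k)) \<gamma>') * lin_subst n \<Gamma> (mo \<gamma>')))"
      by (intro sum.cong refl arg_cong2[of _ _ _ _ "(*)"] expand moF)
        (auto simp: macaulay_cols_def t_def)
    finally have "Poly_Mapping.lookup (mconst (det \<Gamma> ^ (t - d)) * (mo \<beta> * conj_forms n \<Gamma> F i)) \<gamma>
      = Poly_Mapping.lookup \<dots> \<gamma>" by simp
    then show ?thesis
      by (simp add: lookup_sum macaulay_coeff_def ib(1) mo_def case_prod_unfold
          mult.commute[of "Poly_Mapping.lookup (lin_subst n \<Gamma> _) \<gamma>"])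
  qed
  then show ?thesis unfolding mo_def t_def by blast
qed

text \<open>Up to a power of the determinant, the minors of the conjugate tuple are combinations of
  the minors of \<open>F\<close>, because the Macaulay matrix is only multiplied from both
  sides.\<close>

lemma minors_conj_dvd:
  fixes F :: "nat \<Rightarrow> (nat, 'a::comm_ring_1) mpol"
  assumes F: "\<And>j. j \<le> n \<Longrightarrow> F j \<in> forms UNIV n d"
    and \<Gamma>: "\<Gamma> \<in> carrier_mat (n + 1) (n + 1)" and "d \<ge> 1"
    and x: "\<And>e c. (e, c) \<in> minor_selections n d \<Longrightarrow> x dvd macaulay_minor n d F e c"
    and ec: "(e, c) \<in> minor_selections n d"
  shows "\<exists>m. x dvd det \<Gamma> ^ m * macaulay_minor n d (conj_forms n \<Gamma> F) e c"
proof -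
  define t where "t = macaulay_degree n d"
  define M where "M = monoms n t"
  define r where "r = card M"
  let ?s = "det \<Gamma> ^ (t - d)"
  have "\<forall>k\<in>macaulay_cols n d. \<exists>q. \<forall>\<gamma>. ?s * macaulay_coeff (conj_forms n \<Gamma> F) \<gamma> k
    = (\<Sum>k\<in>macaulay_cols n d. q k *
        (\<Sum>\<gamma>'\<in>M. Poly_Mapping.lookup (lin_subst n \<Gamma> (Poly_Mapping.single \<gamma>' 1)) \<gamma> * macaulay_coeff F \<gamma>' k))"
    using macaulay_coeff_conj[of n F d, OF F \<Gamma> \<open>d \<ge> 1\<close>] unfolding M_def t_def by blast
  from bchoice[OF this] obtain q where q: "\<And>k \<gamma>. k \<in> macaulay_cols n d \<Longrightarrow>
    ?s * macaulay_coeff (conj_forms n \<Gamma> F) \<gamma> k = (\<Sum>k'\<in>macaulay_cols n d. q k k' *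
        (\<Sum>\<gamma>'\<in>M. Poly_Mapping.lookup (lin_subst n \<Gamma> (Poly_Mapping.single \<gamma>' 1)) \<gamma> * macaulay_coeff F \<gamma>' k'))"
    by blast
  have e: "bij_betw e {..<r} M" and c: "c ` {..<r} \<subseteq> macaulay_cols n d"
    using ec by (auto simp: minor_selections_def r_def M_def t_def)
  define N where "N u k = (\<Sum>\<gamma>'\<in>M. Poly_Mapping.lookup (lin_subst n \<Gamma> (Poly_Mapping.single \<gamma>' 1)) (e u)
    * macaulay_coeff F \<gamma>' k)" for u k
  have "?s ^ r * macaulay_minor n d (conj_forms n \<Gamma> F) e c
      = det (?s \<cdot>\<^sub>m mat r r (\<lambda>(u, v). macaulay_coeff (conj_forms n \<Gamma> F) (e u) (c v)))"
    by (simp add: macaulay_minor_def Let_def r_def M_def t_def)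
  also have "?s \<cdot>\<^sub>m mat r r (\<lambda>(u, v). macaulay_coeff (conj_forms n \<Gamma> F) (e u) (c v))
      = mat r r (\<lambda>(u, v). \<Sum>k\<in>macaulay_cols n d. q (c v) k * N u k)"
    using c by (intro eq_matI) (auto simp: q N_def image_subset_iff)
  finally have eq: "?s ^ r * macaulay_minor n d (conj_forms n \<Gamma> F) e c
      = det (mat r r (\<lambda>(u, v). \<Sum>k\<in>macaulay_cols n d. q (c v) k * N u k))" .
  have "x dvd det (mat r r (\<lambda>(u, v). \<Sum>k\<in>macaulay_cols n d. q (c v) k * N u k))"
  proof (rule det_dvd_columns)
    show "finite (macaulay_cols n d)" by (simp add: macaulay_cols_def)
    fix c' :: "nat \<Rightarrow> nat \<times> (nat \<Rightarrow>\<^sub>0 nat)" assume c': "c' ` {..<r} \<subseteq> macaulay_cols n d"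
    let ?S = "mat r r (\<lambda>(u, w). Poly_Mapping.lookup (lin_subst n \<Gamma> (Poly_Mapping.single (e w) 1)) (e u))"
    let ?F = "mat r r (\<lambda>(u, v). macaulay_coeff F (e u) (c' v))"
    \<comment> \<open>All rows are present and are transformed by a square matrix, so each selection
      of columns yields a product of two determinants.\<close>
    have "mat r r (\<lambda>(u, v). N u (c' v)) = ?S * ?F"
    proof (rule eq_matI)
      fix u v assume "u < dim_row (?S * ?F)" "v < dim_col (?S * ?F)"
      then have uv: "u < r" "v < r" by auto
      have "N u (c' v) = (\<Sum>w<r. Poly_Mapping.lookup (lin_subst n \<Gamma> (Poly_Mapping.single (e w) 1)) (e u)
          * macaulay_coeff F (e w) (c' v))"
        unfolding N_def by (rule sum.reindex_bij_betw[OF e, symmetric])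
      then show "mat r r (\<lambda>(u, v). N u (c' v)) $$ (u, v) = (?S * ?F) $$ (u, v)"
        using uv by (simp add: scalar_prod_def atLeast0LessThan)
    qed auto
    then have "det (mat r r (\<lambda>(u, v). N u (c' v))) = det ?S * det ?F"
      using det_mult[of ?S r ?F] by simp
    moreover have "det ?F = macaulay_minor n d F e c'"
      by (simp add: macaulay_minor_def Let_def r_def M_def t_def)
    moreover have "(e, c') \<in> minor_selections n d"
      using ec c' by (simp add: minor_selections_def r_def M_def t_def)
    ultimately show "x dvd det (mat r r (\<lambda>(u, v). N u (c' v)))"
      using x by simp
  qed
  then show ?thesis
    unfolding eq[symmetric] power_mult[symmetric] by blast
qed

lemma macaulay_minor_scale:
  "macaulay_minor n d (scale_forms s F) e c
    = s ^ card (monoms n (macaulay_degree n d)) * macaulay_minor n d F e c"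
proof -
  let ?r = "card (monoms n (macaulay_degree n d))"
  have "mat ?r ?r (\<lambda>(u, v). macaulay_coeff (scale_forms s F) (e u) (c v))
      = s \<cdot>\<^sub>m mat ?r ?r (\<lambda>(u, v). macaulay_coeff F (e u) (c v))"
    by (rule eq_matI) (auto simp: macaulay_coeff_def scale_forms_def mult.left_commute[of "Poly_Mapping.single _ 1" "mconst s"] split: prod.splits)
  then show ?thesis by (simp add: macaulay_minor_def Let_def)
qed

lemma resultant_dvd_minor:
  fixes F :: "nat \<Rightarrow> (nat, 'a::comm_ring_1) mpol"
  assumes "\<And>j. j \<le> n \<Longrightarrow> F j \<in> forms UNIV n d" "d \<ge> 1" "(e, c) \<in> minor_selections n d"
  shows "resultant_of n d F dvd macaulay_minor n d F e c"
proof -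
  interpret comm_ring_hom "mp_eval of_int (coeffs_of F) :: (cvar, int) mpol \<Rightarrow> 'a"
    by (intro comm_ring_hom.comm_ring_hom_mp_eval comm_ring_hom_of_int)
  have "resultant_poly n d dvd macaulay_minor n d (forms_with_coeffs n d mvar) e c"
    using assms(3) by (intro resultant_poly_spec assms) (auto simp: macaulay_minors_eq)
  from hom_dvd[OF this] show ?thesis
    using mp_eval_macaulay_minor[of n F d e c] assms(1,3) by (simp add: resultant_of_def)
qed

text \<open>The resultant of the conjugate tuple divides the minors of that tuple. Conjugating back
  by the adjugate turns these into minors of a multiple of \<open>F\<close>, so the bound is in
  terms of \<open>F\<close> and powers of the determinant only.\<close>

lemma resultant_conj_dvd:
  fixes F :: "nat \<Rightarrow> (nat, 'a::idom) mpol"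
  assumes F: "\<And>j. j \<le> n \<Longrightarrow> F j \<in> forms UNIV n d" and "d \<ge> 1"
    and \<Gamma>: "\<Gamma> \<in> carrier_mat (n + 1) (n + 1)" "det \<Gamma> \<noteq> 0"
    and ec: "(e, c) \<in> minor_selections n d"
  shows "\<exists>m. resultant_of n d (conj_forms n \<Gamma> F) dvd det \<Gamma> ^ m * macaulay_minor n d F e c"
proof -
  note adj = adj_mat[OF \<Gamma>(1)]
  have G: "conj_forms n \<Gamma> F j \<in> forms UNIV n d" for j
    using F by (rule conj_forms_in_forms)
  obtain m where m: "resultant_of n d (conj_forms n \<Gamma> F)
      dvd det (adj_mat \<Gamma>) ^ m * macaulay_minor n d (conj_forms n (adj_mat \<Gamma>) (conj_forms n \<Gamma> F)) e c"
    using minors_conj_dvd[of n "conj_forms n \<Gamma> F" d, OF G adj(1) \<open>d \<ge> 1\<close>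
        resultant_dvd_minor[of n "conj_forms n \<Gamma> F" d, OF G \<open>d \<ge> 1\<close>] ec] by blast
  have eq: "macaulay_minor n d (conj_forms n (adj_mat \<Gamma>) (conj_forms n \<Gamma> F)) e c
      = macaulay_minor n d (scale_forms (det \<Gamma> ^ (n + d)) F) e c"
    using conj_forms_adj[of n F d, OF F _ \<Gamma>] by (intro macaulay_minor_cong[OF _ ec]) auto
  have "resultant_of n d (conj_forms n \<Gamma> F) dvd det \<Gamma> ^ (n * m) *
      (det \<Gamma> ^ ((n + d) * card (monoms n (macaulay_degree n d))) * macaulay_minor n d F e c)"
    using m unfolding eq macaulay_minor_scale power_mult det_adj_mat[OF \<Gamma>] .
  then show ?thesis
    unfolding mult.assoc[symmetric] power_add[symmetric] by blast
qed

text \<open>Splitting off the powers of the variable from \<open>x\<close> and from its cofactor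
  leaves two factors whose product is the nonzero constant \<open>\<Delta>\<close>, so both are
  constants.\<close>

lemma dvd_X_power_const:
  fixes x :: "'a::idom poly"
  assumes "x dvd [:0, 1:] ^ m * [:\<Delta>:]" "\<Delta> \<noteq> 0"
  shows "x = monom (lead_coeff x) (degree x)"
proof -
  obtain y where y: "[:0, 1:] ^ m * [:\<Delta>:] = x * y" using assms(1) by (elim dvdE)
  then have nz: "x \<noteq> 0" "y \<noteq> 0" using assms(2) by auto
  obtain x' where x': "x = [:- 0, 1:] ^ order 0 x * x'" "\<not> [:- 0, 1:] dvd x'"
    using order_decomp[OF nz(1)] by blast
  obtain y' where y': "y = [:- 0, 1:] ^ order 0 y * y'" "\<not> [:- 0, 1:] dvd y'"
    using order_decomp[OF nz(2)] by blast
  have "order 0 ([:0, 1:] ^ m * [:\<Delta>:]) = m"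
    using assms(2) order_power_n_n[of 0 m] by (subst order_mult) (auto simp: order_0I)
  then have m: "order 0 x + order 0 y = m" using y nz by (simp add: order_mult)
  have "[:0, 1:] ^ m * [:\<Delta>:] = ([:0, 1:] ^ order 0 x * x') * ([:0, 1:] ^ order 0 y * y')"
    using y x'(1) y'(1) by simp
  also have "\<dots> = [:0, 1:] ^ m * (x' * y')"
    unfolding m[symmetric] power_add by (simp only: mult_ac)
  finally have "x' * y' = [:\<Delta>:]"
    unfolding mult_cancel_left by simp
  moreover have "x' \<noteq> 0" "y' \<noteq> 0" using x' y' by auto
  ultimately have "degree x' = 0"
    using degree_mult_eq[of x' y'] by simp
  then obtain b where "x' = [:b:]" by (metis degree_eq_zeroE)
  then have "x = monom b (order 0 x)"
    using x'(1) by (simp add: monom_altdef)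
  moreover from this have "b \<noteq> 0" using nz(1) by auto
  ultimately show ?thesis by (metis degree_monom_eq lead_coeff_monom)
qed

lemma resultant_of_cong:
  assumes "\<And>i. i \<le> n \<Longrightarrow> F i = G i" "d \<ge> 1"
  shows "resultant_of n d F = resultant_of n d G"
  unfolding resultant_of_def
proof (rule mp_eval_cong)
  fix \<mu> v assume "\<mu> \<in> Poly_Mapping.keys (resultant_poly n d)" "v \<in> Poly_Mapping.keys \<mu>"
  then have "v \<in> coeff_vars n d"
    using resultant_poly_mpols_in[OF assms(2), of n] unfolding mpols_in_def by blast
  then show "coeffs_of F v = coeffs_of G v"
    using assms(1) by (auto simp: coeff_vars_def coeffs_of_def)
qed simp

lemma hom_resultant_of:
  assumes "comm_ring_hom h" "d \<ge> 1"
  shows "h (resultant_of n d F) = resultant_of n d (\<lambda>i. mp_map h (F i))"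
  unfolding resultant_of_def hom_mp_eval_of_int[OF assms(1)]
  by (simp add: coeffs_of_def comm_ring_hom.lookup_mp_map[OF assms(1)] case_prod_unfold)

lemma conj_forms_cong:
  "(\<And>j. j \<le> n \<Longrightarrow> F j = G j) \<Longrightarrow> conj_forms n \<Gamma> F i = conj_forms n \<Gamma> G i"
  unfolding conj_forms_eq by (intro sum.cong) simp_all

text \<open>The polynomial variable on top of the coefficient variables is a parameter for families
  of matrices or scalars. What is proved for these forms passes to every commutative ring through
  \<open>specialize\<close>.\<close>

definition generic_forms :: "nat \<Rightarrow> nat \<Rightarrow> nat \<Rightarrow> (nat, (cvar, int) mpol poly) mpol"
  where "generic_forms n d = forms_with_coeffs n d (\<lambda>v. [:mvar v:])"

definition specialize ::
    "(nat \<Rightarrow> (nat, 'a::comm_ring_1) mpol) \<Rightarrow> 'a \<Rightarrow> (cvar, int) mpol poly \<Rightarrow> 'a"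
  where "specialize F \<tau> p = poly (map_poly (mp_eval of_int (coeffs_of F)) p) \<tau>"

lemma comm_ring_hom_specialize: "comm_ring_hom (specialize F \<tau>)"
proof -
  interpret e: comm_ring_hom "mp_eval of_int (coeffs_of F) :: (cvar, int) mpol \<Rightarrow> 'a"
    by (intro comm_ring_hom.comm_ring_hom_mp_eval comm_ring_hom_of_int)
  interpret m: map_poly_comm_ring_hom "mp_eval of_int (coeffs_of F) :: (cvar, int) mpol \<Rightarrow> 'a" ..
  show ?thesis
    unfolding specialize_def[abs_def]
    by (rule comm_ring_hom_compose[OF m.comm_ring_hom_axioms comm_ring_hom_poly])
qed

lemma specialize_const [simp]: "specialize F \<tau> [:c:] = mp_eval of_int (coeffs_of F) c"
  and specialize_X [simp]: "specialize F \<tau> [:0, 1:] = \<tau>"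
  and specialize_monom: "specialize F \<tau> (monom c m) = mp_eval of_int (coeffs_of F) c * \<tau> ^ m"
proof -
  interpret e: comm_ring_hom "mp_eval of_int (coeffs_of F) :: (cvar, int) mpol \<Rightarrow> 'a"
    by (intro comm_ring_hom.comm_ring_hom_mp_eval comm_ring_hom_of_int)
  show monom: "specialize F \<tau> (monom c m) = mp_eval of_int (coeffs_of F) c * \<tau> ^ m" for c m
    by (simp add: specialize_def map_poly_monom poly_monom)
  show "specialize F \<tau> [:c:] = mp_eval of_int (coeffs_of F) c"
    using monom[of c 0] by (simp add: monom_0)
  show "specialize F \<tau> [:0, 1:] = \<tau>"
    using monom[of 1 1] by (simp add: monom_altdef del: One_nat_def)
qed

lemma specialize_generic:
  assumes "F i \<in> forms UNIV n d"
  shows "mp_map (specialize F \<tau>) (generic_forms n d i) = F i"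
  using forms_with_coeffs_coeffs_of[of F i n d, OF assms]
  by (simp add: generic_forms_def comm_ring_hom.mp_map_forms_with_coeffs[OF comm_ring_hom_specialize]
      comm_ring_hom.mp_eval_single[OF comm_ring_hom_of_int])

lemma generic_forms_in_forms [simp]: "generic_forms n d i \<in> forms UNIV n d"
  by (simp add: generic_forms_def)

lemma generic_nonzero_minor:
  assumes "d \<ge> 1"
  obtains e c \<Delta> where "(e, c) \<in> minor_selections n d" "\<Delta> \<noteq> 0"
    "macaulay_minor n d (generic_forms n d) e c = [:\<Delta>:]"
proof -
  obtain e c where ec: "(e, c) \<in> minor_selections n d"
    "macaulay_minor n d (forms_with_coeffs n d mvar) e c \<noteq> (0 :: (cvar, int) mpol)"
    using ex_nonzero_minor[OF assms] by blast
  show ?thesis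
    by (rule that[OF ec]) (simp only: generic_forms_def hom_macaulay_minor[OF comm_ring_hom_pCons])
qed

text \<open>
  Along a one-parameter family of matrices whose determinant is a power of the parameter, the
  resultant of the generic forms divides a power of the parameter times a minor which does not
  involve the parameter; so it is a monomial in the parameter.
\<close>

lemma resultant_conj_family:
  assumes "d \<ge> 1" "\<Gamma> \<in> carrier_mat (n + 1) (n + 1)" "det \<Gamma> = [:0, 1:] ^ j"
  defines "P \<equiv> resultant_of n d (conj_forms n \<Gamma> (generic_forms n d))"
  shows "P = monom (lead_coeff P) (degree P)" "j = 0 \<Longrightarrow> degree P = 0"
proof -
  obtain e c \<Delta> where ec: "(e, c) \<in> minor_selections n d" "\<Delta> \<noteq> 0"
    "macaulay_minor n d (generic_forms n d) e c = [:\<Delta>:]"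
    using generic_nonzero_minor[OF assms(1)] by blast
  obtain m where m: "P dvd ([:0, 1:] ^ j) ^ m * [:\<Delta>:]"
    using resultant_conj_dvd[of n "generic_forms n d" d \<Gamma> e c] assms(1-3) ec(1,3)
    unfolding P_def by auto
  then show "P = monom (lead_coeff P) (degree P)"
    unfolding power_mult[symmetric] using ec(2) by (rule dvd_X_power_const)
  show "degree P = 0" if "j = 0"
    using m ec(2) dvd_imp_degree_le[of P "[:\<Delta>:]"] that by simp
qed

lemma resultant_conj_specialize:
  assumes "d \<ge> 1" "\<And>i. i \<le> n \<Longrightarrow> F i \<in> forms UNIV n d" "\<Gamma> \<in> carrier_mat (n + 1) (n + 1)"
  shows "specialize F \<tau> (resultant_of n d (conj_forms n \<Gamma> (generic_forms n d)))
    = resultant_of n d (conj_forms n (map_mat (specialize F \<tau>) \<Gamma>) F)"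
proof -
  have "mp_map (specialize F \<tau>) (conj_forms n \<Gamma> (generic_forms n d) i)
      = conj_forms n (map_mat (specialize F \<tau>) \<Gamma>) F i" if "i \<le> n" for i
    unfolding comm_ring_hom.mp_map_conj_forms[OF comm_ring_hom_specialize generic_forms_in_forms assms(3) that]
    by (intro conj_forms_cong specialize_generic assms)
  then show ?thesis
    unfolding hom_resultant_of[OF comm_ring_hom_specialize assms(1)]
    by (intro resultant_of_cong assms(1)) simp
qed

lemma one_smult_mat: "(1 :: 'a::comm_ring_1) \<cdot>\<^sub>m A = A"
  by (rule eq_matI) auto

lemma conj_forms_one:
  assumes "\<And>j. j \<le> n \<Longrightarrow> F j \<in> forms UNIV n d" "i \<le> n"
  shows "conj_forms n (1\<^sub>m (n + 1)) F i = F i"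
proof -
  have "adj_mat (1\<^sub>m (n + 1) :: 'a mat) = 1\<^sub>m (n + 1)"
    using adj_mat[of "1\<^sub>m (n + 1) :: 'a mat" "n + 1"] by (simp add: one_smult_mat)
  moreover have "lin_subst n (1\<^sub>m (n + 1)) P = P" if "P \<in> forms UNIV n d" for P :: "(nat, 'a) mpol"
    using lin_subst_scalar[OF that, of 1] by (simp add: one_smult_mat)
  ultimately have "conj_forms n (1\<^sub>m (n + 1)) F i = (\<Sum>j\<le>n. if j = i then F i else 0)"
    unfolding conj_forms_eq using assms by (intro sum.cong refl) auto
  then show ?thesis using assms(2) by simp
qed

text \<open>With a generic entry \<open>\<tau>\<close> the determinant is 1, so the resultant does
  not involve the parameter; the value 0 of the parameter gives the identity matrix.\<close>

lemma resultant_conj_addrow: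
  fixes F :: "nat \<Rightarrow> (nat, 'a::comm_ring_1) mpol"
  assumes "d \<ge> 1" "\<And>i. i \<le> n \<Longrightarrow> F i \<in> forms UNIV n d" "k < n + 1" "l < n + 1" "k \<noteq> l"
  shows "resultant_of n d (conj_forms n (addrow_mat (n + 1) \<tau> k l) F) = resultant_of n d F"
proof -
  define \<Gamma> where "\<Gamma> = addrow_mat (n + 1) [:0, 1 :: (cvar, int) mpol:] k l"
  have \<Gamma>: "\<Gamma> \<in> carrier_mat (n + 1) (n + 1)" "det \<Gamma> = [:0, 1:] ^ 0"
    using assms by (auto simp: \<Gamma>_def det_addrow_mat)
  obtain b where b: "resultant_of n d (conj_forms n \<Gamma> (generic_forms n d)) = [:b:]"
    using resultant_conj_family(2)[OF assms(1) \<Gamma>] by (metis degree_eq_zeroE)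
  have map: "map_mat (specialize F s) \<Gamma> = addrow_mat (n + 1) s k l" for s
  proof -
    interpret s: comm_ring_hom "specialize F s" by (rule comm_ring_hom_specialize)
    show ?thesis by (rule eq_matI) (auto simp: \<Gamma>_def s.hom_add)
  qed
  have "resultant_of n d (conj_forms n (addrow_mat (n + 1) s k l) F) = mp_eval of_int (coeffs_of F) b" for s
    using resultant_conj_specialize[OF assms(1,2) \<Gamma>(1), where \<tau> = s] by (simp add: map b)
  from this[of \<tau>] this[of 0] have "resultant_of n d (conj_forms n (addrow_mat (n + 1) \<tau> k l) F)
      = resultant_of n d (conj_forms n (addrow_mat (n + 1) 0 k l) F)" by simp
  also have "addrow_mat (n + 1) 0 k l = (1\<^sub>m (n + 1) :: 'a mat)"
    by (rule eq_matI) auto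
  finally show ?thesis
    using resultant_of_cong[of n "conj_forms n (1\<^sub>m (n + 1)) F" F d] conj_forms_one[OF assms(2)] assms(1)
    by simp
qed

text \<open>The exponent of the determinant in the transformation law, read off from the scaling of
  one row: the determinant of that matrix is the scaling factor.\<close>

definition row_weight :: "nat \<Rightarrow> nat \<Rightarrow> nat"
  where "row_weight n d = degree (resultant_of n d
    (conj_forms n (multrow_mat (n + 1) 0 [:0, 1:]) (generic_forms n d)))"

text \<open>By \<open>resultant_conj_family\<close> the resultant is one power of the parameter
  times a coefficient; the parameter 1 gives the identity matrix and so identifies the
  coefficient.\<close>

lemma resultant_conj_multrow:
  fixes F :: "nat \<Rightarrow> (nat, 'a::comm_ring_1) mpol"
  assumes "d \<ge> 1" "\<And>i. i \<le> n \<Longrightarrow> F i \<in> forms UNIV n d"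
  shows "resultant_of n d (conj_forms n (multrow_mat (n + 1) 0 \<tau>) F) = \<tau> ^ row_weight n d * resultant_of n d F"
proof -
  define \<Gamma> where "\<Gamma> = multrow_mat (n + 1) 0 [:0, 1 :: (cvar, int) mpol:]"
  have \<Gamma>: "\<Gamma> \<in> carrier_mat (n + 1) (n + 1)" "det \<Gamma> = [:0, 1:] ^ 1"
    by (auto simp: \<Gamma>_def det_multrow_mat)
  obtain b where b: "resultant_of n d (conj_forms n \<Gamma> (generic_forms n d)) = monom b (row_weight n d)"
    using resultant_conj_family(1)[OF assms(1) \<Gamma>] unfolding row_weight_def \<Gamma>_def by blast
  have map: "map_mat (specialize F s) \<Gamma> = multrow_mat (n + 1) 0 s" for s
  proof -
    interpret s: comm_ring_hom "specialize F s" by (rule comm_ring_hom_specialize)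
    show ?thesis by (rule eq_matI) (auto simp: \<Gamma>_def)
  qed
  have *: "resultant_of n d (conj_forms n (multrow_mat (n + 1) 0 s) F)
      = mp_eval of_int (coeffs_of F) b * s ^ row_weight n d" for s
    using resultant_conj_specialize[OF assms(1,2) \<Gamma>(1), where \<tau> = s] by (simp add: map b specialize_monom)
  have "multrow_mat (n + 1) 0 1 = (1\<^sub>m (n + 1) :: 'a mat)"
    by (rule eq_matI) auto
  then have "resultant_of n d F = mp_eval of_int (coeffs_of F) b"
    using *[of 1] resultant_of_cong[of n "conj_forms n (1\<^sub>m (n + 1)) F" F d] conj_forms_one[OF assms(2)] assms(1)
    by simp
  then show ?thesis using *[of \<tau>] by (simp add: mult.commute)
qed

text \<open>The exponent \<open>E\<close>, obtained by multiplying all coefficients by one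
  parameter.\<close>

definition resultant_degree :: "nat \<Rightarrow> nat \<Rightarrow> nat"
  where "resultant_degree n d = degree (resultant_of n d (scale_forms [:0, 1:] (generic_forms n d)))"

lemma scale_forms_in_forms: "F i \<in> forms UNIV n d \<Longrightarrow> scale_forms c F i \<in> forms UNIV n d"
  unfolding scale_forms_def by (rule forms_mconst_mult)

text \<open>The resultant of the scaled generic forms divides a minor, which is a power of the
  parameter times a polynomial free of it; so it is a monomial in the parameter, and the parameter 1
  gives its coefficient.\<close>

lemma resultant_scale:
  fixes F :: "nat \<Rightarrow> (nat, 'a::comm_ring_1) mpol"
  assumes "d \<ge> 1" "\<And>i. i \<le> n \<Longrightarrow> F i \<in> forms UNIV n d"
  shows "resultant_of n d (scale_forms \<tau> F) = \<tau> ^ resultant_degree n d * resultant_of n d F"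
proof -
  define P where "P = resultant_of n d (scale_forms [:0, 1:] (generic_forms n d))"
  obtain e c \<Delta> where ec: "(e, c) \<in> minor_selections n d" "\<Delta> \<noteq> 0"
    "macaulay_minor n d (generic_forms n d) e c = [:\<Delta>:]"
    using generic_nonzero_minor[OF assms(1)] by blast
  have "P dvd [:0, 1:] ^ card (monoms n (macaulay_degree n d)) * [:\<Delta>:]"
    using resultant_dvd_minor[of n "scale_forms [:0, 1:] (generic_forms n d)" d,
        OF scale_forms_in_forms[of "generic_forms n d", OF generic_forms_in_forms] assms(1) ec(1)]
    unfolding P_def macaulay_minor_scale ec(3) .
  from dvd_X_power_const[OF this ec(2)] obtain b where b: "P = monom b (resultant_degree n d)"
    unfolding P_def resultant_degree_def by blast
  have *: "resultant_of n d (scale_forms s F) = mp_eval of_int (coeffs_of F) b * s ^ resultant_degree n d" for s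
  proof -
    interpret s: comm_ring_hom "specialize F s" by (rule comm_ring_hom_specialize)
    interpret ms: comm_ring_hom "mp_map (specialize F s) :: (nat, (cvar, int) mpol poly) mpol \<Rightarrow> (nat, 'a) mpol"
      by (rule s.comm_ring_hom_mp_map)
    have "resultant_of n d (scale_forms s F)
        = resultant_of n d (\<lambda>i. mp_map (specialize F s) (scale_forms [:0, 1:] (generic_forms n d) i))"
      using specialize_generic[OF assms(2)]
      by (intro resultant_of_cong assms(1)) (simp add: scale_forms_def ms.hom_mult s.mp_map_single)
    also have "\<dots> = specialize F s P"
      unfolding P_def hom_resultant_of[OF comm_ring_hom_specialize assms(1)] ..
    finally show ?thesis by (simp add: b specialize_monom)
  qed
  have "resultant_of n d (scale_forms 1 F) = resultant_of n d F"
    by (intro resultant_of_cong assms(1)) (simp add: scale_forms_def)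
  then show ?thesis using *[of 1] by (simp add: * mult.commute)
qed

text \<open>Gaussian elimination with row additions and the scaling of row 0 as generators. As
  \<open>P\<close> is assumed closed under products only, the steps are reversed through
  \<open>undo\<close>: the inverse of a row addition is again a row addition.\<close>

lemma GL_induct [consumes 3, case_names mult addrow multrow]:
  fixes A :: "'a::field mat"
  assumes N: "N > 0" and A: "A \<in> carrier_mat N N" and "det A \<noteq> 0"
    and mult: "\<And>A B. A \<in> carrier_mat N N \<Longrightarrow> B \<in> carrier_mat N N \<Longrightarrow> det A \<noteq> 0 \<Longrightarrow> det B \<noteq> 0 \<Longrightarrow>
      P A \<Longrightarrow> P B \<Longrightarrow> P (A * B)"
    and addrow: "\<And>a k l. k < N \<Longrightarrow> l < N \<Longrightarrow> k \<noteq> l \<Longrightarrow> P (addrow_mat N a k l)"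
    and multrow: "\<And>a. a \<noteq> 0 \<Longrightarrow> P (multrow_mat N 0 a)"
  shows "P A"
proof -
  have det_E: "det (addrow_mat N a k l * A) = det A" "addrow_mat N a k l * A \<in> carrier_mat N N"
    if "A \<in> carrier_mat N N" "k \<noteq> l" for A and a :: 'a and k l
    using that by (auto simp: det_mult[of _ N] det_addrow_mat)
  have undo: "P A" if "A \<in> carrier_mat N N" "det A \<noteq> 0" "k < N" "l < N" "k \<noteq> l" "P (addrow_mat N a k l * A)"
    for A a k l
  proof -
    have "addrow_mat N (- a) k l * (addrow_mat N a k l * A) = (addrow_mat N (- a) k l * addrow_mat N a k l) * A"
      using that(1) by (intro assoc_mult_mat[symmetric, of _ N N _ N _ N]) auto
    also have "addrow_mat N (- a) k l * addrow_mat N a k l = 1\<^sub>m N"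
      using addrow_mat_inv[of k N l "- a"] that by simp
    finally have "A = addrow_mat N (- a) k l * (addrow_mat N a k l * A)"
      using that(1) by simp
    moreover have "P (addrow_mat N (- a) k l * (addrow_mat N a k l * A))"
      by (rule mult) (use that det_E[OF that(1,5)] addrow[of k l] in \<open>auto simp: det_addrow_mat\<close>)
    ultimately show ?thesis by metis
  qed
  have multrow': "P (multrow_mat N k a)" if k: "k < N" and a: "a \<noteq> 0" for k a
  proof (cases "k = 0")
    case False
    define D where "D = multrow_mat N k a"
    \<comment> \<open>\<open>W\<close> exchanges rows 0 and k up to one sign, as a product of three
      row additions. It carries the scaling of row k to that of row 0:
      \<open>W * D = multrow_mat N 0 a * W\<close>.\<close>
    define E where "E = addrow_mat N (1 :: 'a) 0 k"
    define E' where "E' = addrow_mat N (- 1 :: 'a) k 0"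
    define W where "W = E * (E' * E)"
    have D: "D \<in> carrier_mat N N" "det D \<noteq> 0"
      using k a by (auto simp: D_def det_multrow_mat)
    have Ec: "E \<in> carrier_mat N N" "E' \<in> carrier_mat N N" by (auto simp: E_def E'_def)
    have W_eq: "W = mat N N (\<lambda>(i, j). if i = 0 \<and> j = k then 1 else if i = k \<and> j = 0 then - 1
        else if i = j \<and> i \<noteq> 0 \<and> i \<noteq> k then 1 else 0)"
    proof -
      have "E' * E = addrow (- 1) k 0 E"
        unfolding E'_def by (rule addrow_mat[symmetric, OF Ec(1) N])
      moreover have "W = addrow 1 0 k (E' * E)"
        unfolding W_def by (subst (1) E_def) (rule addrow_mat[symmetric, OF mult_carrier_mat[OF Ec(2,1)] k])
      ultimately have "W = addrow 1 0 k (addrow (- 1) k 0 E)" by simp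
      then show ?thesis
        unfolding E_def using False N k by (intro eq_matI) auto
    qed
    have "W * D = multcol k a W"
      unfolding D_def using Ec by (intro multcol_mat[symmetric]) (auto simp: W_def)
    moreover have "multrow_mat N 0 a * W = multrow 0 a W"
      using Ec by (intro multrow_mat[symmetric]) (auto simp: W_def)
    moreover have "multcol k a W = multrow 0 a W"
      unfolding W_eq using False N k by (intro eq_matI) auto
    ultimately have eq: "W * D = multrow_mat N 0 a * W" by simp
    have E: "P E" "P E'" "det E = 1" "det E' = 1"
      using addrow False N k by (auto simp: E_def E'_def det_addrow_mat)
    have EE: "E' * E \<in> carrier_mat N N" "det (E' * E) = 1" "P (E' * E)"
      using Ec E by (auto simp: det_mult[OF Ec(2,1)] intro: mult)
    then have W: "W \<in> carrier_mat N N" "det W = 1" "P W"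
      unfolding W_def using Ec E by (auto simp: det_mult[OF Ec(1) EE(1)] intro: mult)
    have "P (W * D)"
      unfolding eq using W N a by (intro mult multrow) (auto simp: det_multrow_mat)
    moreover have "W * D = E * (E' * (E * D))"
      unfolding W_def using Ec D(1) by (simp add: assoc_mult_mat[of _ N N _ N _ N])
    ultimately have P1: "P (E * (E' * (E * D)))" by simp
    have ED: "E * D \<in> carrier_mat N N" "det (E * D) \<noteq> 0"
      using Ec D E by (auto simp: det_mult[OF Ec(1) D(1)])
    have EED: "E' * (E * D) \<in> carrier_mat N N" "det (E' * (E * D)) \<noteq> 0"
      using Ec E ED by (auto simp: det_mult[OF Ec(2) ED(1)])
    \<comment> \<open>\<open>W\<close> is removed from \<open>W * D\<close> factor by factor, as
      \<open>undo\<close> cancels a single row addition.\<close>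
    have 0: "0 \<noteq> k" "k \<noteq> 0" using False by auto
    have P2: "P (E' * (E * D))"
      by (rule undo[OF EED N k 0(1), of 1]) (use P1 in \<open>simp add: E_def\<close>)
    have P3: "P (E * D)"
      by (rule undo[OF ED k N 0(2), of "- 1"]) (use P2 in \<open>simp add: E'_def\<close>)
    have "P D"
      by (rule undo[OF D N k 0(1), of 1]) (use P3 in \<open>simp add: E_def\<close>)
    then show ?thesis by (simp add: D_def)
  qed (use multrow a in simp)
  \<comment> \<open>Here \<open>m\<close> counts the columns that already agree with the identity
    matrix.\<close>
  have "P A" if "A \<in> carrier_mat N N" "det A \<noteq> 0" "m \<le> N"
    "\<And>i j. j < m \<Longrightarrow> i < N \<Longrightarrow> A $$ (i, j) = (if i = j then 1 else 0)" for m A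
    using that
  proof (induction "N - m" arbitrary: m A rule: less_induct)
    case less
    show ?case
    proof (cases "m = N")
      case True
      then have "A = multrow_mat N 0 1"
        using less.prems(1,4) by (intro eq_matI) auto
      then show ?thesis using multrow[of 1] by simp
    next
      case False
      then have m: "m < N" using less.prems by simp
      \<comment> \<open>With the pivot equal to 1, column m is cleared row by row; the rows before
        \<open>s\<close> are done.\<close>
      have clear: "P B" if "B \<in> carrier_mat N N" "det B \<noteq> 0" "B $$ (m, m) = 1" "s \<le> N"
        "\<And>i j. j < m \<Longrightarrow> i < N \<Longrightarrow> B $$ (i, j) = (if i = j then 1 else 0)"
        "\<And>k. k < s \<Longrightarrow> k \<noteq> m \<Longrightarrow> B $$ (k, m) = 0" for s B
        using that
      proof (induction "N - s" arbitrary: s B rule: less_induct)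
        case inner: less
        show ?case
        proof (cases "s = N")
          case True
          show ?thesis
          proof (rule less.hyps[of "Suc m"])
            fix i j assume "j < Suc m" "i < N"
            then show "B $$ (i, j) = (if i = j then 1 else 0)"
              using inner.prems True by (cases "j = m") auto
          qed (use m inner.prems in auto)
        next
          case s: False
          show ?thesis
          proof (cases "s = m")
            case True
            then show ?thesis
              using inner.prems s by (intro inner.hyps[of "Suc s"]) (auto simp: less_Suc_eq)
          next
            case sm: False
            have sN: "s < N" using s inner.prems by simp
            let ?B = "addrow_mat N (- B $$ (s, m)) s m * B"
            have B: "?B = addrow (- B $$ (s, m)) s m B"
              by (rule addrow_mat[symmetric, OF inner.prems(1) m])
            have "P ?B"
            proof (rule inner.hyps[of "Suc s"])
              show "?B \<in> carrier_mat N N" "det ?B \<noteq> 0"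
                using det_E[OF inner.prems(1) sm] inner.prems by auto
              show "?B $$ (m, m) = 1"
                unfolding B using inner.prems m sm by auto
              show "?B $$ (i, j) = (if i = j then 1 else 0)" if "j < m" "i < N" for i j
                unfolding B using inner.prems(1) inner.prems(5)[OF that] inner.prems(5)[OF that(1) m] m that by auto
              show "?B $$ (k, m) = 0" if "k < Suc s" "k \<noteq> m" for k
                unfolding B using inner.prems(1,3) inner.prems(6)[of k] that m sN by (auto simp: less_Suc_eq)
            qed (use sN in auto)
            then show ?thesis
              using undo[OF inner.prems(1,2) sN m sm] by blast
          qed
        qed
      qed
      have pivot: "P C" if C: "C \<in> carrier_mat N N" "det C \<noteq> 0" "C $$ (m, m) \<noteq> 0"
        "\<And>i j. j < m \<Longrightarrow> i < N \<Longrightarrow> C $$ (i, j) = (if i = j then 1 else 0)" for C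
      proof -
        let ?a = "C $$ (m, m)"
        let ?C = "multrow_mat N m (inverse ?a) * C"
        have eq: "?C = multrow m (inverse ?a) C"
          by (rule multrow_mat[symmetric, OF C(1)])
        have Cc: "?C \<in> carrier_mat N N" "det ?C \<noteq> 0"
          using C m by (auto simp: det_mult[of _ N] det_multrow_mat)
        have "P ?C"
        proof (rule clear[of _ 0])
          show "?C $$ (m, m) = 1" unfolding eq using C m by auto
          show "?C $$ (i, j) = (if i = j then 1 else 0)" if "j < m" "i < N" for i j
            unfolding eq using C(1) C(4)[OF that] that m by auto
        qed (use Cc in auto)
        then have "P (multrow_mat N m ?a * ?C)"
          using C m Cc multrow'[OF m C(3)] by (intro mult[of "multrow_mat N m ?a" ?C]) (auto simp: det_multrow_mat)
        moreover have "multrow_mat N m ?a * ?C = (multrow_mat N m ?a * multrow_mat N m (inverse ?a)) * C"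
          using C(1) by (intro assoc_mult_mat[symmetric, of _ N N _ N _ N]) auto
        moreover have "multrow_mat N m ?a * multrow_mat N m (inverse ?a) = 1\<^sub>m N"
          using C(3) m by (intro multrow_mat_inv) auto
        ultimately show ?thesis using left_mult_one_mat[OF C(1)] by metis
      qed
      \<comment> \<open>Otherwise column m would be a combination of the columns before it, which
        are unit vectors, and \<open>v\<close> would record this as a kernel vector.\<close>
      have "\<exists>i\<ge>m. i < N \<and> A $$ (i, m) \<noteq> 0"
      proof (rule ccontr)
        assume none: "\<not> (\<exists>i\<ge>m. i < N \<and> A $$ (i, m) \<noteq> 0)"
        define v where "v = vec N (\<lambda>j. if j < m then - A $$ (j, m) else if j = m then 1 else 0)"
        have "A *\<^sub>v v = 0\<^sub>v N"
        proof (rule eq_vecI)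
          fix i assume "i < dim_vec (0\<^sub>v N :: 'a vec)"
          then have i: "i < N" by simp
          have "(A *\<^sub>v v) $ i = (\<Sum>j<N. A $$ (i, j) * v $ j)"
            using less.prems(1) i by (simp add: v_def scalar_prod_def atLeast0LessThan)
          also have "\<dots> = (\<Sum>j<N. (if j = i then (if i < m then - A $$ (i, m) else 0) else 0) + (if j = m then A $$ (i, m) else 0))"
            using i by (intro sum.cong refl) (auto simp: v_def less.prems(4))
          also have "\<dots> = (if i < m then - A $$ (i, m) else 0) + A $$ (i, m)"
            unfolding sum.distrib using i m by simp
          also have "\<dots> = 0" using none i by (cases "i < m") auto
          finally show "(A *\<^sub>v v) $ i = 0\<^sub>v N $ i" using i by simp
        qed (use less.prems(1) in auto)
        moreover have "v \<in> carrier_vec N" by (simp add: v_def)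
        moreover have "v $ m \<noteq> 0" using m by (simp add: v_def)
        then have "v \<noteq> 0\<^sub>v N" using m by auto
        ultimately show False
          using less.prems(2) det_0_iff_vec_prod_zero_field[OF less.prems(1)] by blast
      qed
      then obtain i where i: "i \<ge> m" "i < N" "A $$ (i, m) \<noteq> 0" by blast
      show ?thesis
      proof (cases "A $$ (m, m) = 0")
        case False
        then show ?thesis using less.prems by (intro pivot) auto
      next
        case True
        then have im: "m \<noteq> i" using i by auto
        \<comment> \<open>Adding row i to row m, whose entry in this column is 0, replaces a row
          exchange.\<close>
        have eq: "addrow_mat N 1 m i * A = addrow 1 m i A"
          by (rule addrow_mat[symmetric, OF less.prems(1) i(2)])
        have "P (addrow_mat N 1 m i * A)"
        proof (rule pivot)
          show "addrow_mat N 1 m i * A \<in> carrier_mat N N" "det (addrow_mat N 1 m i * A) \<noteq> 0"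
            using det_E[OF less.prems(1) im] less.prems by auto
          show "(addrow_mat N 1 m i * A) $$ (m, m) \<noteq> 0"
            unfolding eq using less.prems(1) True i m by auto
          show "(addrow_mat N 1 m i * A) $$ (i', j) = (if i' = j then 1 else 0)" if "j < m" "i' < N" for i' j
            unfolding eq using less.prems(1) less.prems(4)[OF that] less.prems(4)[OF that(1) i(2)] i m that by auto
        qed
        then show ?thesis using undo[OF less.prems(1,2) m i(2) im] by blast
      qed
    qed
  qed
  from this[of A 0] show ?thesis using A \<open>det A \<noteq> 0\<close> by simp
qed

text \<open>Both sides are multiplicative in \<open>\<Gamma>\<close>, so generators suffice. The
  induction quantifies over the tuple because the second factor of a product acts on the tuple
  transformed by the first.\<close>

lemma resultant_conj:
  fixes F :: "nat \<Rightarrow> (nat, 'a::field) mpol"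
  assumes "d \<ge> 1" "\<Gamma> \<in> carrier_mat (n + 1) (n + 1)" "det \<Gamma> \<noteq> 0" "\<And>i. i \<le> n \<Longrightarrow> F i \<in> forms UNIV n d"
  shows "resultant_of n d (conj_forms n \<Gamma> F) = det \<Gamma> ^ row_weight n d * resultant_of n d F"
proof -
  have "n + 1 > 0" by simp
  then have "\<forall>F. (\<forall>i\<le>n. F i \<in> forms UNIV n d) \<longrightarrow>
      resultant_of n d (conj_forms n \<Gamma> F) = det \<Gamma> ^ row_weight n d * resultant_of n d F"
    using assms(2,3)
  proof (induction \<Gamma> rule: GL_induct)
    case (mult A B)
    show ?case
    proof (intro allI impI)
      fix F assume F: "\<forall>i\<le>n. (F i :: (nat, 'a) mpol) \<in> forms UNIV n d"
      have "resultant_of n d (conj_forms n (A * B) F) = resultant_of n d (conj_forms n B (conj_forms n A F))"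
        using conj_forms_mult[of n F d _ A B] F mult by (intro resultant_of_cong assms(1)) simp
      also have "\<dots> = det (A * B) ^ row_weight n d * resultant_of n d F"
        using mult F conj_forms_in_forms[of n F d A] by (simp add: det_mult[of A "n + 1"] power_mult_distrib)
      finally show "resultant_of n d (conj_forms n (A * B) F) = det (A * B) ^ row_weight n d * resultant_of n d F" .
    qed
  next
    case (addrow a k l)
    then show ?case
      using resultant_conj_addrow[OF assms(1), of n _ k l a] det_addrow_mat[of k l "n + 1" a] by simp
  next
    case (multrow a)
    then show ?case
      using resultant_conj_multrow[OF assms(1), of n _ a] det_multrow_mat[of 0 "n + 1" a] by simp
  qed
  then show ?thesis using assms(4) by blast
qed

lemma conj_forms_scalar:
  fixes F :: "nat \<Rightarrow> (nat, 'a::idom) mpol"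
  assumes F: "\<And>j. j \<le> n \<Longrightarrow> F j \<in> forms UNIV n d" and "i \<le> n" "t \<noteq> 0"
  shows "conj_forms n (t \<cdot>\<^sub>m 1\<^sub>m (n + 1)) F i = scale_forms (t ^ (n + d)) F i"
proof -
  interpret m: comm_ring_hom "mconst :: 'a \<Rightarrow> (nat, 'a) mpol" by (rule comm_ring_hom_mconst)
  let ?T = "t \<cdot>\<^sub>m 1\<^sub>m (n + 1) :: 'a mat"
  have T: "?T \<in> carrier_mat (n + 1) (n + 1)" by simp
  note a = adj_mat[OF T]
  have detT: "det ?T = t ^ (n + 1)" by simp
  have "adj_mat ?T * ?T = t \<cdot>\<^sub>m adj_mat ?T"
    using mult_smult_distrib[OF a(1) one_carrier_mat] right_mult_one_mat[OF a(1)] by simp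
  then have adj_t: "t \<cdot>\<^sub>m adj_mat ?T = t ^ (n + 1) \<cdot>\<^sub>m 1\<^sub>m (n + 1)"
    unfolding a(3) detT by simp
  define A where "A = adj_mat ?T"
  have A: "A \<in> carrier_mat (n + 1) (n + 1)" "t \<cdot>\<^sub>m A = t ^ (n + 1) \<cdot>\<^sub>m 1\<^sub>m (n + 1)"
    unfolding A_def using a(1) adj_t by simp_all
  have adj: "A $$ (i, j) = (if j = i then t ^ n else 0)" if "j \<le> n" for j
  proof -
    have "t * A $$ (i, j) = (t \<cdot>\<^sub>m A) $$ (i, j)"
      using A(1) that \<open>i \<le> n\<close> by simp
    also have "\<dots> = t * (if j = i then t ^ n else 0)"
      unfolding A(2) using that \<open>i \<le> n\<close> by auto
    finally show ?thesis unfolding mult_cancel_left using \<open>t \<noteq> 0\<close> by blast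
  qed
  have "mconst (A $$ (i, j)) * lin_subst n ?T (F j)
      = (if j = i then mconst (t ^ n) * (mconst (t ^ d) * F i) else 0)" if "j \<le> n" for j
    unfolding adj[OF that] lin_subst_scalar[OF F[OF that]] by auto
  then have "conj_forms n ?T F i = (\<Sum>j\<le>n. if j = i then mconst (t ^ n) * (mconst (t ^ d) * F i) else 0)"
    unfolding conj_forms_eq A_def[symmetric] by (intro sum.cong refl) blast
  then show ?thesis using \<open>i \<le> n\<close> by (simp add: scale_forms_def power_add m.hom_mult mult.assoc)
qed

text \<open>Twice the identity over the rationals acts on \<open>(X_0^d, ..., X_n^d)\<close> both as
  a matrix of determinant \<open>2 ^ (n + 1)\<close> and as the scalar \<open>2 ^ (n + d)\<close>.
  The resultant there is 1, and equal powers of 2 have equal exponents.\<close>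

lemma row_weight_eq:
  assumes "d \<ge> 1"
  shows "(n + 1) * row_weight n d = (n + d) * resultant_degree n d"
proof -
  define F where "F = (power_forms d :: nat \<Rightarrow> (nat, rat) mpol)"
  have F: "F i \<in> forms UNIV n d" if "i \<le> n" for i
    unfolding F_def by (rule power_forms_in_forms[OF that])
  have "resultant_of n d F = of_int (mp_eval of_int (coeffs_of (power_forms d)) (resultant_poly n d))"
    unfolding resultant_of_def hom_mp_eval_of_int[OF comm_ring_hom_of_int]
    by (intro arg_cong[of _ _ "\<lambda>x. mp_eval of_int x _"]) (auto simp: F_def coeffs_of_power_forms fun_eq_iff)
  then have res: "resultant_of n d F = 1"
    by (simp only: resultant_poly_spec(2)[OF assms] of_int_1)
  let ?T = "2 \<cdot>\<^sub>m 1\<^sub>m (n + 1) :: rat mat"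
  have "resultant_of n d (conj_forms n ?T F) = resultant_of n d (scale_forms (2 ^ (n + d)) F)"
    using conj_forms_scalar[of n F d _ 2] F by (intro resultant_of_cong assms) simp
  then have "(2 ^ (n + d)) ^ resultant_degree n d = ((2 :: rat) ^ (n + 1)) ^ row_weight n d"
    using resultant_scale[OF assms, of n F "2 ^ (n + d)"] resultant_conj[OF assms, of ?T n F] F res by simp
  then have "(2 :: rat) ^ ((n + d) * resultant_degree n d) = 2 ^ ((n + 1) * row_weight n d)"
    unfolding power_mult .
  then show ?thesis by simp
qed

section \<open>Transformation of the invariants\<close>

lemma SL_invariants_mpols_in: "f \<in> SL_invariants n d \<Longrightarrow> f \<in> mpols_in (coeff_vars n d)"
  by (simp add: SL_invariants_def mpols_in_def)

lemma mp_eval_coeffs_cong: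
  assumes "f \<in> mpols_in (coeff_vars n d)" "\<And>i. i \<le> n \<Longrightarrow> F i = G i"
  shows "mp_eval h (coeffs_of F) f = mp_eval h (coeffs_of G) f"
proof (rule mp_eval_cong)
  fix \<mu> v assume "\<mu> \<in> Poly_Mapping.keys f" "v \<in> Poly_Mapping.keys \<mu>"
  then have "v \<in> coeff_vars n d" using assms(1) unfolding mpols_in_def by blast
  then show "coeffs_of F v = coeffs_of G v"
    using assms(2) by (auto simp: coeff_vars_def coeffs_of_def)
qed simp

lemma hom_mp_eval_coeffs:
  assumes "comm_ring_hom h"
  shows "h (mp_eval of_int (coeffs_of F) f) = mp_eval of_int (coeffs_of (\<lambda>i. mp_map h (F i))) f"
  unfolding hom_mp_eval_of_int[OF assms]
  by (simp add: coeffs_of_def comm_ring_hom.lookup_mp_map[OF assms] case_prod_unfold)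

lemma mp_eval_scale_homogeneous:
  assumes "\<forall>\<mu>\<in>Poly_Mapping.keys f. mon_degree \<mu> = D"
  shows "mp_eval of_int (coeffs_of (scale_forms s F)) f = s ^ D * mp_eval of_int (coeffs_of F) f"
proof -
  have "coeffs_of (scale_forms s F) = (\<lambda>v. s * coeffs_of F v)"
    by (auto simp: coeffs_of_def scale_forms_def fun_eq_iff)
  then show ?thesis
    using assms
    by (simp add: comm_ring_hom.mp_eval_superset[OF comm_ring_hom_of_int finite_keys order_refl]
        mon_eval_scale sum_distrib_left mult.left_commute)
qed

text \<open>The generic matrix and the generic coefficients are specialized to
  \<open>\<Gamma>\<close> and \<open>F\<close>. This homomorphism kills
  \<open>det (generic_mat n) - 1\<close>, and with it the difference between the coaction of
  \<open>f\<close> and \<open>f\<close>.\<close>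

lemma SL_invariant_conj_SL:
  fixes F :: "nat \<Rightarrow> (nat, 'a::comm_ring_1) mpol"
  assumes f: "f \<in> SL_invariants n d" and \<Gamma>: "\<Gamma> \<in> carrier_mat (n + 1) (n + 1)" "det \<Gamma> = 1"
    and F: "\<And>i. i \<le> n \<Longrightarrow> F i \<in> forms UNIV n d"
  shows "mp_eval of_int (coeffs_of (conj_forms n \<Gamma> F)) f = mp_eval of_int (coeffs_of F) f"
proof -
  define x where "x v = (case v of Inl w \<Rightarrow> coeffs_of F w | Inr ij \<Rightarrow> \<Gamma> $$ ij)" for v :: cgvar
  define h :: "(cgvar, int) mpol \<Rightarrow> 'a" where "h = mp_eval of_int x"
  have hom: "comm_ring_hom h"
    unfolding h_def by (intro comm_ring_hom.comm_ring_hom_mp_eval comm_ring_hom_of_int)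
  interpret h: comm_ring_hom h by (rule hom)
  have hvar: "h (mvar v) = x v" for v
    by (simp add: h_def comm_ring_hom.mp_eval_single[OF comm_ring_hom_of_int])
  have gen: "map_mat h (generic_mat n) = \<Gamma>"
    using \<Gamma>(1) by (intro eq_matI) (auto simp: generic_mat_def hvar x_def simp del: One_nat_def)
  have gen_c: "generic_mat n \<in> carrier_mat (n + 1) (n + 1)"
    by (simp add: generic_mat_def)
  have "h (det (generic_mat n) - 1) = 0"
    using \<Gamma>(2) by (simp add: h.hom_minus gen flip: h.hom_det)
  moreover have "h (det (generic_mat n) - 1) dvd h (coaction n d f - mp_eval of_int (\<lambda>v. mvar (Inl v)) f)"
    using f by (intro h.hom_dvd) (simp add: SL_invariants_def)
  ultimately have eq: "h (coaction n d f) = h (mp_eval of_int (\<lambda>v. mvar (Inl v)) f)"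
    by (simp add: h.hom_minus)
  have "h (mp_eval of_int (\<lambda>v. mvar (Inl v)) f) = mp_eval of_int (coeffs_of F) f"
    unfolding hom_mp_eval_of_int[OF hom] hvar by (simp add: x_def)
  moreover have "h (coaction n d f) = mp_eval of_int (coeffs_of (conj_forms n \<Gamma> F)) f"
    unfolding coaction_def hom_mp_eval_coeffs[OF hom]
  proof (rule mp_eval_coeffs_cong[OF SL_invariants_mpols_in[OF f]])
    fix i assume i: "i \<le> n"
    have "mp_map h (forms_with_coeffs n d (\<lambda>v. mvar (Inl v)) j) = F j" if "j \<le> n" for j
      unfolding h.mp_map_forms_with_coeffs hvar
      using forms_with_coeffs_coeffs_of[of F j n d] F[OF that] by (simp add: x_def)
    then show "mp_map h (conj_forms n (generic_mat n) (forms_with_coeffs n d (\<lambda>v. mvar (Inl v))) i)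
        = conj_forms n \<Gamma> F i"
      unfolding h.mp_map_conj_forms[OF forms_with_coeffs_in_forms gen_c i] gen by (rule conj_forms_cong)
  qed
  ultimately show ?thesis using eq by simp
qed

lemma comm_ring_hom_to_ac: "comm_ring_hom to_ac"
  by unfold_locales simp_all

text \<open>
  Over the algebraic closure \<open>\<Gamma>\<close> is a scalar multiple of a matrix of determinant \<open>1\<close>; the
  \<open>(n+1)\<close>-st power removes the choice of a root of the determinant.
\<close>

lemma SL_invariant_conj:
  fixes F :: "nat \<Rightarrow> (nat, 'a::field) mpol"
  assumes f: "f \<in> SL_invariants n d" and D: "\<forall>\<mu>\<in>Poly_Mapping.keys f. mon_degree \<mu> = D"
    and \<Gamma>: "\<Gamma> \<in> carrier_mat (n + 1) (n + 1)" "det \<Gamma> \<noteq> 0"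
    and F: "\<And>i. i \<le> n \<Longrightarrow> F i \<in> forms UNIV n d"
  shows "mp_eval of_int (coeffs_of (conj_forms n \<Gamma> F)) f ^ (n + 1)
    = (det \<Gamma> ^ (n + d)) ^ D * mp_eval of_int (coeffs_of F) f ^ (n + 1)"
proof -
  interpret a: comm_ring_hom "to_ac :: 'a \<Rightarrow> 'a alg_closure" by (rule comm_ring_hom_to_ac)
  obtain t :: "'a alg_closure" where t: "t ^ (n + 1) = to_ac (det \<Gamma>)"
    using nth_root_exists[of "n + 1" "to_ac (det \<Gamma>)"] by auto
  have t0: "t \<noteq> 0" using t \<Gamma>(2) by (metis to_ac_eq_0_iff power_0_left add_is_0 one_neq_zero)
  define \<Gamma>1 where "\<Gamma>1 = inverse t \<cdot>\<^sub>m map_mat to_ac \<Gamma>"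
  have \<Gamma>1: "\<Gamma>1 \<in> carrier_mat (n + 1) (n + 1)"
    using \<Gamma>(1) by (simp add: \<Gamma>1_def)
  have det1: "det \<Gamma>1 = 1"
    using \<Gamma> t t0 by (simp add: \<Gamma>1_def power_inverse flip: power_Suc)
  define T where "T = t \<cdot>\<^sub>m 1\<^sub>m (n + 1)"
  have T: "T \<in> carrier_mat (n + 1) (n + 1)" "det T \<noteq> 0"
    using t0 by (auto simp: T_def)
  have eq: "map_mat to_ac \<Gamma> = \<Gamma>1 * T"
    unfolding T_def mult_smult_distrib[OF \<Gamma>1 one_carrier_mat] right_mult_one_mat[OF \<Gamma>1]
    using t0 by (intro eq_matI) (auto simp: \<Gamma>1_def)
  define G where "G i = mp_map to_ac (F i)" for i
  have G: "G i \<in> forms UNIV n d" if "i \<le> n" for i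
    using F[OF that] by (auto simp: G_def forms_def in_keys_iff a.lookup_mp_map)
  have G1: "conj_forms n \<Gamma>1 G i \<in> forms UNIV n d" for i
    using G by (rule conj_forms_in_forms)
  have "to_ac (mp_eval of_int (coeffs_of (conj_forms n \<Gamma> F)) f)
      = mp_eval of_int (coeffs_of (scale_forms (t ^ (n + d)) (conj_forms n \<Gamma>1 G))) f"
    unfolding hom_mp_eval_coeffs[OF comm_ring_hom_to_ac]
  proof (rule mp_eval_coeffs_cong[OF SL_invariants_mpols_in[OF f]])
    fix i assume i: "i \<le> n"
    have "mp_map to_ac (conj_forms n \<Gamma> F i) = conj_forms n (map_mat to_ac \<Gamma>) G i"
      using a.mp_map_conj_forms[of n F d \<Gamma> i] F \<Gamma> i by (simp add: G_def[abs_def])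
    also have "\<dots> = conj_forms n T (conj_forms n \<Gamma>1 G) i"
      unfolding eq using conj_forms_mult[of n G d i \<Gamma>1 T] G i \<Gamma>1 T det1 by simp
    also have "\<dots> = scale_forms (t ^ (n + d)) (conj_forms n \<Gamma>1 G) i"
      unfolding T_def using G1 i t0 by (intro conj_forms_scalar) auto
    finally show "mp_map to_ac (conj_forms n \<Gamma> F i) = scale_forms (t ^ (n + d)) (conj_forms n \<Gamma>1 G) i" .
  qed
  also have "\<dots> = (t ^ (n + d)) ^ D * mp_eval of_int (coeffs_of G) f"
    using SL_invariant_conj_SL[of f n d \<Gamma>1 G] f \<Gamma>1 det1 G by (simp add: mp_eval_scale_homogeneous[OF D])
  also have "mp_eval of_int (coeffs_of G) f = to_ac (mp_eval of_int (coeffs_of F) f)"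
    unfolding hom_mp_eval_coeffs[OF comm_ring_hom_to_ac] G_def[abs_def] ..
  finally have "to_ac (mp_eval of_int (coeffs_of (conj_forms n \<Gamma> F)) f) ^ (n + 1)
      = ((t ^ (n + d)) ^ D) ^ (n + 1) * to_ac (mp_eval of_int (coeffs_of F) f) ^ (n + 1)"
    by (simp only: power_mult_distrib)
  \<comment> \<open>Regrouped, only \<open>t ^ (n + 1)\<close>, the determinant, occurs; the
    identity thus descends to the base field.\<close>
  also have "((t ^ (n + d)) ^ D) ^ (n + 1) = to_ac ((det \<Gamma> ^ (n + d)) ^ D)"
    unfolding to_ac_power t[symmetric] by (simp only: power_mult[symmetric] mult_ac)
  finally have "to_ac (mp_eval of_int (coeffs_of (conj_forms n \<Gamma> F)) f ^ (n + 1))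
      = to_ac ((det \<Gamma> ^ (n + d)) ^ D * mp_eval of_int (coeffs_of F) f ^ (n + 1))"
    by (simp only: to_ac_power to_ac_mult)
  then show ?thesis unfolding to_ac_eq_iff .
qed


section \<open>Integral elements\<close>

definition subring_set :: "'a::comm_ring_1 set \<Rightarrow> bool"
  where "subring_set S \<longleftrightarrow> 1 \<in> S \<and> (\<forall>a\<in>S. \<forall>b\<in>S. a - b \<in> S \<and> a * b \<in> S)"

lemma subring_setD:
  assumes "subring_set S"
  shows "0 \<in> S" "1 \<in> S" "a \<in> S \<Longrightarrow> - a \<in> S" "a \<in> S \<Longrightarrow> b \<in> S \<Longrightarrow> a + b \<in> S"
    "a \<in> S \<Longrightarrow> b \<in> S \<Longrightarrow> a - b \<in> S" "a \<in> S \<Longrightarrow> b \<in> S \<Longrightarrow> a * b \<in> S"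
proof -
  have m: "a - b \<in> S" if "a \<in> S" "b \<in> S" for a b using assms that by (auto simp: subring_set_def)
  show one: "1 \<in> S" using assms by (simp add: subring_set_def)
  show zero: "0 \<in> S" using m[OF one one] by simp
  show neg: "- a \<in> S" if "a \<in> S" for a using m[OF zero that] by simp
  show "a + b \<in> S" if "a \<in> S" "b \<in> S" using m[OF that(1) neg[OF that(2)]] by simp
  show "a - b \<in> S" if "a \<in> S" "b \<in> S" using m[OF that] .
  show "a * b \<in> S" if "a \<in> S" "b \<in> S" using assms that by (auto simp: subring_set_def)
qed

lemma subring_set_power: "subring_set S \<Longrightarrow> a \<in> S \<Longrightarrow> a ^ n \<in> S"
  by (induction n) (auto intro: subring_setD)

lemma subring_set_sum: "subring_set S \<Longrightarrow> (\<And>i. i \<in> I \<Longrightarrow> f i \<in> S) \<Longrightarrow> sum f I \<in> S"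
  by (induction I rule: infinite_finite_induct) (auto intro: subring_setD)

lemma subring_set_prod: "subring_set S \<Longrightarrow> (\<And>i. i \<in> I \<Longrightarrow> f i \<in> S) \<Longrightarrow> prod f I \<in> S"
  by (induction I rule: infinite_finite_induct) (auto intro: subring_setD)

lemma subring_set_of_int: "subring_set S \<Longrightarrow> of_int k \<in> S"
proof -
  assume S: "subring_set S"
  have nat: "of_nat n \<in> S" for n by (induction n) (auto intro: subring_setD[OF S])
  show ?thesis
    by (cases k rule: int_cases2) (auto intro: nat subring_setD(3)[OF S])
qed

lemma subring_set_polys:
  assumes S: "subring_set S"
  shows "subring_set {p. \<forall>i. coeff p i \<in> S}"
  unfolding subring_set_def
  by (auto simp: coeff_mult coeff_1 intro!: subring_setD[OF S] subring_set_sum[OF S])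

lemma poly_mem:
  assumes "subring_set S" "\<And>i. coeff p i \<in> S" "x \<in> S"
  shows "poly p x \<in> S"
  unfolding poly_altdef
  using assms by (intro subring_set_sum subring_setD(6) subring_set_power) auto

lemma det_mem:
  assumes S: "subring_set S" and "A \<in> carrier_mat n n" "\<And>i j. i < n \<Longrightarrow> j < n \<Longrightarrow> A $$ (i, j) \<in> S"
  shows "det A \<in> S"
  unfolding det_def'[OF assms(2)]
proof (intro subring_set_sum[OF S] subring_setD(6)[OF S] subring_set_prod[OF S] subring_set_of_int[OF S])
  fix p i assume "p \<in> {p. p permutes {0..<n}}" "i \<in> {0..<n}"
  then show "A $$ (i, p i) \<in> S"
    using permutes_in_image[of p "{0..<n}" i] by (intro assms(3)) auto
qed

definition integral_over :: "'a::comm_ring_1 set \<Rightarrow> 'a \<Rightarrow> bool"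
  where "integral_over S w \<longleftrightarrow> (\<exists>n a. (\<forall>i<n. a i \<in> S) \<and> w ^ n = (\<Sum>i<n. a i * w ^ i))"

lemma integral_over_mono: "integral_over S w \<Longrightarrow> S \<subseteq> T \<Longrightarrow> integral_over T w"
  unfolding integral_over_def by blast

lemma monic_poly_root:
  fixes p :: "'a::comm_ring_1 poly"
  assumes "lead_coeff p = 1" "poly p w = 0"
  shows "w ^ degree p = (\<Sum>i<degree p. - coeff p i * w ^ i)"
proof -
  have "poly p w = (\<Sum>i<degree p. coeff p i * w ^ i) + coeff p (degree p) * w ^ degree p"
    unfolding poly_altdef lessThan_Suc_atMost[symmetric] sum.lessThan_Suc ..
  then have "(\<Sum>i<degree p. coeff p i * w ^ i) + w ^ degree p = 0"
    unfolding assms by simp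
  then have "w ^ degree p = - (\<Sum>i<degree p. coeff p i * w ^ i)"
    by (metis add.commute eq_neg_iff_add_eq_0)
  then show ?thesis by (simp add: sum_negf)
qed

text \<open>The Cayley-Hamilton argument: \<open>w\<close> is an eigenvalue of a matrix over \<open>S\<close>.\<close>

lemma integral_overI_matrix:
  fixes v :: "nat \<Rightarrow> 'a::field"
  assumes S: "subring_set S" and A: "\<And>i j. i < N \<Longrightarrow> j < N \<Longrightarrow> A i j \<in> S"
    and eq: "\<And>i. i < N \<Longrightarrow> w * v i = (\<Sum>j<N. A i j * v j)" and nz: "i0 < N" "v i0 \<noteq> 0"
  shows "integral_over S w"
proof -
  define M where "M = mat N N (\<lambda>(i, j). A i j)"
  have M: "M \<in> carrier_mat N N" by (simp add: M_def)
  have "eigenvector M (vec N v) w"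
    unfolding eigenvector_def
  proof (intro conjI)
    have "vec N v $ i0 \<noteq> 0\<^sub>v N $ i0" using nz by simp
    then show "vec N v \<noteq> 0\<^sub>v (dim_row M)" using M by auto
    show "M *\<^sub>v vec N v = w \<cdot>\<^sub>v vec N v"
      by (rule eq_vecI) (auto simp: M_def scalar_prod_def atLeast0LessThan eq)
  qed (simp add: M_def)
  then have root: "poly (char_poly M) w = 0"
    using eigenvalue_root_char_poly[OF M] by (auto simp: eigenvalue_def)
  have monic: "lead_coeff (char_poly M) = 1"
    using degree_monic_char_poly[OF M] by simp
  have "char_poly M \<in> {p. \<forall>i. coeff p i \<in> S}"
    unfolding char_poly_def
  proof (rule det_mem[OF subring_set_polys[OF S]])
    show "char_poly_matrix M \<in> carrier_mat N N" using M by simp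
    fix i j assume "i < N" "j < N"
    then show "char_poly_matrix M $$ (i, j) \<in> {p. \<forall>i. coeff p i \<in> S}"
      using A[of i j] by (auto simp: char_poly_matrix_def M_def coeff_pCons split: nat.splits
          intro: subring_setD[OF S])
  qed
  then show ?thesis
    unfolding integral_over_def using monic_poly_root[OF monic root] subring_setD(3)[OF S]
    by (intro exI[of _ "degree (char_poly M)"] exI[of _ "\<lambda>i. - coeff (char_poly M) i"]) auto
qed

text \<open>An overring of \<open>S\<close> that is finitely generated as an
  \<open>S\<close>-module. Being a ring, it is stable under multiplication by its elements, as the
  determinant argument requires.\<close>

definition module_finite :: "'a::comm_ring_1 set \<Rightarrow> 'a set \<Rightarrow> bool"
  where "module_finite S M \<longleftrightarrow> subring_set M \<and> S \<subseteq> M \<and>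
    (\<exists>N b. \<forall>m\<in>M. \<exists>c. (\<forall>i<(N::nat). c i \<in> S \<and> b i \<in> M) \<and> m = (\<Sum>i<N. c i * b i))"

lemma module_finite_refl:
  assumes S: "subring_set S"
  shows "module_finite S S"
proof -
  have "\<exists>c. (\<forall>i<(1 :: nat). c i \<in> S \<and> 1 \<in> S) \<and> m = (\<Sum>i<(1 :: nat). c i * 1)" if "m \<in> S" for m
    using that subring_setD(2)[OF S] by (intro exI[of _ "\<lambda>_. m"]) simp
  then show ?thesis
    unfolding module_finite_def
    by (intro conjI S order_refl) (rule exI[of _ 1], rule exI[of _ "\<lambda>_. 1"], blast)
qed

text \<open>Multiplication by \<open>w\<close> sends the generators to combinations of themselves,
  which gives a matrix over \<open>S\<close>. As 1 is such a combination, the generators do not all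
  vanish.\<close>

lemma module_finite_imp_integral:
  fixes M :: "'a::field set"
  assumes S: "subring_set S" and M: "module_finite S M" and "w \<in> M"
  shows "integral_over S w"
proof -
  have sub: "subring_set M" using M by (simp add: module_finite_def)
  obtain N :: nat and b where "\<forall>m\<in>M. \<exists>c. (\<forall>i<N. c i \<in> S \<and> b i \<in> M) \<and> m = (\<Sum>i<N. c i * b i)"
    using M unfolding module_finite_def by (elim conjE exE)
  note b = bspec[OF this]
  have bM: "b i \<in> M" if "i < N" for i using b[OF subring_setD(2)[OF sub]] that by blast
  have "\<forall>i<N. \<exists>c. (\<forall>j<N. c j \<in> S) \<and> w * b i = (\<Sum>j<N. c j * b j)"
  proof (intro allI impI)
    fix i assume "i < N"
    then show "\<exists>c. (\<forall>j<N. c j \<in> S) \<and> w * b i = (\<Sum>j<N. c j * b j)"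
      using b[OF subring_setD(6)[OF sub \<open>w \<in> M\<close> bM]] by blast
  qed
  then obtain A where A: "\<And>i. i < N \<Longrightarrow> (\<forall>j<N. A i j \<in> S) \<and> w * b i = (\<Sum>j<N. A i j * b j)"
    by metis
  have "\<exists>i<N. b i \<noteq> 0"
  proof (rule ccontr)
    assume none: "\<not> (\<exists>i<N. b i \<noteq> 0)"
    obtain c where "1 = (\<Sum>i<N. c i * b i)" using b[OF subring_setD(2)[OF sub]] by blast
    also have "\<dots> = 0" using none by (intro sum.neutral) auto
    finally show False by simp
  qed
  then obtain i0 where "i0 < N" "b i0 \<noteq> 0" by blast
  then show ?thesis
    using A by (intro integral_overI_matrix[OF S, of N A w b i0]) auto
qed

lemma poly_reduce_monic:
  assumes M: "subring_set M" and a: "\<And>i. i < n \<Longrightarrow> a i \<in> M" "w ^ n = (\<Sum>i<n. a i * w ^ i)"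
  shows "\<exists>c. (\<forall>i<n. c i \<in> M) \<and> w ^ k = (\<Sum>i<n. c i * w ^ i)"
proof (induction k)
  case 0
  show ?case
  proof (cases "n = 0")
    case False
    have "(\<Sum>i<n. (if i = 0 then 1 else 0) * w ^ i) = (\<Sum>i<n. if i = 0 then 1 else 0)"
      by (intro sum.cong) auto
    also have "\<dots> = 1" using False by simp
    finally show ?thesis
      by (intro exI[of _ "\<lambda>i. if i = 0 then 1 else 0"]) (auto intro: subring_setD[OF M])
  qed (use a(2) in simp)
next
  case (Suc k)
  then obtain c where c: "\<And>i. i < n \<Longrightarrow> c i \<in> M" "w ^ k = (\<Sum>i<n. c i * w ^ i)" by blast
  show ?case
  proof (cases n)
    case 0
    then show ?thesis using c by simp
  next
    case (Suc m)
    \<comment> \<open>Multiplication by \<open>w\<close> shifts the coefficients by one place; the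
      top coefficient \<open>c m\<close> then belongs to \<open>w ^ n\<close>, which is rewritten by
      the monic equation.\<close>
    define c' where "c' i = (if i = 0 then 0 else c (i - 1)) + c m * a i" for i
    have "w ^ Suc k = (\<Sum>i<n. c i * w ^ Suc i)"
      by (simp add: c(2) sum_distrib_left mult.left_commute)
    also have "\<dots> = (\<Sum>i<m. c i * w ^ Suc i) + c m * w ^ n"
      by (simp add: Suc)
    also have "(\<Sum>i<m. c i * w ^ Suc i) = (\<Sum>i<n. (if i = 0 then 0 else c (i - 1)) * w ^ i)"
      unfolding Suc sum.lessThan_Suc_shift by simp
    also have "\<dots> + c m * w ^ n = (\<Sum>i<n. c' i * w ^ i)"
      unfolding a(2) by (simp add: c'_def distrib_right sum.distrib sum_distrib_left mult.assoc)
    finally have "w ^ Suc k = (\<Sum>i<n. c' i * w ^ i)" .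
    moreover have "c' i \<in> M" if "i < n" for i
      unfolding c'_def using that c(1) a(1) Suc by (auto intro!: subring_setD[OF M])
    ultimately show ?thesis by blast
  qed
qed

text \<open>The larger ring consists of the values at \<open>w\<close> of polynomials over
  \<open>M\<close>. It is generated over \<open>S\<close> by the products of the generators of
  \<open>M\<close> with the powers of \<open>w\<close> below the degree of a monic equation.\<close>

lemma module_finite_adjoin:
  assumes S: "subring_set S" and M: "module_finite S M" and w: "integral_over M w"
  shows "\<exists>M'. module_finite S M' \<and> M \<subseteq> M' \<and> w \<in> M'"
proof -
  have sub: "subring_set M" and SM: "S \<subseteq> M" using M by (auto simp: module_finite_def)
  obtain N :: nat and b where "\<forall>m\<in>M. \<exists>c. (\<forall>i<N. c i \<in> S \<and> b i \<in> M) \<and> m = (\<Sum>i<N. c i * b i)"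
    using M unfolding module_finite_def by (elim conjE exE)
  note b = bspec[OF this]
  have bM: "b i \<in> M" if "i < N" for i using b[OF subring_setD(2)[OF sub]] that by blast
  obtain n a where a: "\<And>i. i < n \<Longrightarrow> a i \<in> M" "w ^ n = (\<Sum>i<n. a i * w ^ i)"
    using w unfolding integral_over_def by blast
  define M' where "M' = {poly p w | p. \<forall>i. coeff p i \<in> M}"
  note polys = subring_set_polys[OF sub]
  have M'I: "poly p w \<in> M'" if "\<And>i. coeff p i \<in> M" for p using that by (auto simp: M'_def)
  have MM': "M \<subseteq> M'"
  proof
    fix m assume "m \<in> M"
    then have "poly [:m:] w \<in> M'"
      by (intro M'I) (auto simp: coeff_pCons split: nat.splits intro: subring_setD[OF sub])
    then show "m \<in> M'" by simp
  qed
  have "poly (monom 1 1) w \<in> M'"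
    by (intro M'I) (auto simp: intro: subring_setD[OF sub])
  then have wM': "w \<in> M'" by (simp add: poly_monom)
  have sub': "subring_set M'"
    unfolding subring_set_def
  proof (intro conjI ballI)
    show "1 \<in> M'" using MM' subring_setD(2)[OF sub] by blast
    fix x y assume "x \<in> M'" "y \<in> M'"
    then obtain p q where pq: "x = poly p w" "\<forall>i. coeff p i \<in> M" "y = poly q w" "\<forall>i. coeff q i \<in> M"
      by (auto simp: M'_def)
    then show "x - y \<in> M'" "x * y \<in> M'"
      using subring_setD(5,6)[OF polys, of p q] M'I[of "p - q"] M'I[of "p * q"] by auto
  qed
  have gen: "\<exists>c. (\<forall>i<N * n. c i \<in> S \<and> b (i mod N) * w ^ (i div N) \<in> M')
      \<and> x = (\<Sum>i<N * n. c i * (b (i mod N) * w ^ (i div N)))" if x: "x \<in> M'" for x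
  proof -
    obtain p where p: "x = poly p w" "\<And>i. coeff p i \<in> M"
      using x unfolding M'_def by blast
    have "\<forall>k. \<exists>c. (\<forall>i<n. c i \<in> M) \<and> w ^ k = (\<Sum>i<n. c i * w ^ i)"
      using poly_reduce_monic[OF sub a] by (intro allI)
    then obtain r' where "\<forall>k. (\<forall>i<n. r' k i \<in> M) \<and> w ^ k = (\<Sum>i<n. r' k i * w ^ i)"
      by (rule choice[THEN exE])
    then obtain r where r: "\<And>k i. i < n \<Longrightarrow> r k i \<in> M" "\<And>k. w ^ k = (\<Sum>i<n. r k i * w ^ i)"
      by blast
    define m where "m i = (\<Sum>k\<le>degree p. coeff p k * r k i)" for i
    have mM: "m i \<in> M" if "i < n" for i
      unfolding m_def using that r(1) p(2) by (intro subring_set_sum[OF sub] subring_setD(6)[OF sub]) auto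
    have "x = (\<Sum>k\<le>degree p. coeff p k * (\<Sum>i<n. r k i * w ^ i))"
      unfolding p(1) poly_altdef by (subst r(2)) simp
    also have "\<dots> = (\<Sum>i<n. m i * w ^ i)"
      unfolding sum_distrib_left m_def sum_distrib_right by (subst sum.swap) (simp add: mult.assoc)
    finally have x: "x = (\<Sum>i<n. m i * w ^ i)" .
    have "\<forall>i\<in>{..<n}. \<exists>c. (\<forall>j<N. c j \<in> S) \<and> m i = (\<Sum>j<N. c j * b j)"
      using b mM by blast
    from bchoice[OF this] obtain c where c: "\<And>i. i < n \<Longrightarrow> (\<forall>j<N. c i j \<in> S) \<and> m i = (\<Sum>j<N. c i j * b j)"
      by auto
    have lt: "j + i * N < N * n" if "i < n" "j < N" for i j
    proof -
      have "j + i * N < N * Suc i" using that(2) by (simp add: mult.commute)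
      also have "\<dots> \<le> N * n" using that(1) by (intro mult_le_mono2) simp
      finally show ?thesis .
    qed
    have "x = (\<Sum>i<n. \<Sum>j<N. c i j * b j * w ^ i)"
      unfolding x by (intro sum.cong refl) (simp add: c sum_distrib_right)
    \<comment> \<open>The double sum is numbered by \<open>j + i * N\<close>, with
      \<open>mod\<close> and \<open>div\<close> recovering \<open>j\<close> and
      \<open>i\<close>.\<close>
    also have "\<dots> = (\<Sum>i<N * n. c (i div N) (i mod N) * b (i mod N) * w ^ (i div N))"
    proof (cases "N = 0")
      case False
      have "(\<Sum>i<n. \<Sum>j<N. c i j * b j * w ^ i) = (\<Sum>(i, j)\<in>{..<n} \<times> {..<N}. c i j * b j * w ^ i)"
        by (rule sum.cartesian_product)
      also have "\<dots> = (\<Sum>i<N * n. c (i div N) (i mod N) * b (i mod N) * w ^ (i div N))"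
        using False
        by (intro sum.reindex_bij_witness[of _ "\<lambda>i. (i div N, i mod N)" "\<lambda>(i, j). j + i * N"])
          (auto simp: less_mult_imp_div_less mult.commute intro: lt)
      finally show ?thesis .
    qed simp
    finally have "x = (\<Sum>i<N * n. c (i div N) (i mod N) * (b (i mod N) * w ^ (i div N)))"
      by (simp add: mult.assoc)
    moreover have "c (i div N) (i mod N) \<in> S \<and> b (i mod N) * w ^ (i div N) \<in> M'" if "i < N * n" for i
    proof -
      have "N > 0" using that by (cases N) auto
      then have "i div N < n" "i mod N < N"
        using that by (auto simp: less_mult_imp_div_less mult.commute)
      then show ?thesis
        using c bM MM' wM' by (auto intro!: subring_setD(6)[OF sub'] subring_set_power[OF sub'])
    qed
    ultimately show ?thesis by (intro exI[of _ "\<lambda>i. c (i div N) (i mod N)"]) simp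
  qed
  have "module_finite S M'"
    unfolding module_finite_def using SM MM'
    by (intro conjI sub' subset_trans[OF SM MM'])
      (rule exI[of _ "N * n"], rule exI[of _ "\<lambda>i. b (i mod N) * w ^ (i div N)"], rule ballI, rule gen)
  then show ?thesis using MM' wM' by blast
qed

lemma module_finite_adjoin_list:
  assumes S: "subring_set S" and "\<And>i. i < r \<Longrightarrow> integral_over S (a i)"
  shows "\<exists>M. module_finite S M \<and> (\<forall>i<(r::nat). a i \<in> M)"
  using assms(2)
proof (induction r)
  case 0
  then show ?case using module_finite_refl[OF S] by blast
next
  case (Suc r)
  then obtain M where M: "module_finite S M" "\<forall>i<r. a i \<in> M" by auto
  then have "integral_over M (a r)"
    using Suc.prems[of r] by (auto simp: module_finite_def intro: integral_over_mono)
  from module_finite_adjoin[OF S M(1) this] M(2) show ?case by (auto simp: less_Suc_eq)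
qed

text \<open>Only the finitely many coefficients of one equation for \<open>w\<close> have to be
  adjoined before \<open>w\<close> itself.\<close>

lemma integral_over_trans:
  fixes w :: "'a::field"
  assumes S: "subring_set S" and "\<And>a. a \<in> T \<Longrightarrow> integral_over S a" and w: "integral_over T w"
  shows "integral_over S w"
proof -
  obtain n a where a: "\<And>i. i < n \<Longrightarrow> a i \<in> T" "w ^ n = (\<Sum>i<n. a i * w ^ i)"
    using w unfolding integral_over_def by blast
  obtain M where M: "module_finite S M" "\<forall>i<n. a i \<in> M"
    using module_finite_adjoin_list[OF S, of n a] assms(2) a(1) by blast
  then have "integral_over M w"
    unfolding integral_over_def using a(2) by blast
  from module_finite_adjoin[OF S M(1) this] obtain M' where "module_finite S M'" "w \<in> M'" by blast
  then show ?thesis by (rule module_finite_imp_integral[OF S])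
qed

text \<open>\<open>S\<close> is a field here. A monic equation of least degree for \<open>x\<close>
  has a nonzero constant term, as otherwise \<open>x\<close> could be cancelled; dividing by that
  term expresses the inverse of \<open>x\<close>.\<close>

lemma module_finite_inverse:
  fixes M :: "'a::field set"
  assumes S: "subring_set S" "\<And>a. a \<in> S \<Longrightarrow> inverse a \<in> S" and M: "module_finite S M" and x: "x \<in> M" "x \<noteq> 0"
  shows "inverse x \<in> M"
proof -
  have sub: "subring_set M" and SM: "S \<subseteq> M" using M by (auto simp: module_finite_def)
  obtain n a where a: "\<forall>i<n. a i \<in> S" "x ^ n = (\<Sum>i<n. a i * x ^ i)"
    using module_finite_imp_integral[OF S(1) M x(1)] unfolding integral_over_def by blast
  define P where "P k \<longleftrightarrow> (\<exists>a. (\<forall>i<k. a i \<in> S) \<and> x ^ k = (\<Sum>i<k. a i * x ^ i))" for k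
  have "P n" unfolding P_def using a by blast
  define k where "k = (LEAST k. P k)"
  have k: "P k" "\<And>j. j < k \<Longrightarrow> \<not> P j"
    unfolding k_def using \<open>P n\<close> by (auto intro: LeastI dest: not_less_Least)
  then obtain c where c: "\<And>i. i < k \<Longrightarrow> c i \<in> S" "x ^ k = (\<Sum>i<k. c i * x ^ i)"
    unfolding P_def by blast
  have "k \<noteq> 0" using c(2) by (cases k) auto
  then obtain m where m: "k = Suc m" by (cases k) auto
  define s where "s = (\<Sum>i<m. c (Suc i) * x ^ i)"
  have eq: "x * x ^ m = c 0 + x * s"
    using c(2) unfolding m sum.lessThan_Suc_shift s_def by (simp add: sum_distrib_left mult.left_commute)
  have "c 0 \<noteq> 0"
  proof
    assume "c 0 = 0"
    then have "x ^ m = s" using eq x(2) by simp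
    then have "P m" unfolding P_def s_def using c(1) m by (intro exI[of _ "\<lambda>i. c (Suc i)"]) auto
    then show False using k(2) m by simp
  qed
  have "x * (x ^ m - s) = c 0" using eq by (simp add: right_diff_distrib)
  then have "x * ((x ^ m - s) * inverse (c 0)) = 1"
    using \<open>c 0 \<noteq> 0\<close> by (simp add: mult.assoc[symmetric])
  then have inv: "inverse x = (x ^ m - s) * inverse (c 0)"
    using x(2) by (metis inverse_unique)
  have "s \<in> M"
    unfolding s_def using c(1) m SM x(1)
    by (intro subring_set_sum[OF sub] subring_setD(6)[OF sub] subring_set_power[OF sub]) auto
  moreover have "inverse (c 0) \<in> M" using S(2)[OF c(1)[of 0]] m SM by auto
  ultimately show ?thesis
    unfolding inv by (intro subring_setD(5,6)[OF sub] subring_set_power[OF sub] x(1))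
qed


section \<open>Discrete valuation rings\<close>

text \<open>The valuation is encoded by the factorization of the nonzero field elements into a unit
  and a power of \<open>\<pi>\<close>; that \<open>\<pi>\<close> is not a unit makes the exponent
  unique.\<close>

locale dvr =
  fixes V :: "'a::field set" and \<pi> :: 'a
  assumes sub: "subring_set V" and pi_mem: "\<pi> \<in> V" and pi_nz: "\<pi> \<noteq> 0" and pi_nonunit: "inverse \<pi> \<notin> V"
    and decomp: "x \<noteq> 0 \<Longrightarrow> \<exists>u e. u \<in> V \<and> inverse u \<in> V \<and> x = u * \<pi> powi e"
begin

lemmas V_rules = subring_setD[OF sub]

lemma powi_mem_iff: "\<pi> powi e \<in> V \<longleftrightarrow> e \<ge> 0"
proof
  assume e: "\<pi> powi e \<in> V"
  show "e \<ge> 0"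
  proof (rule ccontr)
    assume "\<not> e \<ge> 0"
    then have "nat (- e - 1) = - e - 1" by simp
    \<comment> \<open>A negative power of \<open>\<pi>\<close> in \<open>V\<close> can be multiplied
      up to exponent -1, which is excluded.\<close>
    then have "\<pi> powi e * \<pi> ^ nat (- e - 1) = \<pi> powi (e + (- e - 1))"
      using pi_nz by (metis power_int_add power_int_of_nat)
    also have "\<dots> = inverse \<pi>" by (simp add: power_int_minus)
    finally show False
      using V_rules(6)[OF e subring_set_power[OF sub pi_mem, of "nat (- e - 1)"]] pi_nonunit by simp
  qed
next
  assume "e \<ge> 0"
  then have "\<pi> powi e = \<pi> ^ nat e" by (metis nat_0_le power_int_of_nat)
  then show "\<pi> powi e \<in> V" using subring_set_power[OF sub pi_mem] by simp
qed

definition val :: "'a \<Rightarrow> int"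
  where "val x = (SOME e. \<exists>u. u \<in> V \<and> inverse u \<in> V \<and> x = u * \<pi> powi e)"

lemma val_decomp:
  assumes "x \<noteq> 0"
  obtains u where "u \<in> V" "inverse u \<in> V" "x = u * \<pi> powi val x"
proof -
  have "\<exists>e u. u \<in> V \<and> inverse u \<in> V \<and> x = u * \<pi> powi e" using decomp[OF assms] by blast
  from someI_ex[OF this] show ?thesis using that unfolding val_def by blast
qed

text \<open>The power of \<open>\<pi>\<close> with exponent \<open>e - e'\<close> equals
  \<open>u' * inverse u\<close> and so lies in \<open>V\<close>.\<close>

lemma unit_powi_le:
  assumes "x \<noteq> 0" "x = u * \<pi> powi e" "x = u' * \<pi> powi e'" "inverse u \<in> V" "u' \<in> V"
  shows "e' \<le> e"
proof -
  have "u \<noteq> 0" using assms by auto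
  have "\<pi> powi (e - e') = u' * inverse u"
    using assms(2,3) \<open>u \<noteq> 0\<close> pi_nz by (simp add: power_int_diff field_simps)
  then have "\<pi> powi (e - e') \<in> V" using V_rules(6)[OF assms(5,4)] by simp
  then show ?thesis by (simp add: powi_mem_iff)
qed

lemma val_unique:
  assumes "x \<noteq> 0" "u \<in> V" "inverse u \<in> V" "x = u * \<pi> powi e"
  shows "val x = e"
proof -
  obtain u' where u': "u' \<in> V" "inverse u' \<in> V" "x = u' * \<pi> powi val x"
    using val_decomp[OF assms(1)] .
  show ?thesis
    using unit_powi_le[OF assms(1,4) u'(3) assms(3) u'(1)] unit_powi_le[OF assms(1) u'(3) assms(4) u'(2) assms(2)]
    by simp
qed

lemma val_mult: "x \<noteq> 0 \<Longrightarrow> y \<noteq> 0 \<Longrightarrow> val (x * y) = val x + val y"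
proof -
  assume nz: "x \<noteq> 0" "y \<noteq> 0"
  obtain u where u: "u \<in> V" "inverse u \<in> V" "x = u * \<pi> powi val x" using val_decomp[OF nz(1)] .
  obtain u' where u': "u' \<in> V" "inverse u' \<in> V" "y = u' * \<pi> powi val y" using val_decomp[OF nz(2)] .
  have "x * y = (u * u') * (\<pi> powi val x * \<pi> powi val y)"
    by (subst u(3), subst u'(3)) (simp only: mult_ac)
  then have "x * y = (u * u') * \<pi> powi (val x + val y)"
    using pi_nz by (simp add: power_int_add)
  moreover have "inverse (u * u') \<in> V"
    using V_rules(6)[OF u(2) u'(2)] by (simp add: inverse_mult_distrib)
  ultimately show ?thesis
    using nz pi_nz V_rules(6)[OF u(1) u'(1)] by (intro val_unique[of _ "u * u'"]) auto
qed

lemma val_1 [simp]: "val 1 = 0"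
  by (rule val_unique[of _ 1]) (auto intro: V_rules)

lemma val_pi [simp]: "val \<pi> = 1"
  using pi_nz by (intro val_unique[of _ 1]) (auto intro: V_rules)

lemma val_power: "x \<noteq> 0 \<Longrightarrow> val (x ^ n) = int n * val x"
  by (induction n) (simp_all add: val_mult algebra_simps)

lemma val_inverse: "x \<noteq> 0 \<Longrightarrow> val (inverse x) = - val x"
  using val_mult[of x "inverse x"] by simp

lemma val_powi: "x \<noteq> 0 \<Longrightarrow> val (x powi e) = e * val x"
  by (cases e rule: int_cases2) (simp_all add: val_power val_inverse power_int_minus)

lemma mem_iff_val: "x \<noteq> 0 \<Longrightarrow> x \<in> V \<longleftrightarrow> val x \<ge> 0"
proof -
  assume nz: "x \<noteq> 0"
  obtain u where u: "u \<in> V" "inverse u \<in> V" "x = u * \<pi> powi val x" using val_decomp[OF nz] .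
  have "u \<noteq> 0" using u nz by auto
  then have "\<pi> powi val x = x * inverse u" by (subst u(3)) simp
  then have "x \<in> V \<Longrightarrow> \<pi> powi val x \<in> V" using V_rules(6)[OF _ u(2)] by simp
  moreover have "\<pi> powi val x \<in> V \<Longrightarrow> x \<in> V" by (subst u(3)) (rule V_rules(6)[OF u(1)])
  ultimately show ?thesis by (auto simp: powi_mem_iff)
qed

lemma max_ideal_iff_val: "x \<noteq> 0 \<Longrightarrow> x \<in> max_ideal V \<longleftrightarrow> val x > 0"
  using mem_iff_val[of x] mem_iff_val[of "inverse x"] by (auto simp: max_ideal_def val_inverse)

lemma zero_in_max_ideal: "0 \<in> max_ideal V"
  by (auto simp: max_ideal_def intro: V_rules)

lemma max_ideal_eq: "max_ideal V = {\<pi> * y | y. y \<in> V}"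
proof (intro equalityI subsetI)
  fix x assume x: "x \<in> max_ideal V"
  show "x \<in> {\<pi> * y | y. y \<in> V}"
  proof (cases "x = 0")
    case True
    then show ?thesis using V_rules(1) by auto
  next
    case False
    then have "val (x * inverse \<pi>) \<ge> 0" using x pi_nz by (simp add: max_ideal_iff_val val_mult val_inverse)
    then have "x * inverse \<pi> \<in> V" using False pi_nz by (subst mem_iff_val) auto
    then show ?thesis using pi_nz by (intro CollectI exI[of _ "x * inverse \<pi>"]) auto
  qed
next
  fix x assume "x \<in> {\<pi> * y | y. y \<in> V}"
  then obtain y where y: "x = \<pi> * y" "y \<in> V" by blast
  show "x \<in> max_ideal V"
  proof (cases "y = 0")
    case False
    then show ?thesis using y pi_nz mem_iff_val[of y] by (simp add: max_ideal_iff_val val_mult)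
  qed (simp add: y(1) zero_in_max_ideal)
qed

lemma uniformizer_pi: "uniformizer V \<pi>"
  by (simp add: uniformizer_def max_ideal_eq)

text \<open>Two generators of the maximal ideal divide each other, so their valuations
  agree.\<close>

lemma val_uniformizer:
  assumes "uniformizer V \<rho>"
  shows "\<rho> \<noteq> 0" "val \<rho> = 1"
proof -
  have eq: "{\<rho> * y | y. y \<in> V} = {\<pi> * y | y. y \<in> V}"
    using assms by (simp add: uniformizer_def max_ideal_eq)
  have "\<pi> * 1 \<in> {\<rho> * y | y. y \<in> V}" unfolding eq using V_rules(2) by blast
  then obtain y where y: "\<pi> = \<rho> * y" "y \<in> V" by auto
  have "\<rho> * 1 \<in> {\<pi> * y | y. y \<in> V}" unfolding eq[symmetric] using V_rules(2) by blast
  then obtain z where z: "\<rho> = \<pi> * z" "z \<in> V" by auto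
  show nz: "\<rho> \<noteq> 0" using y(1) pi_nz by auto
  have y0: "y \<noteq> 0" using y(1) pi_nz by auto
  have z0: "z \<noteq> 0" using z(1) nz by auto
  have "val \<pi> = val \<rho> + val y" using val_mult[OF nz y0] by (simp only: y(1)[symmetric])
  moreover have "val \<rho> = val \<pi> + val z" using val_mult[OF pi_nz z0] by (simp only: z(1)[symmetric])
  moreover have "val y \<ge> 0" "val z \<ge> 0" using y(2) z(2) mem_iff_val[OF y0] mem_iff_val[OF z0] by blast+
  ultimately show "val \<rho> = 1" by simp
qed

text \<open>\<open>ord_at\<close> ranges over all uniformizers, so the uniqueness of its exponent
  uses that each of them has valuation 1.\<close>

lemma ord_at_eq: "x \<noteq> 0 \<Longrightarrow> ord_at V x = Fin (val x)"
proof -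
  assume nz: "x \<noteq> 0"
  have "(THE e. \<exists>\<rho> u. uniformizer V \<rho> \<and> u \<in> V \<and> inverse u \<in> V \<and> x = u * \<rho> powi e) = val x"
  proof (rule the_equality)
    obtain u where "u \<in> V" "inverse u \<in> V" "x = u * \<pi> powi val x" using val_decomp[OF nz] .
    then show "\<exists>\<rho> u. uniformizer V \<rho> \<and> u \<in> V \<and> inverse u \<in> V \<and> x = u * \<rho> powi val x"
      using uniformizer_pi by blast
  next
    fix e assume "\<exists>\<rho> u. uniformizer V \<rho> \<and> u \<in> V \<and> inverse u \<in> V \<and> x = u * \<rho> powi e"
    then obtain \<rho> u where *: "uniformizer V \<rho>" "u \<in> V" "inverse u \<in> V" "x = u * \<rho> powi e" by blast
    then have "u \<noteq> 0" using nz by auto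
    then have "val u \<ge> 0" "val (inverse u) \<ge> 0"
      using * mem_iff_val[of u] mem_iff_val[of "inverse u"] by auto
    then have "val u = 0" using \<open>u \<noteq> 0\<close> by (simp add: val_inverse)
    then show "e = val x"
      using *(4) \<open>u \<noteq> 0\<close> val_uniformizer[OF *(1)] by (simp add: val_mult val_powi power_int_eq_0_iff)
  qed
  then show ?thesis using nz by (simp add: ord_at_def)
qed

end

text \<open>A non-unit in \<open>V\<close> is divisible by \<open>\<pi>\<close>. Dividing repeatedly
  comes to an end, because the element divides some \<open>\<pi> ^ k\<close> and each division
  lowers \<open>k\<close>.\<close>

lemma dvrI:
  assumes sub: "subring_set V" and frac: "\<And>x. \<exists>a\<in>V. \<exists>b\<in>V. b \<noteq> 0 \<and> x = a / b"
    and max: "max_ideal V = {\<pi> * y | y. y \<in> V}" and nz: "\<pi> \<noteq> 0"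
    and arch: "\<And>y. y \<in> V \<Longrightarrow> y \<noteq> 0 \<Longrightarrow> \<exists>k. \<exists>z\<in>V. \<pi> ^ k = y * z"
  shows "dvr V \<pi>"
proof -
  note V = subring_setD[OF sub]
  have "\<pi> * 1 \<in> max_ideal V" unfolding max using V(2) by blast
  then have pi: "\<pi> \<in> V" "inverse \<pi> \<notin> V" using nz by (auto simp: max_ideal_def)
  have dec: "\<exists>u e. u \<in> V \<and> inverse u \<in> V \<and> y = u * \<pi> ^ e" if "y \<in> V" "z \<in> V" "\<pi> ^ k = y * z" for k y z
    using that
  proof (induction k arbitrary: y)
    case 0
    then have "y * z = 1" by simp
    then have "inverse y = z" by (rule inverse_unique)
    then show ?case using 0 by (intro exI[of _ y] exI[of _ 0]) auto
  next
    case (Suc k)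
    show ?case
    proof (cases "inverse y \<in> V")
      case True
      then show ?thesis using Suc by (intro exI[of _ y] exI[of _ 0]) auto
    next
      case False
      then have "y \<in> max_ideal V" using Suc by (simp add: max_ideal_def)
      then obtain y1 where y1: "y = \<pi> * y1" "y1 \<in> V" unfolding max by blast
      have "\<pi> * \<pi> ^ k = \<pi> * (y1 * z)" using Suc.prems(3) y1(1) by (simp add: mult.assoc)
      then have "\<pi> ^ k = y1 * z" using nz by (metis mult_cancel_left)
      then obtain u e where "u \<in> V" "inverse u \<in> V" "y1 = u * \<pi> ^ e"
        using Suc.IH[OF y1(2) Suc.prems(2)] by blast
      then show ?thesis unfolding y1(1) by (intro exI[of _ u] exI[of _ "Suc e"]) (simp add: mult.left_commute)
    qed
  qed
  have dec': "\<exists>u e. u \<in> V \<and> inverse u \<in> V \<and> y = u * \<pi> ^ e" if y: "y \<in> V" "y \<noteq> 0" for y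
  proof -
    obtain k z where "z \<in> V" "\<pi> ^ k = y * z" using arch[OF y] by blast
    then show ?thesis using dec[OF y(1)] by blast
  qed
  show ?thesis
  proof
    fix x :: 'a assume "x \<noteq> 0"
    obtain a b where ab: "a \<in> V" "b \<in> V" "b \<noteq> 0" "x = a / b" using frac[of x] by blast
    then have "a \<noteq> 0" using \<open>x \<noteq> 0\<close> by auto
    obtain u e where u: "u \<in> V" "inverse u \<in> V" "a = u * \<pi> ^ e" using dec'[OF ab(1) \<open>a \<noteq> 0\<close>] by blast
    obtain u' e' where u': "u' \<in> V" "inverse u' \<in> V" "b = u' * \<pi> ^ e'" using dec'[OF ab(2,3)] by blast
    have "x = (u * inverse u') * \<pi> powi (int e - int e')"
      unfolding ab(4) u(3) u'(3) using nz by (simp add: power_int_diff divide_inverse)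
    moreover have "u * inverse u' \<in> V" by (intro V u u')
    moreover have "inverse (u * inverse u') \<in> V"
      using V(6)[OF u(2) u'(1)] by (simp add: inverse_mult_distrib)
    ultimately show "\<exists>u e. u \<in> V \<and> inverse u \<in> V \<and> x = u * \<pi> powi e" by blast
  qed (use sub pi nz in auto)
qed


section \<open>Local rings of curves\<close>

lemma subfield_type_algebraD:
  assumes "subfield k (ring_of_type_algebra :: 'a::field ring)"
  shows "subring_set k" "\<And>a. a \<in> k \<Longrightarrow> inverse a \<in> k"
proof -
  interpret R: Ring.field "ring_of_type_algebra :: 'a ring" by (rule field_from_type_algebra)
  have simps: "x \<otimes>\<^bsub>ring_of_type_algebra\<^esub> y = x * y" "x \<oplus>\<^bsub>ring_of_type_algebra\<^esub> y = x + y"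
    "\<one>\<^bsub>ring_of_type_algebra\<^esub> = 1" "\<zero>\<^bsub>ring_of_type_algebra\<^esub> = 0"
    "carrier ring_of_type_algebra = UNIV" for x y :: 'a
    by (simp_all add: ring_of_type_algebra_def)
  note k = subringE[OF subfieldE(1)[OF assms], unfolded simps]
  have neg: "\<ominus>\<^bsub>ring_of_type_algebra\<^esub> a = - a" for a :: 'a
    using R.r_neg[of a] unfolding simps by (simp add: eq_neg_iff_add_eq_0 add.commute)
  show "subring_set k"
    unfolding subring_set_def
  proof (intro conjI ballI)
    fix a b assume ab: "a \<in> k" "b \<in> k"
    show "a - b \<in> k" using k(7)[OF ab(1) k(5)[OF ab(2)]] by (simp add: neg)
    show "a * b \<in> k" by (rule k(6)[OF ab])
  qed (rule k(3))
  show "inverse a \<in> k" if "a \<in> k" for a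
  proof (cases "a = 0")
    case False
    then have "a \<in> k - {\<zero>\<^bsub>ring_of_type_algebra\<^esub>}" using that by (simp add: simps)
    from R.subfield_m_inv(1,2)[OF assms this] show ?thesis
      unfolding simps by (metis DiffD1 inverse_unique)
  qed (use k(2) in simp)
qed

text \<open>\<open>a\<close> is the lowest nonzero coefficient. At a nonzero root \<open>z\<close>
  the formula exhibits it as a multiple of \<open>z\<close>, which is how relations become
  divisibilities below.\<close>

lemma poly_low_order:
  fixes p :: "'a::comm_ring_1 poly"
  assumes "p \<noteq> 0" "\<And>i. coeff p i \<in> S"
  shows "\<exists>j a h. a \<noteq> 0 \<and> a \<in> S \<and> (\<forall>i. coeff h i \<in> S) \<and> (\<forall>z. poly p z = z ^ j * (a + z * poly h z))"
proof -
  define j where "j = (LEAST i. coeff p i \<noteq> 0)"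
  have "coeff p (degree p) \<noteq> 0" using assms(1) by simp
  then have j: "coeff p j \<noteq> 0" "\<And>i. i < j \<Longrightarrow> coeff p i = 0"
    unfolding j_def using LeastI[of "\<lambda>i. coeff p i \<noteq> 0" "degree p"] by (blast dest: not_less_Least)+
  define g where "g = poly_shift j p"
  have g: "coeff g i = coeff p (i + j)" for i by (simp add: g_def coeff_poly_shift)
  have p: "p = monom 1 j * g"
    by (rule poly_eqI) (auto simp: coeff_monom_mult g j(2))
  obtain a h where h: "g = pCons a h" by (rule pCons_cases)
  have "a = coeff g 0" "\<And>i. coeff h i = coeff g (Suc i)" by (simp_all add: h)
  then have "a \<noteq> 0" "a \<in> S" "\<forall>i. coeff h i \<in> S" using j(1) assms(2) by (simp_all add: g)
  moreover have "\<forall>z. poly p z = z ^ j * (a + z * poly h z)"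
    by (simp add: p h poly_monom algebra_simps)
  ultimately show ?thesis by blast
qed

lemma subring_set_poly_values:
  assumes k: "subring_set k"
  shows "subring_set {poly f z | f. \<forall>i. coeff f i \<in> k}"
  unfolding subring_set_def
proof (intro conjI ballI)
  note P = subring_set_polys[OF k]
  show "1 \<in> {poly f z | f. \<forall>i. coeff f i \<in> k}"
    using subring_setD(2)[OF P] by (intro CollectI exI[of _ 1]) auto
  fix a b assume "a \<in> {poly f z | f. \<forall>i. coeff f i \<in> k}" "b \<in> {poly f z | f. \<forall>i. coeff f i \<in> k}"
  then obtain f g where fg: "a = poly f z" "\<forall>i. coeff f i \<in> k" "b = poly g z" "\<forall>i. coeff g i \<in> k" by blast
  show "a - b \<in> {poly f z | f. \<forall>i. coeff f i \<in> k}"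
    using subring_setD(5)[OF P, of f g] fg by (intro CollectI exI[of _ "f - g"]) auto
  show "a * b \<in> {poly f z | f. \<forall>i. coeff f i \<in> k}"
    using subring_setD(6)[OF P, of f g] fg by (intro CollectI exI[of _ "f * g"]) auto
qed

lemma const_in_poly_values:
  assumes "subring_set k" "c \<in> k"
  shows "c \<in> {poly f z | f. \<forall>i. coeff f i \<in> k}"
  using assms subring_setD(1)[OF assms(1)]
  by (intro CollectI exI[of _ "[:c:]"]) (auto simp: coeff_pCons split: nat.splits)

section \<open>Fractions and algebraic dependence\<close>

definition fractions :: "'a::field set \<Rightarrow> 'a set"
  where "fractions S = {a / b | a b. a \<in> S \<and> b \<in> S \<and> b \<noteq> 0}"

lemma subring_set_fractions:
  assumes S: "subring_set S"
  shows "subring_set (fractions S)" "S \<subseteq> fractions S" "\<And>a. a \<in> fractions S \<Longrightarrow> inverse a \<in> fractions S"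
proof -
  note S' = subring_setD[OF S]
  have I: "x \<in> fractions S" if "x = a / b" "a \<in> S" "b \<in> S" "b \<noteq> 0" for x a b
    using that by (auto simp: fractions_def)
  show sub: "S \<subseteq> fractions S" using I[of _ _ 1] S'(2) by auto
  show "subring_set (fractions S)"
    unfolding subring_set_def
  proof (intro conjI ballI)
    show "1 \<in> fractions S" using sub S'(2) by blast
    fix x y assume "x \<in> fractions S" "y \<in> fractions S"
    then obtain a b c d where *: "x = a / b" "a \<in> S" "b \<in> S" "b \<noteq> 0" "y = c / d" "c \<in> S" "d \<in> S" "d \<noteq> 0"
      unfolding fractions_def by blast
    show "x - y \<in> fractions S"
      using * by (intro I[of _ "a * d - c * b" "b * d"] S') (auto simp: field_simps)
    show "x * y \<in> fractions S"
      using * by (intro I[of _ "a * c" "b * d"] S') auto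
  qed
  show "inverse x \<in> fractions S" if x: "x \<in> fractions S" for x
  proof (cases "x = 0")
    case True
    then show ?thesis using sub S'(1) by auto
  next
    case False
    obtain a b where "x = a / b" "a \<in> S" "b \<in> S" "b \<noteq> 0" using x unfolding fractions_def by blast
    then show ?thesis using False by (intro I[of _ b a]) auto
  qed
qed

lemma integral_over_of_root:
  fixes Q :: "'a::field poly"
  assumes M: "subring_set M" and "inverse (lead_coeff Q) \<in> M" "\<And>i. coeff Q i \<in> M" "Q \<noteq> 0" "poly Q z = 0"
  shows "integral_over M z"
proof -
  define P where "P = smult (inverse (lead_coeff Q)) Q"
  have P: "lead_coeff P = 1" "poly P z = 0" using assms(4,5) by (simp_all add: P_def)
  have "- coeff P i \<in> M" for i
    using assms(2,3) by (auto simp: P_def intro!: subring_setD(3,6)[OF M])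
  then show ?thesis
    unfolding integral_over_def using monic_poly_root[OF P]
    by (intro exI[of _ "degree P"] exI[of _ "\<lambda>i. - coeff P i"]) auto
qed

lemma common_denominator:
  assumes S: "subring_set S" and "\<And>i. i < (n::nat) \<Longrightarrow> a i \<in> fractions S"
  shows "\<exists>D\<in>S. D \<noteq> 0 \<and> (\<forall>i<n. D * a i \<in> S)"
  using assms(2)
proof (induction n)
  case 0
  then show ?case using subring_setD(2)[OF S] by (intro bexI[of _ 1]) auto
next
  case (Suc n)
  then obtain D where D: "D \<in> S" "D \<noteq> 0" "\<forall>i<n. D * a i \<in> S" by auto
  obtain b c where bc: "a n = b / c" "b \<in> S" "c \<in> S" "c \<noteq> 0"
    using Suc.prems[of n] unfolding fractions_def by blast
  have "D * c * a i \<in> S" if "i < Suc n" for i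
  proof (cases "i = n")
    case True
    then show ?thesis using bc subring_setD(6)[OF S D(1) bc(2)] by simp
  next
    case False
    then have "D * a i \<in> S" using D that by simp
    from subring_setD(6)[OF S this bc(3)] show ?thesis by (simp add: mult_ac)
  qed
  then show ?case
    using D bc subring_setD(6)[OF S D(1) bc(3)] by (intro bexI[of _ "D * c"]) auto
qed

text \<open>The exchange argument for transcendence bases: a relation between \<open>s\<close> and
  \<open>t\<close> makes \<open>t\<close> algebraic over \<open>k(s)\<close>, and then everything
  algebraic over \<open>k(t)\<close> is algebraic over \<open>k(s)\<close> by transitivity.\<close>

lemma algebraic_exchange:
  fixes k :: "'a::field set"
  assumes k: "subring_set k"
    and t: "\<And>y. algebraic_over {poly f t | f. \<forall>i. coeff f i \<in> k} y"
    and s: "\<not> algebraic_over k s"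
  shows "algebraic_over {poly f s | f. \<forall>i. coeff f i \<in> k} y"
proof -
  define K0 where "K0 = {poly f s | f. \<forall>i. coeff f i \<in> k}"
  define F0 where "F0 = fractions K0"
  have K0: "subring_set K0" unfolding K0_def by (rule subring_set_poly_values[OF k])
  note F0 = subring_set_fractions[OF K0, folded F0_def]
  have kK0: "c \<in> K0" if "c \<in> k" for c unfolding K0_def by (rule const_in_poly_values[OF k that])
  have K0I: "poly f s \<in> K0" if "\<And>i. coeff f i \<in> k" for f using that unfolding K0_def by blast
  have "integral_over F0 t"
  proof -
    obtain p where p: "p \<noteq> 0" "\<And>i. coeff p i \<in> {poly f t | f. \<forall>i. coeff f i \<in> k}" "poly p s = 0"
      using t[of s] unfolding algebraic_over_def by blast
    have "\<forall>i. \<exists>f. coeff p i = poly f t \<and> (\<forall>j. coeff f j \<in> k)" using p(2) by blast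
    from choice[OF this] obtain f where f: "\<And>i. coeff p i = poly (f i) t" "\<And>i j. coeff (f i) j \<in> k" by blast
    \<comment> \<open>The relation for \<open>s\<close> with coefficients in \<open>k[t]\<close> is
      reordered by powers of \<open>t\<close>; its coefficients become polynomials in
      \<open>s\<close>.\<close>
    define Q where "Q = (\<Sum>i\<le>degree p. smult (s ^ i) (f i))"
    have "poly Q t = poly p s"
      by (simp add: Q_def poly_sum poly_altdef[of p] f(1) mult.commute)
    then have root: "poly Q t = 0" using p(3) by simp
    have cQ: "coeff Q j = poly (\<Sum>i\<le>degree p. monom (coeff (f i) j) i) s" for j
      by (simp add: Q_def coeff_sum poly_sum poly_monom mult.commute)
    have cg: "coeff (\<Sum>i\<le>degree p. monom (coeff (f i) j) i) l = (if l \<le> degree p then coeff (f l) j else 0)" for j l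
      by (simp add: coeff_sum)
    have QK0: "coeff Q j \<in> K0" for j
      unfolding cQ by (rule K0I) (auto simp: cg f(2) intro: subring_setD(1)[OF k])
    \<comment> \<open>Some power of \<open>t\<close> gets as coefficient a nonzero polynomial over
      \<open>k\<close>, evaluated at \<open>s\<close>; as \<open>s\<close> is transcendental, this
      value is not 0.\<close>
    have "poly (f (degree p)) t \<noteq> 0" using p(1) by (simp flip: f(1))
    then have "f (degree p) \<noteq> 0" by auto
    then obtain j where "coeff (f (degree p)) j \<noteq> 0" by (metis leading_coeff_0_iff)
    then have "(\<Sum>i\<le>degree p. monom (coeff (f i) j) i) \<noteq> 0"
      using cg[of j "degree p"] by (metis coeff_0 order_refl)
    moreover have "\<forall>l. coeff (\<Sum>i\<le>degree p. monom (coeff (f i) j) i) l \<in> k"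
      by (auto simp: cg f(2) intro: subring_setD(1)[OF k])
    ultimately have "coeff Q j \<noteq> 0" using s unfolding cQ algebraic_over_def by blast
    then have "Q \<noteq> 0" by auto
    then show ?thesis
      using F0 QK0 root by (intro integral_over_of_root[of F0 Q]) auto
  qed
  then obtain M where M: "module_finite F0 M" "t \<in> M"
    using module_finite_adjoin[OF F0(1) module_finite_refl[OF F0(1)]] by blast
  have subM: "subring_set M" and F0M: "F0 \<subseteq> M" using M(1) by (auto simp: module_finite_def)
  have ktM: "poly f t \<in> M" if "\<forall>i. coeff f i \<in> k" for f
    using that kK0 F0(2) F0M M(2) by (intro poly_mem[OF subM]) auto
  obtain p where p: "p \<noteq> 0" "\<And>i. coeff p i \<in> {poly f t | f. \<forall>i. coeff f i \<in> k}" "poly p y = 0"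
    using t[of y] unfolding algebraic_over_def by blast
  have pM: "coeff p i \<in> M" for i using p(2)[of i] ktM by auto
  \<comment> \<open>\<open>M\<close> is finite over the field \<open>F0\<close> and hence closed
    under inverses, so the equation for \<open>y\<close> can be made monic.\<close>
  have "inverse (lead_coeff p) \<in> M"
    using p(1) by (intro module_finite_inverse[OF F0(1,3) M(1) pM]) auto
  then have "integral_over M y"
    using p pM by (intro integral_over_of_root[OF subM, of p]) auto
  then obtain M' where "module_finite F0 M'" "y \<in> M'"
    using module_finite_adjoin[OF F0(1) M(1)] by blast
  then have "integral_over F0 y" by (rule module_finite_imp_integral[OF F0(1)])
  then obtain n a where a: "\<And>i. i < n \<Longrightarrow> a i \<in> F0" "y ^ n = (\<Sum>i<n. a i * y ^ i)"
    unfolding integral_over_def by blast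
  obtain D where D: "D \<in> K0" "D \<noteq> 0" "\<forall>i<n. D * a i \<in> K0"
    using common_denominator[OF K0, of n a] a(1) unfolding F0_def by blast
  \<comment> \<open>The common denominator \<open>D\<close> brings the monic equation over
    \<open>k(s)\<close> back to \<open>k[s]\<close>.\<close>
  define q where "q = monom D n - (\<Sum>i<n. monom (D * a i) i)"
  have cq: "coeff q i = (if i = n then D else if i < n then - (D * a i) else 0)" for i
    by (auto simp: q_def coeff_sum)
  have "poly q y = D * (y ^ n - (\<Sum>i<n. a i * y ^ i))"
    by (simp add: q_def poly_sum poly_monom right_diff_distrib sum_distrib_left mult.assoc)
  then have "poly q y = 0" using a(2) by simp
  moreover have "q \<noteq> 0" using cq[of n] D(2) by auto
  moreover have "coeff q i \<in> K0" for i
    using D subring_setD(1,3)[OF K0] by (auto simp: cq)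
  ultimately show ?thesis unfolding algebraic_over_def K0_def[symmetric] by blast
qed

section \<open>The local ring at a closed point of a curve\<close>

lemma forms_iff:
  assumes "0 \<in> k"
  shows "G \<in> forms k n d \<longleftrightarrow> G \<in> forms UNIV n d \<and> (\<forall>\<alpha>. Poly_Mapping.lookup G \<alpha> \<in> k)"
  using assms by (auto simp: forms_def in_keys_iff)

lemma forms_subring:
  fixes k :: "'a::comm_ring_1 set"
  assumes k: "subring_set k"
  shows "1 \<in> forms k n 0" "c \<in> k \<Longrightarrow> mconst c \<in> forms k n 0" "i \<le> n \<Longrightarrow> mvar i ^ e \<in> forms k n e"
    "G \<in> forms k n d \<Longrightarrow> H \<in> forms k n d \<Longrightarrow> G - H \<in> forms k n d"
    "G \<in> forms k n d \<Longrightarrow> H \<in> forms k n e \<Longrightarrow> G * H \<in> forms k n (d + e)"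
proof -
  note k' = subring_setD[OF k]
  note iff = forms_iff[OF k'(1)]
  show one: "1 \<in> forms k n 0"
    unfolding iff using forms_1 k'(1,2) by (auto simp: lookup_one when_def)
  show "mconst c \<in> forms k n 0" if "c \<in> k"
    unfolding iff using forms_mconst_mult[OF forms_1, of c n] that k'(1)
    by (auto simp: lookup_single when_def)
  show "G - H \<in> forms k n d" if "G \<in> forms k n d" "H \<in> forms k n d"
  proof -
    have "mconst (- 1) * H \<in> forms UNIV n d" using that(2) unfolding iff by (intro forms_mconst_mult) auto
    then have "- H \<in> forms UNIV n d" by (simp add: single_uminus)
    then have "G - H \<in> forms UNIV n d" using forms_add[of G n d "- H"] that unfolding iff by simp
    then show ?thesis using that k'(5) unfolding iff by (auto simp: lookup_minus)
  qed
  show mult: "G * H \<in> forms k n (d + e)" if "G \<in> forms k n d" "H \<in> forms k n e" for G H d e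
  proof -
    have "Poly_Mapping.lookup (G * H) \<gamma> \<in> k" for \<gamma>
    proof -
      have "G * H = (\<Sum>\<mu>\<in>Poly_Mapping.keys G. Poly_Mapping.single \<mu> (Poly_Mapping.lookup G \<mu>) * H)"
        by (subst (1) mpol_sum_monomials[symmetric]) (rule sum_distrib_right)
      then show ?thesis
        using that k' unfolding iff
        by (simp add: lookup_sum lookup_single_mult when_def) (intro subring_set_sum[OF k], simp)+
    qed
    then show ?thesis using that forms_mult[of G n d H e] unfolding iff by blast
  qed
  have mvar: "(mvar i :: (nat, 'a) mpol) \<in> forms k n 1" if "i \<le> n"
    unfolding iff using forms_mvar[OF that] k'(1,2) by (auto simp: lookup_single when_def simp del: One_nat_def)
  show "(mvar i :: (nat, 'a) mpol) ^ e \<in> forms k n e" if "i \<le> n"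
  proof (induction e)
    case 0
    show ?case using one by simp
  next
    case (Suc e)
    from mult[OF mvar[OF that] Suc] show ?case by (simp only: power_Suc plus_1_eq_Suc)
  qed
qed

text \<open>Nonsingularity provides the uniformizer. A nonzero element \<open>y\<close> of the ring
  divides one of its powers: \<open>\<pi>\<close> is transcendental over \<open>k\<close>, so
  \<open>y\<close> is algebraic over \<open>k[\<pi>]\<close>, and the lowest coefficient of an
  equation for \<open>y\<close> is both a multiple of \<open>y\<close> and a unit times a power of
  \<open>\<pi>\<close>.\<close>

lemma curve_dvr:
  fixes x :: "nat \<Rightarrow> 'a::field"
  assumes curve: "nonsingular_curve k m x" and P: "P \<in> curve_points k m x"
  shows "\<exists>\<pi>. dvr (curve_local_ring k m x P) \<pi>"
proof -
  define V where "V = curve_local_ring k m x P"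
  have sf: "subfield k ring_of_type_algebra" and gen: "generic_point k m x" and tr: "trdeg_one k"
    using curve by (auto simp: nonsingular_curve_def alg_closed_subfield_def)
  obtain \<pi> where unif: "uniformizer V \<pi>" using curve P unfolding nonsingular_curve_def V_def by blast
  note k = subfield_type_algebraD[OF sf]
  note k' = subring_setD[OF k(1)]
  note kf = forms_subring[OF k(1)]
  have id: "comm_ring_hom (id :: 'a \<Rightarrow> 'a)" by unfold_locales simp_all
  define ex where "ex = (mp_eval id x :: (nat, 'a) mpol \<Rightarrow> 'a)"
  define eP where "eP = (mp_eval id P :: (nat, 'a) mpol \<Rightarrow> 'a)"
  interpret ex: comm_ring_hom ex unfolding ex_def by (rule comm_ring_hom.comm_ring_hom_mp_eval[OF id])
  interpret eP: comm_ring_hom eP unfolding eP_def by (rule comm_ring_hom.comm_ring_hom_mp_eval[OF id])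
  have ex_single: "ex (Poly_Mapping.single \<mu> c) = c * mon_eval x \<mu>"
    and eP_single: "eP (Poly_Mapping.single \<mu> c) = c * mon_eval P \<mu>" for \<mu> c
    by (simp_all add: ex_def eP_def comm_ring_hom.mp_eval_single[OF id])
  have van: "eP G = 0" if "G \<in> forms k m e" "ex G = 0" for G e
    using P that unfolding curve_points_def ex_def eP_def by blast
  have VI: "y \<in> V" if "y = ex G / ex H" "G \<in> forms k m e" "H \<in> forms k m e" "eP H \<noteq> 0" for y G H e
    using that unfolding V_def curve_local_ring_def ex_def eP_def by blast
  \<comment> \<open>A form that does not vanish at the point does not vanish at the generic point
    either, so the denominators are nonzero in the field.\<close>
  have VE: "\<exists>G H e. y = ex G / ex H \<and> G \<in> forms k m e \<and> H \<in> forms k m e \<and> eP H \<noteq> 0 \<and> ex H \<noteq> 0" if "y \<in> V" for y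
  proof -
    obtain G H e where *: "y = ex G / ex H" "G \<in> forms k m e" "H \<in> forms k m e" "eP H \<noteq> 0"
      using \<open>y \<in> V\<close> unfolding V_def curve_local_ring_def ex_def eP_def by blast
    then show ?thesis using van by blast
  qed
  have kV: "c \<in> V" if "c \<in> k" for c
    using that kf(1) kf(2)[OF that, of m] by (intro VI[of _ "mconst c" 1 0]) (auto simp: ex_single)
  have sub: "subring_set V"
    unfolding subring_set_def
  proof (intro conjI ballI)
    show "1 \<in> V" by (rule kV[OF k'(2)])
    fix y z assume y: "y \<in> V" and z: "z \<in> V"
    obtain G H e where 1: "y = ex G / ex H" "G \<in> forms k m e" "H \<in> forms k m e" "eP H \<noteq> 0" "ex H \<noteq> 0"
      using VE[OF y] by blast
    obtain G' H' e' where 2: "z = ex G' / ex H'" "G' \<in> forms k m e'" "H' \<in> forms k m e'" "eP H' \<noteq> 0" "ex H' \<noteq> 0"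
      using VE[OF z] by blast
    have HH: "H * H' \<in> forms k m (e + e')" "eP (H * H') \<noteq> 0"
      using kf(5)[OF 1(3) 2(3)] 1(4) 2(4) by (auto simp: eP.hom_mult)
    have "H * G' \<in> forms k m (e + e')" using kf(5)[OF 1(3) 2(2)] .
    then have "G * H' - H * G' \<in> forms k m (e + e')"
      by (rule kf(4)[OF kf(5)[OF 1(2) 2(3)]])
    moreover have "y - z = ex (G * H' - H * G') / ex (H * H')"
      unfolding 1(1) 2(1) using 1(5) 2(5) by (simp add: ex.hom_minus ex.hom_mult field_simps)
    ultimately show "y - z \<in> V" using VI[OF _ _ HH] by blast
    have "y * z = ex (G * G') / ex (H * H')"
      unfolding 1(1) 2(1) by (simp add: ex.hom_mult)
    from VI[OF this kf(5)[OF 1(2) 2(2)] HH] show "y * z \<in> V" .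
  qed
  note V' = subring_setD[OF sub]
  have max: "max_ideal V = {\<pi> * y | y. y \<in> V}" using unif by (simp add: uniformizer_def)
  have pi_max: "\<pi> \<in> max_ideal V" unfolding max using V'(2) by (intro CollectI exI[of _ 1]) simp
  then have piV: "\<pi> \<in> V" and pi_unit: "\<pi> = 0 \<or> inverse \<pi> \<notin> V" by (auto simp: max_ideal_def)
  \<comment> \<open>Numerator and denominator are divided by a power of a coordinate that is nonzero
    at the point.\<close>
  have frac: "\<exists>a\<in>V. \<exists>b\<in>V. b \<noteq> 0 \<and> y = a / b" for y
  proof -
    obtain e G H where GH: "G \<in> forms k m e" "H \<in> forms k m e" "ex H \<noteq> 0" "y = ex G / ex H"
      using gen unfolding generic_point_def ex_def by blast
    obtain i where i: "i \<le> m" "P i \<noteq> 0" using P unfolding curve_points_def by blast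
    define L where "L = (mvar i :: (nat, 'a) mpol) ^ e"
    have L: "L \<in> forms k m e" unfolding L_def by (rule kf(3)[OF i(1)])
    have "eP L \<noteq> 0" using i(2) by (simp add: L_def eP.hom_power eP_single del: One_nat_def)
    then have exL: "ex L \<noteq> 0" using van[OF L] by blast
    have "ex G / ex L \<in> V" "ex H / ex L \<in> V"
      using VI[OF refl GH(1) L \<open>eP L \<noteq> 0\<close>] VI[OF refl GH(2) L \<open>eP L \<noteq> 0\<close>] by auto
    then show ?thesis
      using GH exL by (intro bexI[of _ "ex G / ex L"] bexI[of _ "ex H / ex L"]) auto
  qed
  \<comment> \<open>The constant \<open>c\<close> is the value of \<open>y\<close> at the point; the
    residue field is thus \<open>k\<close>.\<close>
  have residue: "\<exists>c\<in>k. y - c \<in> max_ideal V" if y: "y \<in> V" for y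
  proof -
    obtain G H e where 1: "y = ex G / ex H" "G \<in> forms k m e" "H \<in> forms k m e" "eP H \<noteq> 0" "ex H \<noteq> 0"
      using VE[OF y] by blast
    have Pk: "eP G \<in> k" if "G \<in> forms k m e" for G e
    proof -
      have "\<And>i. i \<le> m \<Longrightarrow> P i \<in> k" using P unfolding curve_points_def by blast
      then have "mon_eval P \<mu> \<in> k" if "\<mu> \<in> monoms m e" for \<mu>
        unfolding mon_eval_def using that
        by (intro subring_set_prod[OF k(1)] subring_set_power[OF k(1)]) (auto simp: monoms_def)
      then show ?thesis
        unfolding eP_def comm_ring_hom.mp_eval_superset[OF id finite_keys order_refl]
        using \<open>G \<in> forms k m e\<close>
        by (intro subring_set_sum[OF k(1)] k'(6)) (auto simp: forms_def)
    qed
    define c where "c = eP G * inverse (eP H)"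
    have ck: "c \<in> k" unfolding c_def by (intro k'(6) k(2) Pk[OF 1(2)] Pk[OF 1(3)])
    define N where "N = G - mconst c * H"
    have cH: "mconst c * H \<in> forms k m e" using kf(5)[OF kf(2)[OF ck] 1(3)] by simp
    have N: "N \<in> forms k m e" unfolding N_def by (rule kf(4)[OF 1(2) cH])
    have PN: "eP N = 0" using 1(4) by (simp add: N_def eP.hom_minus eP.hom_mult eP_single c_def)
    have yc: "y - c = ex N / ex H"
      using 1(5) by (simp add: N_def ex.hom_minus ex.hom_mult ex_single 1(1) field_simps)
    have "inverse (y - c) \<notin> V" if nz: "y - c \<noteq> 0"
    proof
      assume "inverse (y - c) \<in> V"
      then obtain G' H' e' where 2: "inverse (y - c) = ex G' / ex H'" "G' \<in> forms k m e'" "H' \<in> forms k m e'"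
          "eP H' \<noteq> 0" "ex H' \<noteq> 0"
        using VE by blast
      have "(ex N / ex H) * (ex G' / ex H') = 1"
        using nz unfolding 2(1)[symmetric] yc[symmetric] by simp
      then have "ex (N * G' - H * H') = 0"
        using 1(5) 2(5) by (simp add: ex.hom_minus ex.hom_mult field_simps)
      moreover have "N * G' - H * H' \<in> forms k m (e + e')"
        by (rule kf(4)[OF kf(5)[OF N 2(2)] kf(5)[OF 1(3) 2(3)]])
      ultimately have "eP (N * G' - H * H') = 0" using van by blast
      then show False using PN 1(4) 2(4) by (simp add: eP.hom_minus eP.hom_mult)
    qed
    moreover have "y - c \<in> V" by (rule V'(5)[OF y kV[OF ck]])
    ultimately show ?thesis using ck by (intro bexI[of _ c]) (auto simp: max_ideal_def)
  qed
  obtain t where t: "\<not> algebraic_over k t" "\<And>y. algebraic_over {poly f t | f. \<forall>i. coeff f i \<in> k} y"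
    using tr unfolding trdeg_one_def by blast
  \<comment> \<open>Were the maximal ideal 0, the local ring and hence the whole field would be
    \<open>k\<close>, which contradicts the existence of a transcendental element.\<close>
  have nz: "\<pi> \<noteq> 0"
  proof
    assume "\<pi> = 0"
    then have "max_ideal V \<subseteq> {0}" unfolding max by auto
    then have Vk: "y \<in> k" if "y \<in> V" for y using residue[OF that] by auto
    obtain a b where "a \<in> V" "b \<in> V" "t = a / b" using frac[of t] by blast
    then have "t \<in> k" using k'(6)[OF Vk k(2)[OF Vk]] by (simp add: divide_inverse)
    then have "algebraic_over k t"
      unfolding algebraic_over_def using k'
      by (intro exI[of _ "[:- t, 1:]"]) (auto simp: coeff_pCons split: nat.splits)
    then show False using t(1) by simp
  qed
  \<comment> \<open>If this element were in the maximal ideal, \<open>\<pi>\<close> would divide the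
    nonzero constant \<open>c\<close> and be a unit.\<close>
  have unit: "c + \<pi> * w \<in> V \<and> inverse (c + \<pi> * w) \<in> V \<and> c + \<pi> * w \<noteq> 0" if c: "c \<in> k" "c \<noteq> 0" and w: "w \<in> V" for c w
  proof -
    have mem: "c + \<pi> * w \<in> V" by (intro V'(4,6) kV c piV w)
    have "c + \<pi> * w \<notin> max_ideal V"
    proof
      assume "c + \<pi> * w \<in> max_ideal V"
      then obtain z where z: "z \<in> V" "c + \<pi> * w = \<pi> * z" unfolding max by blast
      then have "\<pi> * ((z - w) * inverse c) = 1" using c(2) by (simp add: field_simps)
      then have "inverse \<pi> = (z - w) * inverse c" by (rule inverse_unique)
      moreover have "(z - w) * inverse c \<in> V" by (intro V'(5,6) z w kV k(2) c)
      ultimately show False using pi_unit nz by simp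
    qed
    then show ?thesis using mem by (auto simp: max_ideal_def)
  qed
  have piV_poly: "poly h \<pi> \<in> V" if "\<forall>i. coeff h i \<in> k" for h
    using that kV by (intro poly_mem[OF sub _ piV]) auto
  have trans: "\<not> algebraic_over k \<pi>"
  proof
    assume "algebraic_over k \<pi>"
    then obtain p where p: "p \<noteq> 0" "\<And>i. coeff p i \<in> k" "poly p \<pi> = 0" unfolding algebraic_over_def by blast
    obtain j a h where *: "a \<noteq> 0" "a \<in> k" "\<forall>i. coeff h i \<in> k" "\<forall>z. poly p z = z ^ j * (a + z * poly h z)"
      using poly_low_order[OF p(1,2)] by blast
    have "a + \<pi> * poly h \<pi> = 0" using p(3) *(4) nz by simp
    then show False using unit[OF *(2,1) piV_poly[OF *(3)]] by simp
  qed
  have "\<exists>k. \<exists>z\<in>V. \<pi> ^ k = y * z" if y: "y \<in> V" "y \<noteq> 0" for y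
  proof -
    define K0 where "K0 = {poly f \<pi> | f. \<forall>i. coeff f i \<in> k}"
    have "algebraic_over K0 y" unfolding K0_def by (rule algebraic_exchange[OF k(1) t(2) trans])
    then obtain p where p: "p \<noteq> 0" "\<And>i. coeff p i \<in> K0" "poly p y = 0" unfolding algebraic_over_def by blast
    obtain j a h where *: "a \<noteq> 0" "a \<in> K0" "\<forall>i. coeff h i \<in> K0" "\<forall>z. poly p z = z ^ j * (a + z * poly h z)"
      using poly_low_order[OF p(1,2)] by blast
    have K0V: "b \<in> V" if "b \<in> K0" for b using that piV_poly unfolding K0_def by blast
    have hV: "poly h y \<in> V" using *(3) K0V by (intro poly_mem[OF sub _ y(1)]) auto
    \<comment> \<open>The lowest coefficient of the equation is a multiple of \<open>y\<close> and a
      polynomial in \<open>\<pi>\<close>; its own lowest term splits off a power of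
      \<open>\<pi>\<close> and leaves a unit.\<close>
    have a: "a = y * (- poly h y)" using p(3) *(4) y(2) by (simp add: eq_neg_iff_add_eq_0)
    obtain f where f: "a = poly f \<pi>" "\<And>i. coeff f i \<in> k" using *(2) unfolding K0_def by blast
    have "f \<noteq> 0" using f(1) *(1) by auto
    from poly_low_order[OF this f(2)] obtain l b g where
      g: "b \<noteq> 0" "b \<in> k" "\<forall>i. coeff g i \<in> k" "\<forall>z. poly f z = z ^ l * (b + z * poly g z)" by blast
    define u where "u = b + \<pi> * poly g \<pi>"
    have u: "u \<in> V" "inverse u \<in> V" "u \<noteq> 0" using unit[OF g(2,1) piV_poly[OF g(3)]] by (auto simp: u_def)
    have "\<pi> ^ l * u = y * (- poly h y)" using f(1) g(4) a by (simp add: u_def)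
    then have "\<pi> ^ l = y * (- poly h y * inverse u)" using u(3) by (simp add: field_simps)
    moreover have "- poly h y * inverse u \<in> V" by (intro V'(3,6) hV u)
    ultimately show ?thesis by blast
  qed
  then have "dvr V \<pi>" by (intro dvrI sub frac max nz)
  then show ?thesis unfolding V_def by blast
qed


section \<open>Local rings of number fields\<close>

text \<open>
  Seidenberg's argument: lowering the degree of an equation for \<open>u\<close> with a unit coefficient as
  long as neither the leading coefficient \<open>a\<^sub>n\<close> nor \<open>a\<^sub>n u\<close>, which is integral, is a unit.
\<close>

lemma integrally_closed_dichotomy:
  fixes V :: "'a::field set"
  assumes sub: "subring_set V" and closed: "\<And>w. integral_over V w \<Longrightarrow> w \<in> V"
    and add: "\<And>x y. x \<in> max_ideal V \<Longrightarrow> y \<in> max_ideal V \<Longrightarrow> x - y \<in> max_ideal V"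
    and "\<And>i. i \<le> n \<Longrightarrow> a i \<in> V" "(\<Sum>i\<le>n. a i * u ^ i) = 0" "i0 \<le> n" "a i0 \<notin> max_ideal V"
  shows "u \<in> V \<or> inverse u \<in> V"
  using assms(4-)
proof (induction n arbitrary: a i0)
  case 0
  then have "a i0 = 0" by simp
  then show ?case using 0(4) subring_setD(1)[OF sub] by (simp add: max_ideal_def)
next
  case (Suc n)
  note V = subring_setD[OF sub]
  define b where "b = a (Suc n) * u"
  have top: "b * u ^ n = - (\<Sum>i\<le>n. a i * u ^ i)"
    using Suc.prems(2) by (simp add: b_def eq_neg_iff_add_eq_0 mult.assoc add.commute)
  \<comment> \<open>Multiplying the equation for \<open>u\<close> by the n-th power of its leading
    coefficient turns it into a monic equation for \<open>b\<close>.\<close>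
  have "b ^ Suc n = a (Suc n) ^ n * (b * u ^ n)"
    by (simp add: b_def power_mult_distrib mult.left_commute)
  also have "\<dots> = (\<Sum>i<Suc n. - (a i * a (Suc n) ^ (n - i)) * b ^ i)"
    unfolding top lessThan_Suc_atMost mult_minus_right sum_distrib_left sum_negf[symmetric]
  proof (rule sum.cong[OF refl])
    fix i assume "i \<in> {..n}"
    then have "a (Suc n) ^ n = a (Suc n) ^ (n - i) * a (Suc n) ^ i"
      by (simp add: power_add[symmetric])
    then show "- (a (Suc n) ^ n * (a i * u ^ i)) = - (a i * a (Suc n) ^ (n - i)) * b ^ i"
      by (simp add: b_def power_mult_distrib mult_ac)
  qed
  finally have eq: "b ^ Suc n = (\<Sum>i<Suc n. - (a i * a (Suc n) ^ (n - i)) * b ^ i)" .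
  have bV: "b \<in> V"
  proof (rule closed)
    have "\<forall>i<Suc n. - (a i * a (Suc n) ^ (n - i)) \<in> V"
    proof (intro allI impI)
      fix i assume "i < Suc n"
      then have "a i \<in> V" using Suc.prems(1) by simp
      then show "- (a i * a (Suc n) ^ (n - i)) \<in> V"
        using Suc.prems(1)[of "Suc n"] by (intro V(3) V(6) subring_set_power[OF sub]) simp_all
    qed
    then show "integral_over V b" unfolding integral_over_def using eq by (intro exI conjI)
  qed
  have aV: "a (Suc n) \<in> V" using Suc.prems(1) by simp
  consider "b \<notin> max_ideal V" | "a (Suc n) \<notin> max_ideal V" | "b \<in> max_ideal V" "a (Suc n) \<in> max_ideal V" by blast
  then show ?case
  proof cases
    case 1
    then have b: "b \<noteq> 0" "inverse b \<in> V" using bV by (auto simp: max_ideal_def)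
    then have "inverse u = a (Suc n) * inverse b" by (auto simp: b_def)
    then show ?thesis using V(6)[OF aV b(2)] by simp
  next
    case 2
    then have c: "a (Suc n) \<noteq> 0" "inverse (a (Suc n)) \<in> V" using aV by (auto simp: max_ideal_def)
    then have "u = b * inverse (a (Suc n))" by (simp add: b_def)
    then show ?thesis using V(6)[OF bV c(2)] by simp
  next
    case 3
    \<comment> \<open>The top term equals \<open>b * u ^ n\<close> and is absorbed into the
      coefficient of \<open>u ^ n\<close>. As \<open>b\<close> lies in the maximal ideal, a unit
      coefficient stays a unit.\<close>
    define a' where "a' i = (if i = n then a n + b else a i)" for i
    have "(\<Sum>i\<le>n. a' i * u ^ i) = (\<Sum>i\<le>n. a i * u ^ i + (if i = n then b * u ^ n else 0))"
      by (intro sum.cong refl) (auto simp: a'_def distrib_right)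
    also have "\<dots> = 0" using top by (simp add: sum.distrib)
    finally have root: "(\<Sum>i\<le>n. a' i * u ^ i) = 0" .
    have "i0 \<noteq> Suc n" using Suc.prems(4) 3(2) by auto
    then have i0: "i0 \<le> n" using Suc.prems(3) by simp
    have "a' i0 \<notin> max_ideal V"
    proof
      assume "a' i0 \<in> max_ideal V"
      then have "a i0 \<in> max_ideal V"
        using add[OF _ 3(1), of "a n + b"] by (cases "i0 = n") (auto simp: a'_def)
      then show False using Suc.prems(4) by simp
    qed
    moreover have "a' i \<in> V" if "i \<le> n" for i
      using Suc.prems(1) that bV by (auto simp: a'_def intro: V(4))
    ultimately show ?thesis using Suc.IH[OF _ root i0] by blast
  qed
qed

text \<open>A row of zeros makes the N equations in N + 1 unknowns a square system with determinant
  0, and a singular integer matrix has a nonzero integer kernel vector.\<close>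

lemma int_linear_dependency:
  fixes m :: "nat \<Rightarrow> nat \<Rightarrow> int"
  shows "\<exists>c. (\<exists>i\<le>N. c i \<noteq> 0) \<and> (\<forall>b<N. (\<Sum>i\<le>N. m b i * c i) = 0)"
proof -
  define A where "A = mat (Suc N) (Suc N) (\<lambda>(b, i). if b < N then m b i else 0)"
  have A: "A \<in> carrier_mat (Suc N) (Suc N)" by (simp add: A_def)
  have "det A = (\<Sum>j<Suc N. A $$ (N, j) * cofactor A N j)"
    by (rule laplace_expansion_row[OF A]) simp
  also have "\<dots> = 0" by (rule sum.neutral) (simp add: A_def)
  finally have "det A = 0" .
  then obtain v where v: "v \<in> carrier_vec (Suc N)" "v \<noteq> 0\<^sub>v (Suc N)" "A *\<^sub>v v = 0\<^sub>v (Suc N)"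
    using det_0_iff_vec_prod_zero[OF A] by blast
  have "\<exists>i\<le>N. vec_index v i \<noteq> 0"
  proof (rule ccontr)
    assume "\<not> (\<exists>i\<le>N. vec_index v i \<noteq> 0)"
    then have "v = 0\<^sub>v (Suc N)" using v(1) by (intro eq_vecI) auto
    then show False using v(2) by simp
  qed
  moreover have "(\<Sum>i\<le>N. m b i * vec_index v i) = 0" if "b < N" for b
  proof -
    have "vec_index (A *\<^sub>v v) b = (\<Sum>i\<le>N. m b i * vec_index v i)"
      using v(1) that by (auto simp: A_def scalar_prod_def atLeast0LessThan lessThan_Suc_atMost intro!: sum.cong)
    then show ?thesis using v(3) that by simp
  qed
  ultimately show ?thesis by blast
qed

text \<open>In characteristic 0 this says that the dimension over the rationals is at most
  \<open>N\<close>, in a form that keeps integer coefficients.\<close>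

definition qdim_bound :: "'a::field itself \<Rightarrow> nat \<Rightarrow> bool"
  where "qdim_bound _ N \<longleftrightarrow> (\<forall>x :: nat \<Rightarrow> 'a. \<exists>c :: nat \<Rightarrow> int.
    (\<exists>i\<le>N. c i \<noteq> 0) \<and> (\<Sum>i\<le>N. of_int (c i) * x i) = 0)"

lemma number_field_qdim_bound:
  assumes "number_field TYPE('a::field)"
  shows "\<exists>N. qdim_bound TYPE('a) N"
proof -
  obtain B :: "'a set" where B: "finite B"
    "\<And>x. \<exists>q. (\<forall>b\<in>B. \<exists>r s. q b = of_int r / of_int s) \<and> x = (\<Sum>b\<in>B. q b * b)"
    using assms unfolding number_field_def by blast
  define N where "N = card B"
  obtain f where f: "bij_betw f {..<N} B"
    using ex_bij_betw_nat_finite[OF B(1)] by (auto simp: N_def atLeast0LessThan)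
  have "\<exists>c :: nat \<Rightarrow> int. (\<exists>i\<le>N. c i \<noteq> 0) \<and> (\<Sum>i\<le>N. of_int (c i) * x i) = 0" for x :: "nat \<Rightarrow> 'a"
  proof -
    have "\<exists>rs. (\<forall>b<N. (of_int (snd rs b) :: 'a) \<noteq> 0)
        \<and> x i = (\<Sum>b<N. of_int (fst rs b) / of_int (snd rs b) * f b)" for i
    proof -
      obtain q where q: "\<forall>b\<in>B. \<exists>r s. q b = of_int r / of_int s" "x i = (\<Sum>b\<in>B. q b * b)"
        using B(2) by blast
      have "\<forall>b\<in>{..<N}. \<exists>rs. (of_int (snd rs) :: 'a) \<noteq> 0 \<and> q (f b) = of_int (fst rs) / of_int (snd rs)"
      proof
        fix b assume "b \<in> {..<N}"
        then have "f b \<in> B" using f by (auto simp: bij_betw_def)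
        then obtain r s where rs: "q (f b) = of_int r / of_int s" using q(1) by blast
        show "\<exists>rs. (of_int (snd rs) :: 'a) \<noteq> 0 \<and> q (f b) = of_int (fst rs) / of_int (snd rs)"
        \<comment> \<open>A quotient with denominator 0 has the value 0 and is rewritten as 0 over
          1.\<close>
        proof (cases "(of_int s :: 'a) = 0")
          case True
          then show ?thesis using rs by (intro exI[of _ "(0, 1)"]) simp
        next
          case False
          then show ?thesis using rs by (intro exI[of _ "(r, s)"]) simp
        qed
      qed
      from bchoice[OF this] obtain g where g:
        "\<forall>b\<in>{..<N}. (of_int (snd (g b)) :: 'a) \<noteq> 0 \<and> q (f b) = of_int (fst (g b)) / of_int (snd (g b))"
        by (rule exE)
      define r where "r b = fst (g b)" for b
      define s where "s b = snd (g b)" for b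
      have rs: "\<forall>b<N. (of_int (s b) :: 'a) \<noteq> 0 \<and> q (f b) = of_int (r b) / of_int (s b)"
        using g by (simp add: r_def s_def)
      have "x i = (\<Sum>b<N. q (f b) * f b)"
        unfolding q(2) by (rule sum.reindex_bij_betw[OF f, symmetric])
      also have "\<dots> = (\<Sum>b<N. of_int (r b) / of_int (s b) * f b)"
        using rs by (intro sum.cong) auto
      finally show ?thesis using rs by (intro exI[of _ "(r, s)"]) simp
    qed
    then have "\<forall>i. \<exists>rs. (\<forall>b<N. (of_int (snd rs b) :: 'a) \<noteq> 0)
        \<and> x i = (\<Sum>b<N. of_int (fst rs b) / of_int (snd rs b) * f b)" by (rule allI)
    from choice[OF this] obtain rs where "\<forall>i. (\<forall>b<N. (of_int (snd (rs i) b) :: 'a) \<noteq> 0)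
        \<and> x i = (\<Sum>b<N. of_int (fst (rs i) b) / of_int (snd (rs i) b) * f b)"
      by (rule exE)
    then have rs: "\<And>i b. b < N \<Longrightarrow> (of_int (snd (rs i) b) :: 'a) \<noteq> 0"
        "\<And>i. x i = (\<Sum>b<N. of_int (fst (rs i) b) / of_int (snd (rs i) b) * f b)"
      by simp_all
    define r where "r i = fst (rs i)" for i
    define s where "s i = snd (rs i)" for i
    \<comment> \<open>\<open>S\<close> is a common denominator of all coordinates, and
      \<open>R i b\<close> is the product of all denominators other than
      \<open>s i b\<close>.\<close>
    define S where "S = (\<Prod>j\<le>N. \<Prod>l<N. s j l)"
    define R where "R i b = (\<Prod>j\<in>{..N} - {i}. \<Prod>l<N. s j l) * (\<Prod>l\<in>{..<N} - {b}. s i l)" for i b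
    have S0: "(of_int S :: 'a) \<noteq> 0" using rs(1) by (auto simp: S_def s_def prod_zero_iff)
    have SR: "S = R i b * s i b" if "i \<le> N" "b < N" for i b
    proof -
      have "S = (\<Prod>l<N. s i l) * (\<Prod>j\<in>{..N} - {i}. \<Prod>l<N. s j l)"
        unfolding S_def using that by (intro prod.remove) auto
      also have "(\<Prod>l<N. s i l) = s i b * (\<Prod>l\<in>{..<N} - {b}. s i l)"
        using that by (intro prod.remove) auto
      finally show ?thesis by (simp add: R_def mult_ac)
    qed
    have Sx: "of_int S * x i = (\<Sum>b<N. of_int (R i b * r i b) * f b)" if "i \<le> N" for i
      unfolding rs(2) sum_distrib_left
    proof (rule sum.cong[OF refl])
      fix b assume "b \<in> {..<N}"
      then have b: "b < N" by simp
      show "of_int S * (of_int (fst (rs i) b) / of_int (snd (rs i) b) * f b) = of_int (R i b * r i b) * f b"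
        using rs(1)[OF b, of i] SR[OF that b] by (simp add: r_def s_def)
    qed
    obtain c where c: "\<exists>i\<le>N. c i \<noteq> 0" "\<forall>b<N. (\<Sum>i\<le>N. R i b * r i b * c i) = 0"
      using int_linear_dependency[of N "\<lambda>b i. R i b * r i b"] by blast
    have "of_int S * (\<Sum>i\<le>N. of_int (c i) * x i) = (\<Sum>i\<le>N. of_int (c i) * (of_int S * x i))"
      by (simp add: sum_distrib_left mult.left_commute)
    also have "\<dots> = (\<Sum>i\<le>N. \<Sum>b<N. of_int (R i b * r i b * c i) * f b)"
      by (intro sum.cong refl) (simp add: Sx sum_distrib_left mult_ac)
    also have "\<dots> = (\<Sum>b<N. of_int (\<Sum>i\<le>N. R i b * r i b * c i) * f b)"
      by (subst sum.swap) (simp add: sum_distrib_right)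
    also have "\<dots> = 0" using c(2) by (intro sum.neutral) auto
    finally have "(\<Sum>i\<le>N. of_int (c i) * x i) = 0" using S0 by simp
    then show ?thesis using c(1) by blast
  qed
  then show ?thesis unfolding qdim_bound_def by blast
qed

text \<open>The gcd of the coefficients can be cancelled in characteristic 0, so a relation remains
  nontrivial modulo \<open>p\<close>.\<close>

lemma qdim_bound_primitive:
  fixes x :: "nat \<Rightarrow> 'a::field"
  assumes "qdim_bound TYPE('a) N" "CHAR('a) = 0" and p: "p > (1::int)"
  shows "\<exists>c :: nat \<Rightarrow> int. (\<Sum>i\<le>N. of_int (c i) * x i) = 0 \<and> (\<exists>i\<le>N. \<not> p dvd c i)"
proof -
  obtain c :: "nat \<Rightarrow> int" where c: "\<exists>i\<le>N. c i \<noteq> 0" "(\<Sum>i\<le>N. of_int (c i) * x i) = 0"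
    using assms(1) unfolding qdim_bound_def by blast
  define g where "g = Gcd (c ` {..N})"
  have g: "g dvd c i" if "i \<le> N" for i unfolding g_def using that by (intro Gcd_dvd) auto
  have "g \<noteq> 0" using c(1) g by auto
  define c' where "c' i = c i div g" for i
  have cc': "c i = g * c' i" if "i \<le> N" for i using g[OF that] by (simp add: c'_def)
  have "of_int g * (\<Sum>i\<le>N. of_int (c' i) * x i) = (\<Sum>i\<le>N. of_int (c i) * x i)"
    unfolding sum_distrib_left by (intro sum.cong refl) (simp add: cc' mult.assoc)
  moreover have "(of_int g :: 'a) \<noteq> 0"
    using \<open>g \<noteq> 0\<close> assms(2) by (simp add: of_int_eq_0_iff_char_dvd)
  ultimately have "(\<Sum>i\<le>N. of_int (c' i) * x i) = 0" using c(2) by simp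
  moreover have "\<exists>i\<le>N. \<not> p dvd c' i"
  proof (rule ccontr)
    assume "\<not> (\<exists>i\<le>N. \<not> p dvd c' i)"
    then have "g * p dvd Gcd (c ` {..N})" by (intro Gcd_greatest) (auto simp: cc')
    then have "g * p dvd g * 1" by (simp add: g_def)
    then show False using \<open>g \<noteq> 0\<close> p by (simp only: dvd_mult_cancel_left) simp
  qed
  ultimately show ?thesis by blast
qed

section \<open>Integrally closed local rings in a field of finite rank\<close>

lemma algebraic_int_iff_integral:
  fixes w :: "'a::field"
  shows "algebraic_int w \<longleftrightarrow> integral_over (range of_int) w"
proof
  assume "algebraic_int w"
  then obtain p where p: "lead_coeff p = 1" "\<forall>i. coeff p i \<in> \<int>" "poly p w = 0"
    by (auto elim: algebraic_int.cases)
  have "- coeff p i \<in> range of_int" for i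
  proof -
    have "- coeff p i \<in> \<int>" using p(2) by simp
    then show ?thesis by (simp add: Ints_def)
  qed
  then show "integral_over (range of_int) w"
    unfolding integral_over_def using monic_poly_root[OF p(1,3)]
    by (intro exI[of _ "degree p"] exI[of _ "\<lambda>i. - coeff p i"]) auto
next
  assume "integral_over (range of_int) w"
  then obtain n a where a: "\<And>i. i < n \<Longrightarrow> a i \<in> range of_int" "w ^ n = (\<Sum>i<n. a i * w ^ i)"
    unfolding integral_over_def by blast
  define p where "p = monom 1 n - (\<Sum>i<n. monom (a i) i)"
  have cp: "coeff p i = (if i = n then 1 else if i < n then - a i else 0)" for i
    by (auto simp: p_def coeff_sum)
  have "degree p = n"
    using cp by (intro antisym degree_le le_degree) auto
  have aZ: "a i \<in> \<int>" if "i < n" for i using a(1)[OF that] by (simp add: Ints_def)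
  from \<open>degree p = n\<close> have "lead_coeff p = 1" by (simp add: cp)
  moreover have "\<forall>i. coeff p i \<in> \<int>"
    using aZ by (simp add: cp)
  moreover have "poly p w = 0" using a(2) by (simp add: p_def poly_sum poly_monom)
  ultimately show "algebraic_int w" by (intro algebraic_int.intros[of p]) auto
qed

lemma subring_set_range_of_int: "subring_set (range (of_int :: int \<Rightarrow> 'a::comm_ring_1))"
  unfolding subring_set_def
proof (intro conjI ballI)
  show "1 \<in> range (of_int :: int \<Rightarrow> 'a)" by (metis of_int_1 rangeI)
  fix a b :: 'a assume "a \<in> range of_int" "b \<in> range of_int"
  then obtain i j where "a = of_int i" "b = of_int j" by blast
  then show "a - b \<in> range of_int" "a * b \<in> range of_int"
    by (simp_all flip: of_int_diff of_int_mult)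
qed


text \<open>
  If the maximal ideal were not principal, there would be an infinite chain of its elements, starting
  at a prime number, in which each properly divides its predecessor. An integer relation between
  them, not all of whose coefficients are divisible by that prime, has a term of least valuation.
\<close>

lemma finite_rank_dvr:
  fixes V :: "'a::field set"
  assumes sub: "subring_set V" and closed: "\<And>w. integral_over V w \<Longrightarrow> w \<in> V"
    and diff: "\<And>x y. x \<in> max_ideal V \<Longrightarrow> y \<in> max_ideal V \<Longrightarrow> x - y \<in> max_ideal V"
    and qdim: "qdim_bound TYPE('a) N" and char: "CHAR('a) = 0"
    and int: "of_int c0 \<in> max_ideal V" "c0 \<noteq> 0"
  shows "\<exists>\<pi>. dvr V \<pi>"
proof -
  define M where "M = max_ideal V"
  note V = subring_setD[OF sub]
  note Vint = subring_set_of_int[OF sub]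
  have MV: "x \<in> V" if "x \<in> M" for x using that by (simp add: M_def max_ideal_def)
  have M0: "0 \<in> M" using V(1) by (simp add: M_def max_ideal_def)
  have unit: "inverse x \<in> V" "x \<noteq> 0" if "x \<in> V" "x \<notin> M" for x using that by (auto simp: M_def max_ideal_def)
  have M1: "x \<notin> M" if "inverse x \<in> V" "x \<noteq> 0" for x using that by (simp add: M_def max_ideal_def)
  have Mmult: "x * y \<in> M" if "x \<in> M" "y \<in> V" for x y
  proof (rule ccontr)
    assume n: "x * y \<notin> M"
    have xy: "x * y \<in> V" by (rule V(6)[OF MV[OF that(1)] that(2)])
    have nz: "x \<noteq> 0" "y \<noteq> 0" using unit(2)[OF xy n] by auto
    have "y * inverse (x * y) \<in> V" by (rule V(6)[OF that(2) unit(1)[OF xy n]])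
    moreover have "y * inverse (x * y) = inverse x" using nz by (simp add: field_simps)
    ultimately have "inverse x \<in> V" by (simp only:)
    then have "x \<notin> M" using nz(1) by (rule M1)
    then show False using that(1) by simp
  qed
  have Mdiff: "x - y \<in> M" if "x \<in> M" "y \<in> M" for x y using diff that by (simp add: M_def)
  have Mneg: "- x \<in> M" if "x \<in> M" for x using Mdiff[OF M0 that] by simp
  have Madd: "x + y \<in> M" if "x \<in> M" "y \<in> M" for x y using Mdiff[OF that(1) Mneg[OF that(2)]] by simp
  have Msum: "sum f I \<in> M" if "\<And>i. i \<in> I \<Longrightarrow> f i \<in> M" for f :: "nat \<Rightarrow> 'a" and I
    using that by (induction I rule: infinite_finite_induct) (auto intro: M0 Madd)
  have int0: "(of_int c :: 'a) = 0 \<longleftrightarrow> c = 0" for c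
    using char by (simp add: of_int_eq_0_iff_char_dvd)

  \<comment> \<open>\<open>p\<close> is the residue characteristic: the integers in the maximal
    ideal are exactly the multiples of its least positive one.\<close>
  define q where "q = (LEAST k. k > 0 \<and> of_int (int k) \<in> M)"
  have "nat \<bar>c0\<bar> > 0 \<and> of_int (int (nat \<bar>c0\<bar>)) \<in> M"
    using int Mneg[of "of_int c0"] by (auto simp: M_def abs_if)
  then have q: "q > 0 \<and> of_int (int q) \<in> M" unfolding q_def by (rule LeastI)
  define p where "p = int q"
  have p: "p > 0" "of_int p \<in> M" using q by (simp_all add: p_def)
  have p_least: "p \<le> c" if "c > 0" "of_int c \<in> M" for c
  proof -
    have "q \<le> nat c" unfolding q_def using that by (intro Least_le) simp
    then show ?thesis using that(1) by (simp add: p_def)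
  qed
  have p_dvd: "p dvd c" if "of_int c \<in> M" for c
  proof (rule ccontr)
    assume n: "\<not> p dvd c"
    have "of_int c - of_int p * of_int (c div p) \<in> M"
      by (intro Mdiff that Mmult p(2) Vint)
    then have "of_int (c mod p) \<in> M"
      by (simp only: minus_mult_div_eq_mod flip: of_int_mult of_int_diff)
    moreover have "c mod p \<noteq> 0" "c mod p \<ge> 0" "c mod p < p" using n p(1) by (auto simp: dvd_eq_mod_eq_0)
    ultimately show False using p_least[of "c mod p"] by simp
  qed
  have dvd_M: "of_int c \<in> M" if "p dvd c" for c
  proof -
    have "of_int p * of_int (c div p) \<in> M" by (intro Mmult p(2) Vint)
    then show ?thesis using that by (simp flip: of_int_mult)
  qed
  have "1 \<notin> M" using V(2) by (intro M1) simp_all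
  then have "p \<noteq> 1" using p(2) by (metis of_int_1)
  then have p1: "p > 1" using p(1) by simp
  note relation = qdim_bound_primitive[OF qdim char p1]

  \<comment> \<open>A relation between the powers of \<open>u\<close> has a coefficient not
    divisible by \<open>p\<close>, that is a unit of \<open>V\<close>.\<close>
  have val_ring: "u \<in> V \<or> inverse u \<in> V" for u
  proof -
    obtain c i0 where c: "(\<Sum>i\<le>N. of_int (c i) * u ^ i) = 0" "i0 \<le> N" "\<not> p dvd c i0"
      using relation[of "\<lambda>i. u ^ i"] by (elim exE conjE)
    show ?thesis
      by (rule integrally_closed_dichotomy[OF sub closed diff Vint c(1,2)])
        (use c(3) p_dvd in \<open>auto simp: M_def\<close>)
  qed

  have "\<exists>\<pi>. \<pi> \<noteq> 0 \<and> M = {\<pi> * y | y. y \<in> V}"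
  proof (rule ccontr)
    assume n: "\<not> ?thesis"
    have step: "\<exists>y. (y \<in> M \<and> y \<noteq> 0) \<and> x / y \<in> M" if "x \<in> M \<and> x \<noteq> 0" for x
    proof -
      have sub': "{x * y | y. y \<in> V} \<subseteq> M" using Mmult that by auto
      moreover have "M \<noteq> {x * y | y. y \<in> V}"
      proof
        assume "M = {x * y | y. y \<in> V}"
        with that have "x \<noteq> 0 \<and> M = {x * y | y. y \<in> V}" by (intro conjI) simp_all
        from n exI[of "\<lambda>\<pi>. \<pi> \<noteq> 0 \<and> M = {\<pi> * y | y. y \<in> V}", OF this] show False by (rule notE)
      qed
      ultimately obtain y where y: "y \<in> M" "y \<notin> {x * y | y. y \<in> V}" by blast
      have "x * 0 \<in> {x * y | y. y \<in> V}" using V(1) by blast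
      then have y0: "y \<noteq> 0" using y(2) by (cases "y = 0") simp_all
      \<comment> \<open>As \<open>y\<close> is not a multiple of \<open>x\<close>, the dichotomy
        puts \<open>x / y\<close> into \<open>V\<close>, where it is not a unit.\<close>
      have "y / x \<notin> V"
      proof
        assume "y / x \<in> V"
        then have "x * (y / x) \<in> {x * y | y. y \<in> V}" by blast
        then show False using y(2) that by simp
      qed
      then have "x / y \<in> V" "inverse (x / y) \<notin> V"
        using val_ring[of "y / x"] by (simp_all add: inverse_eq_divide)
      then have "x / y \<in> M" by (simp add: M_def max_ideal_def)
      then show ?thesis using y(1) y0 by (intro exI[of _ y]) simp
    qed
    have "\<exists>x. (\<forall>i. x i \<in> M \<and> x i \<noteq> 0) \<and> (\<forall>i. x i / x (Suc i) \<in> M) \<and> x 0 = of_int p"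
    proof -
      define x where "x i = rec_nat (of_int p) (\<lambda>_ x. SOME y. (y \<in> M \<and> y \<noteq> 0) \<and> x / y \<in> M) i" for i :: nat
      have x_Suc: "x (Suc i) = (SOME y. (y \<in> M \<and> y \<noteq> 0) \<and> x i / y \<in> M)" for i by (simp add: x_def)
      have 0: "x 0 = of_int p" by (simp add: x_def)
      have nz: "x i \<in> M \<and> x i \<noteq> 0" for i
      proof (induction i)
        case 0
        show ?case using p by (simp add: x_def int0)
      next
        case (Suc i)
        show ?case using someI_ex[OF step[OF Suc]] unfolding x_Suc by simp
      qed
      have "x i / x (Suc i) \<in> M" for i
        using someI_ex[OF step[OF nz[of i]]] unfolding x_Suc by simp
      then show ?thesis using nz 0 by (intro exI[of _ x]) simp
    qed
    then obtain x where x: "\<And>i. x i \<in> M" "\<And>i. x i \<noteq> 0" "\<And>i. x i / x (Suc i) \<in> M" "x 0 = of_int p"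
      by blast
    have less: "x i / x j \<in> M" if "i < j" for i j
      using that
    proof (induction j)
      case (Suc j)
      show ?case
      proof (cases "i = j")
        case False
        then have "x i / x j * (x j / x (Suc j)) \<in> M" using Suc by (intro Mmult MV x(3)) auto
        then show ?thesis using x(2)[of j] by simp
      qed (use x(3) in simp)
    qed simp
    obtain c i0 where c: "(\<Sum>i\<le>N. of_int (c i) * x i) = 0" "i0 \<le> N" "\<not> p dvd c i0"
      using relation[of x] by (elim exE conjE)
    \<comment> \<open>After division by \<open>x I\<close>, the terms before \<open>I\<close> lie in
      \<open>M\<close> by the chain property, and those after \<open>I\<close> because their
      coefficients are multiples of \<open>p\<close>, the first element of the chain. So
      \<open>c I\<close> would lie in \<open>M\<close> as well.\<close>
    define I where "I = Max {i. i \<le> N \<and> \<not> p dvd c i}"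
    have fin: "finite {i. i \<le> N \<and> \<not> p dvd c i}" by simp
    have "I \<in> {i. i \<le> N \<and> \<not> p dvd c i}" unfolding I_def using c by (intro Max_in[OF fin]) auto
    then have I: "I \<le> N" "\<not> p dvd c I" by auto
    have I_max: "p dvd c i" if "i \<le> N" "I < i" for i
    proof (rule ccontr)
      assume "\<not> p dvd c i"
      then have "i \<le> I" unfolding I_def using that by (intro Max_ge[OF fin]) auto
      then show False using that by simp
    qed
    have terms: "of_int (c i) * x i / x I \<in> M" if "i \<in> {..N} - {I}" for i
    proof (cases "i < I")
      case True
      then show ?thesis using Mmult[OF less[OF True] Vint[of "c i"]] by (simp add: mult.commute)
    next
      case False
      then have "p dvd c i" using that by (intro I_max) auto
      then have ci: "of_int (c i) = x 0 * of_int (c i div p)" by (simp add: x(4) flip: of_int_mult)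
      have "x 0 / x I \<in> V"
        using MV[OF less[of 0 I]] V(2) x(2)[of 0] by (cases "I = 0") auto
      then have "x i * (x 0 / x I * of_int (c i div p)) \<in> M"
        by (intro Mmult x(1) V(6) Vint)
      then show ?thesis by (simp add: ci mult_ac)
    qed
    have "0 = (\<Sum>i\<le>N. of_int (c i) * x i / x I)" using c(1) by (simp flip: sum_divide_distrib)
    also have "\<dots> = of_int (c I) * x I / x I + (\<Sum>i\<in>{..N} - {I}. of_int (c i) * x i / x I)"
      using I(1) by (intro sum.remove) auto
    also have "of_int (c I) * x I / x I = of_int (c I)" using x(2)[of I] by simp
    finally have "of_int (c I) = - (\<Sum>i\<in>{..N} - {I}. of_int (c i) * x i / x I)"
      by (simp add: eq_neg_iff_add_eq_0)
    also have "\<dots> \<in> M" by (intro Mneg Msum terms)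
    finally show False using p_dvd I(2) by simp
  qed
  then obtain \<pi> where pi0: "\<pi> \<noteq> 0" and M_eq: "M = {\<pi> * y | y. y \<in> V}" by (elim exE conjE)
  have piV: "\<pi> * y \<in> M" if "y \<in> V" for y unfolding M_eq using that by blast
  have pi_mem: "\<pi> \<in> V" using MV[OF piV[OF V(2)]] by simp
  note pow = subring_set_power[OF sub pi_mem]
  have tail: "(\<Sum>i\<in>{j<..N}. of_int (c i) * y ^ i) = y ^ Suc j * (\<Sum>i\<in>{j<..N}. of_int (c i) * y ^ (i - Suc j))"
    for c j and y :: 'a
    unfolding sum_distrib_left
  proof (rule sum.cong[OF refl])
    fix i assume "i \<in> {j<..N}"
    then have "y ^ i = y ^ (Suc j + (i - Suc j))" by simp
    then have "y ^ i = y ^ Suc j * y ^ (i - Suc j)" by (simp only: power_add)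
    then show "of_int (c i) * y ^ i = y ^ Suc j * (of_int (c i) * y ^ (i - Suc j))"
      by (simp only: mult.left_commute)
  qed
  have tailV: "(\<Sum>i\<in>{j<..N}. of_int (c i) * y ^ (i - Suc j)) \<in> V" if "y \<in> V" for c j and y :: 'a
    by (intro subring_set_sum[OF sub] V(6) Vint subring_set_power[OF sub that])
  have split: "(\<Sum>i\<le>N. f i) = (\<Sum>i<j. f i) + f j + (\<Sum>i\<in>{j<..N}. f i)" if "j \<le> N" for j and f :: "nat \<Rightarrow> 'a"
  proof -
    have "{..N} = {..<j} \<union> insert j {j<..N}" using that by auto
    moreover have "sum f ({..<j} \<union> insert j {j<..N}) = sum f {..<j} + sum f (insert j {j<..N})"
      by (rule sum.union_disjoint) auto
    ultimately show ?thesis by (simp add: add.assoc)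
  qed

  \<comment> \<open>In a relation between the powers of \<open>\<pi>\<close>, let \<open>I\<close>
    be the first index whose coefficient is not divisible by \<open>p\<close>: the earlier terms are
    multiples of \<open>p\<close>, and the remaining ones add up to \<open>\<pi> ^ I\<close> times a
    unit.\<close>
  obtain I v where v: "v \<in> V" "\<pi> ^ I = of_int p * v"
  proof -
    obtain c i0 where c: "(\<Sum>i\<le>N. of_int (c i) * \<pi> ^ i) = 0" "i0 \<le> N" "\<not> p dvd c i0"
      using relation[of "\<lambda>i. \<pi> ^ i"] by (elim exE conjE)
    define I where "I = (LEAST i. \<not> p dvd c i)"
    have I: "\<not> p dvd c I" unfolding I_def by (rule LeastI[of _ i0]) (rule c(3))
    have I_less: "p dvd c i" if "i < I" for i using not_less_Least[of i "\<lambda>i. \<not> p dvd c i"] that by (auto simp: I_def)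
    have "I \<le> i0" unfolding I_def by (rule Least_le) (rule c(3))
    then have IN: "I \<le> N" using c(2) by simp
    define z where "z = (\<Sum>i\<in>{I<..N}. of_int (c i) * \<pi> ^ (i - Suc I))"
    define w where "w = (\<Sum>i<I. of_int (c i div p) * \<pi> ^ i)"
    have zV: "z \<in> V" unfolding z_def by (rule tailV[OF pi_mem])
    have wV: "w \<in> V" unfolding w_def by (intro subring_set_sum[OF sub] V(6) Vint pow)
    have "(\<Sum>i<I. of_int (c i) * \<pi> ^ i) = of_int p * w"
      unfolding w_def sum_distrib_left
    proof (rule sum.cong[OF refl])
      fix i assume "i \<in> {..<I}"
      then have "c i = p * (c i div p)" using I_less by simp
      then have "(of_int (c i) :: 'a) = of_int p * of_int (c i div p)" by (metis of_int_mult)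
      then show "of_int (c i) * \<pi> ^ i = of_int p * (of_int (c i div p) * \<pi> ^ i)"
        by (simp only: mult.assoc)
    qed
    then have "of_int p * w + of_int (c I) * \<pi> ^ I + \<pi> ^ Suc I * z = 0"
      using c(1) unfolding split[OF IN] tail z_def by simp
    then have eq: "\<pi> ^ I * (of_int (c I) + \<pi> * z) = of_int p * (- w)"
      by (simp add: algebra_simps eq_neg_iff_add_eq_0)
    define e where "e = of_int (c I) + \<pi> * z"
    have eV: "e \<in> V" unfolding e_def by (intro V(4) Vint MV piV zV)
    have "e \<notin> M"
    proof
      assume "e \<in> M"
      then have "e - \<pi> * z \<in> M" by (intro Mdiff piV zV)
      then show False using I p_dvd by (simp add: e_def)
    qed
    note e = unit[OF eV this]
    have "\<pi> ^ I = \<pi> ^ I * e * inverse e" using e(2) by simp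
    also have "\<dots> = of_int p * (- w * inverse e)" using eq by (simp add: e_def mult.assoc)
    finally show ?thesis by (intro that[of "- w * inverse e" I] V(6) V(3) wV e(1))
  qed
  \<comment> \<open>Factors \<open>p\<close> are removed one at a time; an integer not divisible by
    \<open>p\<close> is a unit.\<close>
  have int_dvd: "\<exists>k. \<exists>z\<in>V. \<pi> ^ k = of_int c * z" if "c \<noteq> 0" for c
    using that
  proof (induction "nat \<bar>c\<bar>" arbitrary: c rule: less_induct)
    case less
    show ?case
    proof (cases "p dvd c")
      case False
      then have "of_int c \<notin> M" using p_dvd by auto
      note u = unit[OF Vint this]
      show ?thesis using u by (intro exI[of _ 0] bexI[of _ "inverse (of_int c)"]) auto
    next
      case True
      then obtain c' where c': "c = p * c'" by (rule dvdE)
      then have "c' \<noteq> 0" using less.prems by auto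
      have "nat \<bar>c'\<bar> < nat \<bar>c\<bar>" using \<open>c' \<noteq> 0\<close> p1 by (simp add: c' abs_mult)
      from less.hyps[OF this \<open>c' \<noteq> 0\<close>] obtain k z where z: "z \<in> V" "\<pi> ^ k = of_int c' * z"
        by (elim exE bexE)
      have "\<pi> ^ (I + k) = of_int c * (v * z)" by (simp add: power_add v(2) z(2) c' mult_ac)
      then show ?thesis using V(6)[OF v(1) z(1)] by (intro exI[of _ "I + k"] bexI[of _ "v * z"])
    qed
  qed
  have "dvr V \<pi>"
  proof (rule dvrI[OF sub _ _ pi0])
    fix x
    show "\<exists>a\<in>V. \<exists>b\<in>V. b \<noteq> 0 \<and> x = a / b"
    proof (cases "x \<in> V")
      case True
      then show ?thesis using V(2) by (intro bexI[of _ x, OF bexI[of _ 1]]) auto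
    next
      case False
      then have "inverse x \<in> V" "x \<noteq> 0" using val_ring[of x] V(1) by auto
      then show ?thesis using V(2) by (intro bexI[of _ 1, OF bexI[of _ "inverse x"]]) (auto simp: divide_inverse)
    qed
  next
    show "max_ideal V = {\<pi> * y | y. y \<in> V}" using M_eq by (simp only: M_def)
  next
    fix y assume y: "y \<in> V" "y \<noteq> 0"
    obtain c i0 where c: "(\<Sum>i\<le>N. of_int (c i) * y ^ i) = 0" "i0 \<le> N" "\<not> p dvd c i0"
      using relation[of "\<lambda>i. y ^ i"] by (elim exE conjE)
    \<comment> \<open>In a relation between the powers of \<open>y\<close>, the lowest nonzero
      coefficient is an integer that \<open>y\<close> divides in \<open>V\<close>; this reduces the
      claim to integers.\<close>
    define j where "j = (LEAST i. c i \<noteq> 0)"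
    have ci0: "c i0 \<noteq> 0" using c(3) by auto
    have j: "c j \<noteq> 0" unfolding j_def by (rule LeastI[of _ i0]) (rule ci0)
    have j_less: "c i = 0" if "i < j" for i using not_less_Least[of i "\<lambda>i. c i \<noteq> 0"] that by (auto simp: j_def)
    have "j \<le> i0" unfolding j_def by (rule Least_le) (rule ci0)
    then have jN: "j \<le> N" using c(2) by simp
    define z where "z = (\<Sum>i\<in>{j<..N}. of_int (c i) * y ^ (i - Suc j))"
    have zV: "z \<in> V" unfolding z_def by (rule tailV[OF y(1)])
    have "(\<Sum>i<j. of_int (c i) * y ^ i) = 0" using j_less by (intro sum.neutral) simp
    then have "of_int (c j) * y ^ j + y ^ Suc j * z = 0"
      using c(1) unfolding split[OF jN] tail z_def by simp
    then have "y ^ j * (of_int (c j) + y * z) = 0" by (simp add: algebra_simps)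
    then have "of_int (c j) = y * (- z)" using y(2) by (simp add: eq_neg_iff_add_eq_0)
    moreover obtain k v' where v': "v' \<in> V" and "\<pi> ^ k = of_int (c j) * v'"
      using int_dvd[OF j] by (elim exE bexE)
    ultimately have "\<pi> ^ k = y * (- z * v')" by (simp add: mult.assoc)
    moreover have "- z * v' \<in> V" by (intro V(6) V(3) zV v')
    ultimately show "\<exists>k. \<exists>z\<in>V. \<pi> ^ k = y * z" by (intro exI bexI)
  qed
  then show ?thesis by (rule exI)
qed

section \<open>Localizations of the ring of integers\<close>

lemma subring_of_simps:
  "carrier (subring_of S) = S" "x \<otimes>\<^bsub>subring_of S\<^esub> y = x * y" "x \<oplus>\<^bsub>subring_of S\<^esub> y = x + y"
  "\<one>\<^bsub>subring_of S\<^esub> = 1" "\<zero>\<^bsub>subring_of S\<^esub> = 0"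
  by (simp_all add: subring_of_def ring_of_type_algebra_def)

lemma subring_set_carrier:
  assumes "ring (subring_of S)"
  shows "subring_set S"
proof -
  interpret ring "subring_of S" by fact
  have diff: "a - b \<in> S" if "a \<in> S" "b \<in> S" for a b
  proof -
    have "\<ominus>\<^bsub>subring_of S\<^esub> b \<oplus>\<^bsub>subring_of S\<^esub> b = \<zero>\<^bsub>subring_of S\<^esub>"
      by (rule l_neg) (simp add: subring_of_simps that)
    then have "\<ominus>\<^bsub>subring_of S\<^esub> b = - b" by (simp add: subring_of_simps eq_neg_iff_add_eq_0)
    then have "- b \<in> S" using a_inv_closed[of b] that by (simp add: subring_of_simps)
    then show ?thesis using a_closed[of a "- b"] that by (simp add: subring_of_simps)
  qed
  show ?thesis
    unfolding subring_set_def
    using one_closed m_closed diff by (simp add: subring_of_simps)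
qed

lemma cring_subring_of:
  assumes "subring_set S"
  shows "cring (subring_of S)"
proof (rule cringI)
  note S = subring_setD[OF assms]
  show "abelian_group (subring_of S)"
  proof (rule abelian_groupI)
    fix x assume "x \<in> carrier (subring_of S)"
    then show "\<exists>y\<in>carrier (subring_of S). y \<oplus>\<^bsub>subring_of S\<^esub> x = \<zero>\<^bsub>subring_of S\<^esub>"
      using S(3)[of x] by (intro bexI[of _ "- x"]) (simp_all add: subring_of_simps)
  qed (simp_all add: subring_of_simps S add_ac)
  show "comm_monoid (subring_of S)"
    by (rule comm_monoidI) (simp_all add: subring_of_simps S mult_ac)
qed (simp add: subring_of_simps distrib_right)

text \<open>Two facts are supplied to \<open>finite_rank_dvr\<close>: the localization is integrally
  closed, and its maximal ideal contains a nonzero integer.\<close>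

lemma number_field_dvr:
  assumes nf: "number_field TYPE('a::field)"
    and pp: "maximalideal pp (subring_of (ring_of_integers :: 'a set))"
  shows "\<exists>\<pi>. dvr (localization_at (ring_of_integers :: 'a set) pp) \<pi>"
proof -
  define A where "A = (ring_of_integers :: 'a set)"
  define V where "V = localization_at A pp"
  interpret maximalideal pp "subring_of A" using pp by (simp add: A_def)
  have A_sub: "subring_set A" by (rule subring_set_carrier) (rule ring_axioms)
  interpret A: cring "subring_of A" by (rule cring_subring_of[OF A_sub])
  note A = subring_setD[OF A_sub]
  interpret P: primeideal pp "subring_of A" by (rule A.maximalideal_prime[OF maximalideal_axioms])
  have ppA: "x \<in> A" if "x \<in> pp" for x using a_subset that by (auto simp: subring_of_simps)
  have pp0: "0 \<in> pp" using additive_subgroup.zero_closed[OF additive_subgroup_axioms] by (simp add: subring_of_simps)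
  have pp_mult: "a * x \<in> pp" if "x \<in> pp" "a \<in> A" for x a
    using I_l_closed[of x a] that by (simp add: subring_of_simps)
  have pp_add: "x + y \<in> pp" if "x \<in> pp" "y \<in> pp" for x y
    using additive_subgroup.a_closed[OF additive_subgroup_axioms, of x y] that
    by (simp add: subring_of_simps)
  have pp_diff: "x - y \<in> pp" if "x \<in> pp" "y \<in> pp" for x y
    using pp_add[OF that(1) pp_mult[OF that(2) A(3)[OF A(2)]]] by simp
  have pp1: "1 \<notin> pp"
  proof
    assume "1 \<in> pp"
    then have "a \<in> pp" if "a \<in> A" for a using pp_mult[of 1 a] that by simp
    then have "carrier (subring_of A) = pp" using ppA by (auto simp: subring_of_simps)
    then show False using I_notcarr by simp
  qed
  define T where "T = A - pp"
  have TA: "s \<in> A" "s \<noteq> 0" if "s \<in> T" for s using that pp0 by (auto simp: T_def)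
  have T1: "1 \<in> T" using pp1 A(2) by (simp add: T_def)
  have T_mult: "s * t \<in> T" if "s \<in> T" "t \<in> T" for s t
  proof -
    have "s * t \<notin> pp"
    proof
      assume "s * t \<in> pp"
      then have "s \<in> pp \<or> t \<in> pp"
        using P.I_prime[of s t] that by (simp add: subring_of_simps T_def)
      then show False using that by (auto simp: T_def)
    qed
    then show ?thesis using that A(6) by (auto simp: T_def)
  qed
  have V_intro: "x / s \<in> V" if "x \<in> A" "s \<in> T" for x s
    unfolding V_def localization_at_def using that by (auto simp: T_def)
  have V_elim: "\<exists>x s. x \<in> A \<and> s \<in> T \<and> v = x / s" if "v \<in> V" for v
    using that unfolding V_def localization_at_def T_def by blast
  have AV: "x \<in> V" if "x \<in> A" for x using V_intro[OF that T1] by simp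
  have V_sub: "subring_set V"
    unfolding subring_set_def
  proof (intro conjI ballI)
    show "1 \<in> V" using AV A(2) by simp
    fix a b assume "a \<in> V" "b \<in> V"
    from V_elim[OF \<open>a \<in> V\<close>] obtain x s where xs: "x \<in> A" "s \<in> T" "a = x / s" by (elim exE conjE)
    from V_elim[OF \<open>b \<in> V\<close>] obtain y t where yt: "y \<in> A" "t \<in> T" "b = y / t" by (elim exE conjE)
    have "a - b = (x * t - y * s) / (s * t)" "a * b = (x * y) / (s * t)"
      using TA(2)[OF xs(2)] TA(2)[OF yt(2)] by (simp_all add: xs(3) yt(3) diff_frac_eq)
    then show "a - b \<in> V" "a * b \<in> V"
      using V_intro[OF _ T_mult[OF xs(2) yt(2)]] xs yt TA(1) A(5,6) by simp_all
  qed
  have max: "x / s \<in> max_ideal V \<longleftrightarrow> x \<in> pp" if xs: "x \<in> A" "s \<in> T" for x s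
  proof (cases "x \<in> pp")
    case True
    have "inverse (x / s) \<notin> V" if x0: "x \<noteq> 0"
    proof
      assume "inverse (x / s) \<in> V"
      from V_elim[OF this] obtain y t where yt: "y \<in> A" "t \<in> T" "inverse (x / s) = y / t"
        by (elim exE conjE)
      then have "s * t = y * x" using x0 TA(2)[OF yt(2)] by (simp add: field_simps)
      then have "s * t \<in> pp" using pp_mult[OF True yt(1)] by simp
      then show False using T_mult[OF xs(2) yt(2)] by (simp add: T_def)
    qed
    then show ?thesis using True V_intro[OF xs] by (auto simp: max_ideal_def)
  next
    case False
    then have "x \<in> T" using xs by (simp add: T_def)
    then have "inverse (x / s) \<in> V" "x / s \<noteq> 0"
      using V_intro[OF TA(1)[OF xs(2)]] TA(2)[OF xs(2)] TA(2)[of x] by simp_all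
    then show ?thesis using False by (simp add: max_ideal_def)
  qed
  have max_elim: "\<exists>x s. x \<in> pp \<and> s \<in> T \<and> v = x / s" if "v \<in> max_ideal V" for v
  proof -
    have "v \<in> V" using that by (simp add: max_ideal_def)
    from V_elim[OF this] obtain x s where "x \<in> A" "s \<in> T" "v = x / s" by (elim exE conjE)
    then show ?thesis using that max by (intro exI[of _ x] exI[of _ s]) simp
  qed
  have diff: "v - w \<in> max_ideal V" if vw: "v \<in> max_ideal V" "w \<in> max_ideal V" for v w
  proof -
    obtain x s where xs: "x \<in> pp" "s \<in> T" "v = x / s" using max_elim[OF vw(1)] by (elim exE conjE)
    obtain y t where yt: "y \<in> pp" "t \<in> T" "w = y / t" using max_elim[OF vw(2)] by (elim exE conjE)
    have "v - w = (t * x - s * y) / (s * t)"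
      using TA(2)[OF xs(2)] TA(2)[OF yt(2)] by (simp add: xs(3) yt(3) diff_frac_eq mult.commute)
    moreover have "t * x - s * y \<in> pp" by (intro pp_diff pp_mult xs(1) yt(1) TA(1) xs(2) yt(2))
    ultimately show ?thesis using max[OF ppA T_mult[OF xs(2) yt(2)]] by simp
  qed

  have closed: "w \<in> V" if w: "integral_over V w" for w
  proof -
    obtain n a where a: "\<forall>i<n. a i \<in> V" "w ^ n = (\<Sum>i<n. a i * w ^ i)"
      using w unfolding integral_over_def by (elim exE conjE)
    have "\<forall>i\<in>{..<n}. \<exists>s. s \<in> T \<and> s * a i \<in> A"
    proof
      fix i assume "i \<in> {..<n}"
      then have "a i \<in> V" using a(1) by simp
      from V_elim[OF this] obtain x s where "x \<in> A" "s \<in> T" "a i = x / s" by (elim exE conjE)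
      then show "\<exists>s. s \<in> T \<and> s * a i \<in> A" using TA(2)[of s] by (intro exI[of _ s]) simp
    qed
    from bchoice[OF this] obtain s where s: "\<forall>i\<in>{..<n}. s i \<in> T \<and> s i * a i \<in> A" by (rule exE)
    \<comment> \<open>\<open>t\<close> is a common denominator of the coefficients. Then
      \<open>t * w\<close> satisfies a monic equation over \<open>A\<close>, and by transitivity of
      integrality it is an algebraic integer.\<close>
    define t where "t = (\<Prod>i<n. s i)"
    have "prod s I \<in> T" if "I \<subseteq> {..<n}" for I
      using that
    proof (induction I rule: infinite_finite_induct)
      case (insert i I)
      then have "s i \<in> T" using s by simp
      then show ?case using insert T_mult[of "s i" "prod s I"] by simp
    qed (simp_all add: T1)
    then have tT: "t \<in> T" unfolding t_def by simp
    have ta: "t * a i \<in> A" if i: "i < n" for i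
    proof -
      have "t = s i * (\<Prod>j\<in>{..<n} - {i}. s j)" unfolding t_def using i by (intro prod.remove) auto
      moreover have "(\<Prod>j\<in>{..<n} - {i}. s j) \<in> A" using s TA(1) by (intro subring_set_prod[OF A_sub]) auto
      moreover have "s i * a i \<in> A" using s i by auto
      ultimately show ?thesis using A(6)[of "s i * a i" "\<Prod>j\<in>{..<n} - {i}. s j"] by (simp add: mult_ac)
    qed
    have "(t * w) ^ n = (\<Sum>i<n. (t * a i * t ^ (n - Suc i)) * (t * w) ^ i)"
      unfolding power_mult_distrib a(2) sum_distrib_left
    proof (rule sum.cong[OF refl])
      fix i assume "i \<in> {..<n}"
      then have "t ^ n = t ^ (Suc (n - Suc i) + i)" by simp
      then have "t ^ n = t * t ^ (n - Suc i) * t ^ i" by (simp only: power_add power_Suc)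
      then show "t ^ n * (a i * w ^ i) = t * a i * t ^ (n - Suc i) * (t ^ i * w ^ i)"
        by (simp add: mult_ac)
    qed
    moreover have "\<forall>i<n. t * a i * t ^ (n - Suc i) \<in> A"
      using ta TA(1)[OF tT] by (intro allI impI A(6)[OF _ subring_set_power[OF A_sub]])
    ultimately have tw: "integral_over A (t * w)" unfolding integral_over_def by (intro exI conjI)
    have "integral_over (range of_int) x" if "x \<in> A" for x
      using that by (simp add: A_def ring_of_integers_def algebraic_int_iff_integral)
    from integral_over_trans[OF subring_set_range_of_int this tw]
    have "integral_over (range of_int) (t * w)" .
    then have "t * w \<in> A" by (simp add: A_def ring_of_integers_def algebraic_int_iff_integral)
    from V_intro[OF this tT] show ?thesis using TA(2)[OF tT] by simp
  qed

  have char: "CHAR('a) = 0" using nf by (simp add: number_field_def)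
  have int0: "(of_int c :: 'a) = 0 \<longleftrightarrow> c = 0" for c
    using char by (simp add: of_int_eq_0_iff_char_dvd)
  obtain N where N: "qdim_bound TYPE('a) N" using number_field_qdim_bound[OF nf] by (rule exE)
  \<comment> \<open>Multiplied by \<open>2 ^ n\<close>, a monic integer equation for 1/2 would
    exhibit 1 as an even integer. Thus \<open>A\<close> is not a field, which excludes the zero
    ideal below.\<close>
  have half: "inverse 2 \<notin> A"
  proof
    assume "inverse 2 \<in> A"
    then have "integral_over (range of_int) (inverse 2 :: 'a)"
      by (simp add: A_def ring_of_integers_def algebraic_int_iff_integral)
    then obtain n a where a: "\<forall>i<n. a i \<in> range of_int" "(inverse 2 :: 'a) ^ n = (\<Sum>i<n. a i * inverse 2 ^ i)"
      unfolding integral_over_def by (elim exE conjE)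
    have "\<forall>i\<in>{..<n}. \<exists>c. a i = of_int c" using a(1) by auto
    from bchoice[OF this] obtain c where c: "\<forall>i\<in>{..<n}. a i = of_int (c i)" by (rule exE)
    have two: "(2 :: 'a) \<noteq> 0" using int0[of 2] by simp
    have "(1 :: 'a) = 2 ^ n * inverse 2 ^ n" using two by (simp flip: power_mult_distrib)
    also have "\<dots> = (\<Sum>i<n. of_int (2 * (c i * 2 ^ (n - Suc i))))"
      unfolding a(2) sum_distrib_left
    proof (rule sum.cong[OF refl])
      fix i assume i: "i \<in> {..<n}"
      then have "(2 :: 'a) ^ n = 2 ^ (Suc (n - Suc i) + i)" by simp
      then have "(2 :: 'a) ^ n = 2 * 2 ^ (n - Suc i) * 2 ^ i" by (simp only: power_add power_Suc)
      moreover have "(2 :: 'a) ^ i * inverse 2 ^ i = 1" using two by (simp flip: power_mult_distrib)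
      ultimately show "2 ^ n * (a i * inverse 2 ^ i) = (of_int (2 * (c i * 2 ^ (n - Suc i))) :: 'a)"
        using c i by (simp add: mult_ac)
    qed
    also have "\<dots> = of_int (2 * (\<Sum>i<n. c i * 2 ^ (n - Suc i)))"
      by (simp only: of_int_sum sum_distrib_left)
    finally have "(of_int (2 * (\<Sum>i<n. c i * 2 ^ (n - Suc i)) - 1) :: 'a) = 0"
      by (simp only: of_int_diff of_int_1 diff_self)
    then have "2 * (\<Sum>i<n. c i * 2 ^ (n - Suc i)) - 1 = 0" by (simp only: int0)
    then show False by presburger
  qed
  \<comment> \<open>If the maximal ideal were 0, the ideal of even elements would be 0 or all of
    \<open>A\<close>; 2 is neither 0 nor a unit.\<close>
  have "\<exists>a. a \<in> pp \<and> a \<noteq> 0"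
  proof (rule ccontr)
    assume "\<not> ?thesis"
    then have ppz: "pp = {0}" using pp0 by auto
    have "(2 :: 'a) \<in> A" using A(4)[OF A(2) A(2)] by simp
    define J where "J = {2 * a | a. a \<in> A}"
    have JA: "J \<subseteq> A" using A(6)[OF \<open>2 \<in> A\<close>] by (auto simp: J_def)
    have "J = PIdl\<^bsub>subring_of A\<^esub> 2"
      by (auto simp: J_def cgenideal_def subring_of_simps mult.commute)
    then have "ideal J (subring_of A)"
      using A.cgenideal_ideal[of 2] \<open>2 \<in> A\<close> by (simp add: subring_of_simps)
    moreover have "2 * 0 \<in> J" unfolding J_def using A(1) by blast
    ultimately have "J = pp \<or> J = A"
      using I_maximal[of J] JA ppz by (simp add: subring_of_simps)
    moreover have "2 * 1 \<in> J" unfolding J_def using A(2) by blast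
    moreover have two: "(2 :: 'a) \<noteq> 0" using int0[of 2] by simp
    ultimately have "J = A" using ppz by auto
    then have "1 \<in> J" using A(2) by simp
    then obtain a where "a \<in> A" "1 = 2 * a" unfolding J_def by blast
    have "inverse 2 = a" by (rule inverse_unique) (use \<open>1 = 2 * a\<close> in \<open>rule sym\<close>)
    then have "inverse 2 \<in> A" using \<open>a \<in> A\<close> by (simp only:)
    then show False using half by (rule notE[rotated])
  qed
  then obtain a where a: "a \<in> pp" "a \<noteq> 0" by (elim exE conjE)
  have "algebraic_int a" using ppA[OF a(1)] by (simp add: A_def ring_of_integers_def)
  then obtain f where f: "lead_coeff f = 1" "\<forall>i. poly.coeff f i \<in> \<int>" "poly f a = 0"
    by (auto elim: algebraic_int.cases)
  have "f \<noteq> 0" using f(1) by auto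
  \<comment> \<open>The lowest nonzero coefficient of a monic integer equation for \<open>a\<close>
    is a nonzero integer and a multiple of \<open>a\<close>.\<close>
  from poly_low_order[OF this f(2)[rule_format]] obtain j b h where
    h: "b \<noteq> 0" "b \<in> \<int>" "\<forall>i. poly.coeff h i \<in> \<int>" "\<forall>z. poly f z = z ^ j * (b + z * poly h z)"
    by (elim exE conjE)
  obtain c0 where c0: "b = of_int c0" using h(2) by (auto simp: Ints_def)
  have "b + a * poly h a = 0" using h(4) f(3) a(2) by simp
  then have b: "b = (- poly h a) * a" by (simp add: eq_neg_iff_add_eq_0 mult.commute)
  have "poly.coeff h i \<in> A" for i
  proof -
    obtain k where "poly.coeff h i = of_int k" using h(3) by (auto simp: Ints_def)
    then show ?thesis using subring_set_of_int[OF A_sub] by simp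
  qed
  then have "- poly h a \<in> A" using ppA[OF a(1)] by (intro A(3) poly_mem[OF A_sub])
  from pp_mult[OF a(1) this] have "of_int c0 \<in> pp" using b c0 by simp
  then have "of_int c0 \<in> max_ideal V" using max[OF ppA T1] by simp
  moreover have "c0 \<noteq> 0" using h(1) c0 by auto
  ultimately show ?thesis
    using finite_rank_dvr[OF V_sub closed diff N char] by (simp add: V_def A_def)
qed


section \<open>Reduction and minimality\<close>

context dvr
begin

lemma reduce_hom: "ring_hom_cring (subring_of V) (residue_field V) (reduce V)"
  and reduce_max_ideal: "x \<in> max_ideal V \<Longrightarrow> reduce V x = \<zero>\<^bsub>residue_field V\<^esub>"
proof -
  interpret R: cring "subring_of V" by (rule cring_subring_of[OF sub])
  have "max_ideal V = PIdl\<^bsub>subring_of V\<^esub> \<pi>"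
    by (auto simp: max_ideal_eq cgenideal_def subring_of_simps mult.commute)
  then have ideal: "ideal (max_ideal V) (subring_of V)"
    using R.cgenideal_ideal[of \<pi>] pi_mem by (simp add: subring_of_simps)
  have "reduce V = (+>\<^bsub>subring_of V\<^esub>) (max_ideal V)" by (simp add: reduce_def fun_eq_iff)
  then show "ring_hom_cring (subring_of V) (residue_field V) (reduce V)"
    using ideal.rcos_ring_hom_cring[OF ideal R.cring_axioms] by (simp add: residue_field_def)
  show "reduce V x = \<zero>\<^bsub>residue_field V\<^esub>" if "x \<in> max_ideal V"
    using R.a_rcos_zero[OF ideal that] by (simp add: reduce_def residue_field_def FactRing_def)
qed

lemma mp_eval_of_int_mem:
  assumes "\<And>\<mu> v. \<mu> \<in> Poly_Mapping.keys f \<Longrightarrow> v \<in> Poly_Mapping.keys \<mu> \<Longrightarrow> a v \<in> V"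
  shows "mp_eval of_int a f \<in> V"
  unfolding mp_eval_def
  by (intro subring_set_sum[OF sub] V_rules(6) subring_set_of_int[OF sub] subring_set_prod[OF sub]
      subring_set_power[OF sub] assms)

text \<open>The two evaluations use the operations of two different structures. Every partial
  product and sum lies in \<open>V\<close>, on which reduction is a ring homomorphism.\<close>

lemma int_eval_residue:
  assumes a: "\<And>\<mu> v. \<mu> \<in> Poly_Mapping.keys f \<Longrightarrow> v \<in> Poly_Mapping.keys \<mu> \<Longrightarrow> a v \<in> V"
  shows "int_eval (residue_field V) (\<lambda>v. reduce V (a v)) f = reduce V (mp_eval of_int a f)"
proof -
  let ?\<kappa> = "residue_field V" and ?r = "reduce V"
  interpret h: ring_hom_cring "subring_of V" ?\<kappa> ?r by (rule reduce_hom)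
  have closed: "?r x \<in> carrier ?\<kappa>" if "x \<in> V" for x
    using h.hom_closed[of x] that by (simp add: subring_of_simps)
  have mult: "?r (x * y) = ?r x \<otimes>\<^bsub>?\<kappa>\<^esub> ?r y" if "x \<in> V" "y \<in> V" for x y
    using h.hom_mult[of x y] that by (simp add: subring_of_simps)
  have add: "?r (x + y) = ?r x \<oplus>\<^bsub>?\<kappa>\<^esub> ?r y" if "x \<in> V" "y \<in> V" for x y
    using h.hom_add[of x y] that by (simp add: subring_of_simps)
  have one: "?r 1 = \<one>\<^bsub>?\<kappa>\<^esub>" using h.hom_one by (simp add: subring_of_simps)
  have zero: "?r 0 = \<zero>\<^bsub>?\<kappa>\<^esub>" using h.hom_zero by (simp add: subring_of_simps)
  have neg: "?r (- x) = \<ominus>\<^bsub>?\<kappa>\<^esub> ?r x" if "x \<in> V" for x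
  proof -
    have "?r (- x) \<oplus>\<^bsub>?\<kappa>\<^esub> ?r x = \<zero>\<^bsub>?\<kappa>\<^esub>"
      using add[of "- x" x] that V_rules(3) zero by simp
    then show ?thesis
      using h.S.minus_equality[of "?r (- x)" "?r x"] closed that V_rules(3) by simp
  qed
  have pow: "?r (x ^ k) = ?r x [^]\<^bsub>?\<kappa>\<^esub> k" if "x \<in> V" for x k
  proof (induction k)
    case (Suc k)
    then show ?case using mult[OF subring_set_power[OF sub that, of k] that]
      by (simp add: mult.commute)
  qed (simp add: one)
  have nat: "?r (of_nat k * x) = [k] \<cdot>\<^bsub>?\<kappa>\<^esub> ?r x" if "x \<in> V" for x k
  proof (induction k)
    case (Suc k)
    have "of_nat k * x \<in> V"
      using V_rules(6)[OF subring_set_of_int[OF sub, of "int k"] that] by simp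
    then show ?case using Suc add[of "of_nat k * x" x] that
      by (simp add: distrib_right add.commute)
  qed (simp add: zero)
  have int: "?r (of_int k * x) = [k] \<cdot>\<^bsub>?\<kappa>\<^esub> ?r x" if x: "x \<in> V" for x k
  proof (cases "k \<ge> 0")
    case True
    then show ?thesis using nat[OF x, of "nat k"] by (simp add: add_pow_int_ge)
  next
    case False
    define m where "m = nat (- k)"
    have k: "k = - int m" "k < 0" using False by (simp_all add: m_def)
    have mV: "of_nat m * x \<in> V"
      using V_rules(6)[OF subring_set_of_int[OF sub, of "int m"] x] by simp
    have "?r (of_int k * x) = ?r (- (of_nat m * x))" by (simp add: k(1))
    also have "\<dots> = \<ominus>\<^bsub>?\<kappa>\<^esub> ([m] \<cdot>\<^bsub>?\<kappa>\<^esub> ?r x)" by (simp only: neg[OF mV] nat[OF x])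
    also have "\<dots> = [k] \<cdot>\<^bsub>?\<kappa>\<^esub> ?r x" by (simp only: add_pow_int_lt[OF k(2)] m_def)
    finally show ?thesis .
  qed
  have prod: "(\<Otimes>\<^bsub>?\<kappa>\<^esub>v\<in>A. p v) = ?r (prod g A)"
    if "finite A" "\<And>v. v \<in> A \<Longrightarrow> g v \<in> V" "\<And>v. v \<in> A \<Longrightarrow> p v = ?r (g v)" for A g and p :: "'b \<Rightarrow> 'a set"
    using that
  proof (induction A rule: finite_induct)
    case (insert v A)
    have "(\<Otimes>\<^bsub>?\<kappa>\<^esub>v\<in>insert v A. p v) = p v \<otimes>\<^bsub>?\<kappa>\<^esub> (\<Otimes>\<^bsub>?\<kappa>\<^esub>v\<in>A. p v)"
      using insert.hyps insert.prems closed by (intro h.S.finprod_insert) auto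
    also have "\<dots> = ?r (g v * prod g A)"
      using insert by (simp add: mult subring_set_prod[OF sub])
    finally show ?case using insert.hyps by simp
  qed (simp add: one)
  have sum: "(\<Oplus>\<^bsub>?\<kappa>\<^esub>v\<in>A. p v) = ?r (sum g A)"
    if "finite A" "\<And>v. v \<in> A \<Longrightarrow> g v \<in> V" "\<And>v. v \<in> A \<Longrightarrow> p v = ?r (g v)" for A g and p :: "('b \<Rightarrow>\<^sub>0 nat) \<Rightarrow> 'a set"
    using that
  proof (induction A rule: finite_induct)
    case (insert v A)
    have "(\<Oplus>\<^bsub>?\<kappa>\<^esub>v\<in>insert v A. p v) = p v \<oplus>\<^bsub>?\<kappa>\<^esub> (\<Oplus>\<^bsub>?\<kappa>\<^esub>v\<in>A. p v)"
      using insert.hyps insert.prems closed by (intro h.S.finsum_insert) auto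
    also have "\<dots> = ?r (g v + sum g A)"
      using insert by (simp add: add subring_set_sum[OF sub])
    finally show ?case using insert.hyps by simp
  qed (simp add: zero)
  have mon: "(\<Prod>v\<in>Poly_Mapping.keys \<mu>. a v ^ Poly_Mapping.lookup \<mu> v) \<in> V"
    if "\<mu> \<in> Poly_Mapping.keys f" for \<mu>
    by (intro subring_set_prod[OF sub] subring_set_power[OF sub] a[OF that])
  show ?thesis
    unfolding int_eval_def mp_eval_def
  proof (rule sum)
    fix \<mu> assume \<mu>: "\<mu> \<in> Poly_Mapping.keys f"
    show "of_int (Poly_Mapping.lookup f \<mu>) * (\<Prod>v\<in>Poly_Mapping.keys \<mu>. a v ^ Poly_Mapping.lookup \<mu> v) \<in> V"
      by (intro V_rules(6) subring_set_of_int[OF sub] mon \<mu>)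
    have "(\<Otimes>\<^bsub>?\<kappa>\<^esub>v\<in>Poly_Mapping.keys \<mu>. ?r (a v) [^]\<^bsub>?\<kappa>\<^esub> Poly_Mapping.lookup \<mu> v)
      = ?r (\<Prod>v\<in>Poly_Mapping.keys \<mu>. a v ^ Poly_Mapping.lookup \<mu> v)"
      using a[OF \<mu>] by (intro prod) (simp_all add: pow subring_set_power[OF sub])
    then show "[Poly_Mapping.lookup f \<mu>] \<cdot>\<^bsub>?\<kappa>\<^esub>
        (\<Otimes>\<^bsub>?\<kappa>\<^esub>v\<in>Poly_Mapping.keys \<mu>. ?r (a v) [^]\<^bsub>?\<kappa>\<^esub> Poly_Mapping.lookup \<mu> v)
      = ?r (of_int (Poly_Mapping.lookup f \<mu>) * (\<Prod>v\<in>Poly_Mapping.keys \<mu>. a v ^ Poly_Mapping.lookup \<mu> v))"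
      by (simp only: int[OF mon[OF \<mu>]])
  qed simp
qed

end

section \<open>Presentations and their normalization\<close>

lemma coeffs_of_scale_forms:
  fixes F :: "nat \<Rightarrow> (nat, 'a::comm_ring_1) mpol"
  shows "coeffs_of (scale_forms c F) v = c * coeffs_of F v"
  by (cases v) (simp add: coeffs_of_def scale_forms_def lookup_mconst_mult)

lemma scale_scale_forms: "scale_forms b (scale_forms c F) = scale_forms (b * c) F"
  by (rule ext) (simp add: scale_forms_def mult.assoc[symmetric] mult_single)

lemma presentation_forms:
  assumes "presentation n \<Phi> F" "\<And>i. i \<le> n \<Longrightarrow> \<Phi> i \<in> forms UNIV n d" "i \<le> n"
  shows "F i \<in> forms UNIV n d"
proof -
  obtain \<Gamma> c where "\<forall>i\<le>n. F i = scale_forms c (conj_forms n \<Gamma> \<Phi>) i"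
    using assms(1) unfolding presentation_def by (elim exE conjE)
  then have "F i = scale_forms c (conj_forms n \<Gamma> \<Phi>) i" using assms(3) by simp
  also have "\<dots> \<in> forms UNIV n d"
    by (intro scale_forms_in_forms conj_forms_in_forms assms(2))
  finally show ?thesis .
qed

lemma invertible_mat_det:
  assumes "\<Gamma> \<in> carrier_mat m m" "invertible_mat \<Gamma>"
  shows "det (\<Gamma> :: 'a::field mat) \<noteq> 0"
proof -
  obtain B where B: "\<Gamma> * B = 1\<^sub>m m" "B * \<Gamma> = 1\<^sub>m (dim_row B)"
    using assms by (auto simp: invertible_mat_def inverts_mat_def)
  have "B \<in> carrier_mat m m"
  proof
    show "dim_col B = m" using arg_cong[OF B(1), of dim_col] by simp
    show "dim_row B = m" using arg_cong[OF B(2), of dim_col] assms(1) by simp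
  qed
  then have "det \<Gamma> * det B = 1" using B(1) assms(1) by (simp flip: det_mult)
  then show ?thesis by auto
qed

text \<open>The witness is \<open>w = c ^ (n + 1) * det \<Gamma> ^ (n + d)\<close>, the same for the
  resultant and for all invariants. The scalar \<open>b\<close> is kept free so that a normalizing
  one can be inserted later.\<close>

lemma presentation_scaling:
  assumes pres: "presentation n \<Phi> F" and "\<forall>i\<le>n. \<Phi> i \<in> forms UNIV n d" and d: "d \<ge> 1"
  shows "\<exists>w. w \<noteq> 0 \<and> (\<forall>b.
    resultant_of n d (scale_forms b F) ^ (n + 1)
      = (b ^ (n + 1) * w) ^ resultant_degree n d * resultant_of n d \<Phi> ^ (n + 1) \<and>
    (\<forall>f D. f \<in> SL_invariants n d \<longrightarrow> (\<forall>\<mu>\<in>Poly_Mapping.keys f. mon_degree \<mu> = D) \<longrightarrow>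
      mp_eval of_int (coeffs_of (scale_forms b F)) f ^ (n + 1)
        = (b ^ (n + 1) * w) ^ D * mp_eval of_int (coeffs_of \<Phi>) f ^ (n + 1)))"
proof -
  have \<Phi>: "\<Phi> i \<in> forms UNIV n d" if "i \<le> n" for i using assms(2) that by simp
  obtain \<Gamma> c where \<Gamma>: "\<Gamma> \<in> carrier_mat (n + 1) (n + 1)" "invertible_mat \<Gamma>" "c \<noteq> 0"
    and F: "\<forall>i\<le>n. F i = scale_forms c (conj_forms n \<Gamma> \<Phi>) i"
    using pres unfolding presentation_def by (elim exE conjE)
  have det: "det \<Gamma> \<noteq> 0" by (rule invertible_mat_det[OF \<Gamma>(1,2)])
  let ?E = "resultant_degree n d" and ?\<delta> = "det \<Gamma>"
  define w where "w = c ^ (n + 1) * ?\<delta> ^ (n + d)"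
  have "w \<noteq> 0" using \<Gamma>(3) det by (simp add: w_def)
  have W: "b ^ (n + 1) * w = (b * c) ^ (n + 1) * ?\<delta> ^ (n + d)" for b
    by (simp only: w_def power_mult_distrib mult.assoc)
  have bF: "scale_forms b F i = scale_forms (b * c) (conj_forms n \<Gamma> \<Phi>) i" if "i \<le> n" for b i
  proof -
    have "scale_forms b F i = scale_forms b (scale_forms c (conj_forms n \<Gamma> \<Phi>)) i"
      using F that by (simp add: scale_forms_def)
    then show ?thesis by (simp only: scale_scale_forms)
  qed
  have conj: "conj_forms n \<Gamma> \<Phi> i \<in> forms UNIV n d" for i by (intro conj_forms_in_forms \<Phi>)
  have 1: "resultant_of n d (scale_forms b F) ^ (n + 1) = (b ^ (n + 1) * w) ^ ?E * resultant_of n d \<Phi> ^ (n + 1)" for b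
  proof -
    have "resultant_of n d (scale_forms b F) = resultant_of n d (scale_forms (b * c) (conj_forms n \<Gamma> \<Phi>))"
      by (rule resultant_of_cong[OF bF d])
    also have "\<dots> = (b * c) ^ ?E * (?\<delta> ^ row_weight n d * resultant_of n d \<Phi>)"
      by (simp only: resultant_scale[OF d conj] resultant_conj[OF d \<Gamma>(1) det \<Phi>])
    finally have "resultant_of n d (scale_forms b F) ^ (n + 1)
        = ((b * c) ^ (n + 1)) ^ ?E * ?\<delta> ^ ((n + 1) * row_weight n d) * resultant_of n d \<Phi> ^ (n + 1)"
      by (simp only: power_mult_distrib mult.assoc mult.commute flip: power_mult)
    \<comment> \<open>By \<open>row_weight_eq\<close> the determinant occurs to the power
      \<open>(n + d) * E\<close>, so it combines with the scalar to a power of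
      \<open>b ^ (n + 1) * w\<close>.\<close>
    then show ?thesis
      unfolding row_weight_eq[OF d] W by (simp only: power_mult_distrib power_mult)
  qed
  have 2: "mp_eval of_int (coeffs_of (scale_forms b F)) f ^ (n + 1)
      = (b ^ (n + 1) * w) ^ D * mp_eval of_int (coeffs_of \<Phi>) f ^ (n + 1)"
    if f: "f \<in> SL_invariants n d" "\<forall>\<mu>\<in>Poly_Mapping.keys f. mon_degree \<mu> = D" for b f D
  proof -
    have inv: "mp_eval of_int (coeffs_of (conj_forms n \<Gamma> \<Phi>)) f ^ (n + 1)
        = (?\<delta> ^ (n + d)) ^ D * mp_eval of_int (coeffs_of \<Phi>) f ^ (n + 1)"
      by (rule SL_invariant_conj[OF f \<Gamma>(1) det \<Phi>])
    have "mp_eval of_int (coeffs_of (scale_forms b F)) f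
        = mp_eval of_int (coeffs_of (scale_forms (b * c) (conj_forms n \<Gamma> \<Phi>))) f"
      by (rule mp_eval_coeffs_cong[OF SL_invariants_mpols_in[OF f(1)] bF])
    also have "\<dots> = (b * c) ^ D * mp_eval of_int (coeffs_of (conj_forms n \<Gamma> \<Phi>)) f"
      by (rule mp_eval_scale_homogeneous[OF f(2)])
    finally have "mp_eval of_int (coeffs_of (scale_forms b F)) f ^ (n + 1)
        = ((b * c) ^ D) ^ (n + 1) * mp_eval of_int (coeffs_of (conj_forms n \<Gamma> \<Phi>)) f ^ (n + 1)"
      by (simp only: power_mult_distrib)
    also have "\<dots> = ((b * c) ^ (n + 1)) ^ D * ((?\<delta> ^ (n + d)) ^ D * mp_eval of_int (coeffs_of \<Phi>) f ^ (n + 1))"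
      unfolding inv
      by (simp only: mult.commute flip: power_mult)
    also have "\<dots> = (b ^ (n + 1) * w) ^ D * mp_eval of_int (coeffs_of \<Phi>) f ^ (n + 1)"
      unfolding W by (simp only: power_mult_distrib mult.assoc)
    finally show ?thesis .
  qed
  show ?thesis
    by (intro exI[of _ w] conjI allI impI \<open>w \<noteq> 0\<close> 1 2)
qed

text \<open>Conjugating back by the adjugate, a zero presentation would make all forms of
  \<open>\<Phi>\<close> zero, and the point with all coordinates 1 would be a common zero.\<close>

lemma presentation_nonzero:
  assumes \<Phi>: "proj_morphism n d \<Phi>" and pres: "presentation n \<Phi> F"
  shows "\<exists>v\<in>coeff_vars n d. coeffs_of F v \<noteq> 0"
proof (rule ccontr)
  assume n: "\<not> ?thesis"
  have forms: "\<Phi> i \<in> forms UNIV n d" if "i \<le> n" for i using \<Phi> that by (simp add: proj_morphism_def)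
  obtain \<Gamma> c where \<Gamma>: "\<Gamma> \<in> carrier_mat (n + 1) (n + 1)" "invertible_mat \<Gamma>" "c \<noteq> 0"
    and F: "\<forall>i\<le>n. F i = scale_forms c (conj_forms n \<Gamma> \<Phi>) i"
    using pres unfolding presentation_def by (elim exE conjE)
  have det: "det \<Gamma> \<noteq> 0" by (rule invertible_mat_det[OF \<Gamma>(1,2)])
  have F0: "F i = 0" if i: "i \<le> n" for i
  proof (rule poly_mapping_eqI)
    fix \<alpha>
    show "Poly_Mapping.lookup (F i) \<alpha> = Poly_Mapping.lookup 0 \<alpha>"
    proof (cases "\<alpha> \<in> Poly_Mapping.keys (F i)")
      case True
      then have "\<alpha> \<in> monoms n d" using presentation_forms[OF pres forms i] by (simp add: forms_def)
      then have "(i, \<alpha>) \<in> coeff_vars n d" using i by (simp add: coeff_vars_def)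
      then show ?thesis using n by (auto simp: coeffs_of_def)
    qed (simp add: in_keys_iff)
  qed
  have conj0: "conj_forms n \<Gamma> \<Phi> i = 0" if i: "i \<le> n" for i
  proof -
    have "scale_forms (inverse c) (scale_forms c (conj_forms n \<Gamma> \<Phi>)) i = 0"
      using F F0[OF i] i by (simp add: scale_forms_def)
    then show ?thesis using \<Gamma>(3) by (simp add: scale_scale_forms scale_forms_def)
  qed
  have "\<Phi> i = 0" if i: "i \<le> n" for i
  proof -
    define \<delta> where "\<delta> = det \<Gamma> ^ (n + d)"
    have "\<delta> \<noteq> 0" using det by (simp add: \<delta>_def)
    have "conj_forms n (adj_mat \<Gamma>) (conj_forms n \<Gamma> \<Phi>) i = conj_forms n (adj_mat \<Gamma>) (\<lambda>_. 0) i"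
      by (rule conj_forms_cong) (rule conj0)
    also have "\<dots> = 0" by (simp add: conj_forms_def mp_eval_def)
    finally have "scale_forms \<delta> \<Phi> i = 0" by (simp only: conj_forms_adj[OF forms i \<Gamma>(1) det] \<delta>_def)
    then have "scale_forms (inverse \<delta>) (scale_forms \<delta> \<Phi>) i = 0" by (simp add: scale_forms_def)
    then show ?thesis using \<open>\<delta> \<noteq> 0\<close> by (simp add: scale_scale_forms scale_forms_def)
  qed
  then have "\<forall>i\<le>n. mp_eval to_ac (\<lambda>_. 1) (\<Phi> i) = 0" by (simp add: mp_eval_def)
  then show False using \<Phi> unfolding proj_morphism_def by (metis le0 one_neq_zero)
qed

context dvr
begin

text \<open>Some coefficient becomes a unit after multiplication by \<open>c\<close>, and it is
  still integral after multiplication by \<open>b\<close>.\<close>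

lemma normalized_val_le:
  assumes "c \<noteq> 0" "normalized V n d (scale_forms c F)" "b \<noteq> 0" "normalized V n d (scale_forms b F)"
  shows "val c \<le> val b"
proof -
  obtain v where v: "v \<in> coeff_vars n d" "c * coeffs_of F v \<notin> max_ideal V"
    using assms(2) by (auto simp: normalized_def coeffs_of_scale_forms)
  have a0: "coeffs_of F v \<noteq> 0" using v(2) zero_in_max_ideal by auto
  have "val c + val (coeffs_of F v) \<le> 0"
    using v(2) a0 assms(1) max_ideal_iff_val[of "c * coeffs_of F v"] by (simp add: val_mult)
  moreover have "b * coeffs_of F v \<in> V"
    using v(1) assms(4) by (auto simp: normalized_def coeffs_of_scale_forms)
  then have "val b + val (coeffs_of F v) \<ge> 0"
    using a0 assms(3) mem_iff_val[of "b * coeffs_of F v"] by (simp add: val_mult)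
  ultimately show ?thesis by simp
qed

text \<open>Two normalizing scalars have the same valuation, and by homogeneity of the resultant
  they give the same order; a vanishing resultant has infinite order for each of them.\<close>

lemma resultant_exponent_eq:
  assumes d: "d \<ge> 1" and F: "\<And>i. i \<le> n \<Longrightarrow> F i \<in> forms UNIV n d"
    and c: "c \<noteq> 0" "normalized V n d (scale_forms c F)"
  shows "resultant_exponent V n d F = ord_at V (resultant_of n d (scale_forms c F))"
  unfolding resultant_exponent_def
proof (rule the_equality)
  show "\<exists>b. b \<noteq> 0 \<and> normalized V n d (scale_forms b F) \<and>
      ord_at V (resultant_of n d (scale_forms c F)) = ord_at V (resultant_of n d (scale_forms b F))"
    using c by (intro exI[of _ c] conjI refl)
next
  fix r assume "\<exists>b. b \<noteq> 0 \<and> normalized V n d (scale_forms b F) \<and> r = ord_at V (resultant_of n d (scale_forms b F))"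
  then obtain b where b: "b \<noteq> 0" "normalized V n d (scale_forms b F)" "r = ord_at V (resultant_of n d (scale_forms b F))"
    by (elim exE conjE)
  have val: "val b = val c"
    by (intro antisym normalized_val_le[OF b(1,2) c] normalized_val_le[OF c b(1,2)])
  show "r = ord_at V (resultant_of n d (scale_forms c F))"
  proof (cases "resultant_of n d F = 0")
    case True
    then show ?thesis by (simp add: b(3) resultant_scale[OF d F])
  next
    case False
    then show ?thesis
      using b(1) c(1) val by (simp add: b(3) resultant_scale[OF d F] ord_at_eq val_mult val_power)
  qed
qed

text \<open>Dividing by a coefficient of least valuation makes this coefficient 1 and the others
  integral.\<close>

lemma exists_normalized:
  assumes "\<exists>v\<in>coeff_vars n d. coeffs_of F v \<noteq> 0"
  shows "\<exists>c. c \<noteq> 0 \<and> normalized V n d (scale_forms c F)"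
proof -
  define S where "S = {v \<in> coeff_vars n d. coeffs_of F v \<noteq> 0}"
  define m where "m = Min ((\<lambda>v. val (coeffs_of F v)) ` S)"
  have S: "finite S" "S \<noteq> {}" using assms finite_coeff_vars by (auto simp: S_def)
  have "m \<in> (\<lambda>v. val (coeffs_of F v)) ` S" unfolding m_def using S by (intro Min_in) auto
  then obtain u where u: "u \<in> S" "val (coeffs_of F u) = m" by auto
  have u0: "coeffs_of F u \<noteq> 0" "u \<in> coeff_vars n d" using u(1) by (auto simp: S_def)
  have min: "m \<le> val (coeffs_of F v)" if "v \<in> S" for v
    unfolding m_def using that S(1) by (intro Min_le) auto
  define c where "c = inverse (coeffs_of F u)"
  have c: "c \<noteq> 0" "val c = - m" using u0(1) u(2) by (simp_all add: c_def val_inverse)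
  have "c * coeffs_of F v \<in> V" if v: "v \<in> coeff_vars n d" for v
  proof (cases "coeffs_of F v = 0")
    case True
    then show ?thesis using V_rules(1) by simp
  next
    case False
    then show ?thesis using min[of v] v c by (subst mem_iff_val) (simp_all add: val_mult S_def)
  qed
  moreover have "c * coeffs_of F u \<notin> max_ideal V"
    using u0(1) V_rules(2) by (simp add: c_def max_ideal_def)
  ultimately have "normalized V n d (scale_forms c F)"
    unfolding normalized_def coeffs_of_scale_forms using u0(2) by blast
  then show ?thesis using c(1) by blast
qed

theorem semistable_minimal:
  assumes d: "d \<ge> 1" and \<Phi>: "proj_morphism n d \<Phi>" and pres: "presentation n \<Phi> F"
    and ss: "semistable_at V n d F"
  shows "minimal_at V n d \<Phi> F"
  unfolding minimal_at_def
proof (intro allI impI)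
  fix F' assume pres': "presentation n \<Phi> F'"
  have forms: "\<Phi> i \<in> forms UNIV n d" if "i \<le> n" for i using \<Phi> that by (simp add: proj_morphism_def)
  then have forms_all: "\<forall>i\<le>n. \<Phi> i \<in> forms UNIV n d" by simp
  obtain b where b: "b \<noteq> 0" "normalized V n d (scale_forms b F)"
      "semistable_point (residue_field V) n d (\<lambda>v. reduce V (coeffs_of (scale_forms b F) v))"
    using ss unfolding semistable_at_def by (elim exE conjE)
  obtain f D where f: "f \<in> SL_invariants n d" and D: "D > 0" "\<forall>\<mu>\<in>Poly_Mapping.keys f. mon_degree \<mu> = D"
    and nz: "int_eval (residue_field V) (\<lambda>v. reduce V (coeffs_of (scale_forms b F) v)) f \<noteq> \<zero>\<^bsub>residue_field V\<^esub>"
    using b(3) unfolding semistable_point_def by (elim exE bexE conjE)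
  obtain b' where b': "b' \<noteq> 0" "normalized V n d (scale_forms b' F')"
    using exists_normalized[OF presentation_nonzero[OF \<Phi> pres']] by (elim exE conjE)
  have vars: "v \<in> coeff_vars n d" if "\<mu> \<in> Poly_Mapping.keys f" "v \<in> Poly_Mapping.keys \<mu>" for \<mu> v
    using f that by (auto simp: SL_invariants_def)
  have in_V: "mp_eval of_int (coeffs_of (scale_forms e G)) f \<in> V" if "normalized V n d (scale_forms e G)" for e G
    using that vars by (intro mp_eval_of_int_mem) (auto simp: normalized_def)
  define y where "y = mp_eval of_int (coeffs_of (scale_forms b F)) f"
  define y' where "y' = mp_eval of_int (coeffs_of (scale_forms b' F')) f"
  define z where "z = mp_eval of_int (coeffs_of \<Phi>) f"
  have "int_eval (residue_field V) (\<lambda>v. reduce V (coeffs_of (scale_forms b F) v)) f = reduce V y"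
    unfolding y_def using b(2) vars by (intro int_eval_residue) (auto simp: normalized_def)
  then have y: "y \<notin> max_ideal V" using nz reduce_max_ideal by auto
  then have y0: "y \<noteq> 0" using zero_in_max_ideal by auto
  have valy: "val y = 0"
    using y max_ideal_iff_val[OF y0] mem_iff_val[OF y0] in_V[OF b(2)] by (simp add: y_def)
  obtain w where w: "w \<noteq> 0" and
    *: "\<forall>b. resultant_of n d (scale_forms b F) ^ (n + 1)
      = (b ^ (n + 1) * w) ^ resultant_degree n d * resultant_of n d \<Phi> ^ (n + 1) \<and>
    (\<forall>f D. f \<in> SL_invariants n d \<longrightarrow> (\<forall>\<mu>\<in>Poly_Mapping.keys f. mon_degree \<mu> = D) \<longrightarrow>
      mp_eval of_int (coeffs_of (scale_forms b F)) f ^ (n + 1)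
        = (b ^ (n + 1) * w) ^ D * mp_eval of_int (coeffs_of \<Phi>) f ^ (n + 1))"
    using presentation_scaling[OF pres forms_all d] by (elim exE conjE)
  obtain w' where w': "w' \<noteq> 0" and
    **: "\<forall>b. resultant_of n d (scale_forms b F') ^ (n + 1)
      = (b ^ (n + 1) * w') ^ resultant_degree n d * resultant_of n d \<Phi> ^ (n + 1) \<and>
    (\<forall>f D. f \<in> SL_invariants n d \<longrightarrow> (\<forall>\<mu>\<in>Poly_Mapping.keys f. mon_degree \<mu> = D) \<longrightarrow>
      mp_eval of_int (coeffs_of (scale_forms b F')) f ^ (n + 1)
        = (b ^ (n + 1) * w') ^ D * mp_eval of_int (coeffs_of \<Phi>) f ^ (n + 1))"
    using presentation_scaling[OF pres' forms_all d] by (elim exE conjE)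
  define W where "W = b ^ (n + 1) * w"
  define W' where "W' = b' ^ (n + 1) * w'"
  have W0: "W \<noteq> 0" "W' \<noteq> 0" using w w' b(1) b'(1) by (simp_all add: W_def W'_def)
  define E where "E = resultant_degree n d"
  define \<rho> where "\<rho> = resultant_of n d \<Phi>"
  define x where "x = resultant_of n d (scale_forms b F)"
  define x' where "x' = resultant_of n d (scale_forms b' F')"
  have y_eq: "y ^ (n + 1) = W ^ D * z ^ (n + 1)" and x_eq: "x ^ (n + 1) = W ^ E * \<rho> ^ (n + 1)"
    using *[rule_format, of b] f D(2) by (auto simp: y_def W_def z_def x_def E_def \<rho>_def simp del: power_Suc)
  have y'_eq: "y' ^ (n + 1) = W' ^ D * z ^ (n + 1)" and x'_eq: "x' ^ (n + 1) = W' ^ E * \<rho> ^ (n + 1)"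
    using **[rule_format, of b'] f D(2) by (auto simp: y'_def W'_def z_def x'_def E_def \<rho>_def simp del: power_Suc)
  have val_eq: "int (n + 1) * val p = int k * val q + int (n + 1) * val r"
    if "p ^ (n + 1) = q ^ k * r ^ (n + 1)" "p \<noteq> 0" "q \<noteq> 0" "r \<noteq> 0" for p q r k
  proof -
    have "val (p ^ (n + 1)) = val (q ^ k) + val (r ^ (n + 1))"
      unfolding that(1) using that(3,4) by (intro val_mult) auto
    then show ?thesis by (simp only: val_power[OF that(2)] val_power[OF that(3)] val_power[OF that(4)])
  qed
  \<comment> \<open>The value at the semi-stable tuple is a unit, so \<open>f\<close> does not
    vanish at \<open>\<Phi>\<close>, nor then at the other tuple; all valuations below are therefore
    defined.\<close>
  have z0: "z \<noteq> 0"
  proof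
    assume "z = 0"
    then have "y ^ (n + 1) = 0" using y_eq by simp
    then show False using y0 by simp
  qed
  have "y' ^ (n + 1) \<noteq> 0" unfolding y'_eq using W0 z0 by simp
  then have y'0: "y' \<noteq> 0" by auto
  have "val y' \<ge> 0" using mem_iff_val[OF y'0] in_V[OF b'(2)] by (simp add: y'_def)
  then have "int (n + 1) * val y' \<ge> 0" by simp
  \<comment> \<open>Both sides are compared with the common term
    \<open>- int (n + 1) * val z\<close>.\<close>
  then have "int D * val W' \<ge> int D * val W"
    using val_eq[OF y_eq y0 W0(1) z0] val_eq[OF y'_eq y'0 W0(2) z0] valy by simp
  then have W: "val W \<le> val W'" using D(1) by simp
  have "ord_at V x \<le> ord_at V x'"
  proof (cases "\<rho> = 0")
    case True
    then have "x' ^ (n + 1) = 0" using x'_eq by simp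
    then have "x' = 0" by (metis power_not_zero)
    then show ?thesis by (simp add: ord_at_def)
  next
    case False
    then have "x ^ (n + 1) \<noteq> 0" "x' ^ (n + 1) \<noteq> 0" unfolding x_eq x'_eq using W0 by simp_all
    then have x0: "x \<noteq> 0" "x' \<noteq> 0" by auto
    have "int E * val W \<le> int E * val W'" using W by (simp add: mult_left_mono)
    then have "int (n + 1) * val x \<le> int (n + 1) * val x'"
      using val_eq[OF x_eq x0(1) W0(1) False] val_eq[OF x'_eq x0(2) W0(2) False] by simp
    then have "val x \<le> val x'" by simp
    then show ?thesis using x0 by (simp add: ord_at_eq)
  qed
  then show "resultant_exponent V n d F \<le> resultant_exponent V n d F'"
    using resultant_exponent_eq[OF d presentation_forms[OF pres forms] b(1,2)]
      resultant_exponent_eq[OF d presentation_forms[OF pres' forms] b']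
    by (simp add: x_def x'_def)
qed

end

theorem theorem3p3:
  fixes \<O> :: "'K::field set"
    and \<Phi> F :: "nat \<Rightarrow> (nat, 'K) mpol"
    and n d :: nat
  assumes closed_point:
      "(number_field TYPE('K) \<and>
        (\<exists>\<pp>. maximalideal \<pp> (subring_of (ring_of_integers :: 'K set)) \<and>
             \<O> = localization_at ring_of_integers \<pp>))
       \<or>
       (\<exists>k m x P. nonsingular_curve k m x \<and> P \<in> curve_points k m x \<and>
             \<O> = curve_local_ring k m x P)"
    and "n \<ge> 1" and "d \<ge> 1"
    and "proj_morphism n d \<Phi>"
    and "presentation n \<Phi> F"
    and "semistable_at \<O> n d F"
  shows "minimal_at \<O> n d \<Phi> F"
proof -
  \<comment> \<open>From here on the closed point enters only through this valuation.\<close>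
  have "\<exists>\<pi>. dvr \<O> \<pi>"
    using closed_point
  proof (elim disjE exE conjE)
    fix \<pp>
    assume "number_field TYPE('K)" "maximalideal \<pp> (subring_of (ring_of_integers :: 'K set))"
      "\<O> = localization_at ring_of_integers \<pp>"
    then show ?thesis by (simp only: number_field_dvr)
  next
    fix k m x P
    assume "nonsingular_curve k m x" "P \<in> curve_points k m x" "\<O> = curve_local_ring k m x P"
    then show ?thesis by (simp only: curve_dvr)
  qed
  then obtain \<pi> where "dvr \<O> \<pi>" by (rule exE)
  then show ?thesis by (rule dvr.semistable_minimal) (use assms in simp_all)
qed

end
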